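(* Let $K$ be an algebraically closed field complete with respect to a nontrivial non-Archimedean valuation $\nu:K\to\mathbb{T}=\mathbb{R}\cup\{-\infty\}$, and let $X$ be a closed algebraic subset of $\mathbb{A}^n=K^n$. Let $\mathcal{G}$ be the set of all linear embeddings of $X$, and let \[\pi=\varprojlim_{i\in\mathcal{G}}\pi_i : X^{an}\longrightarrow \varprojlim_{i\in\mathcal{G}} \mathrm{Trop}_i(X).\] Then (i) $\pi$ is surjective, and (ii) the restriction of $\pi$ to $X^{cl}$ is injective.
   Context: Conventions: $\nu(0)=-\infty$; $\mathbb{T}$ carries the topology extending that of $\mathbb{R}$ in which the neighbourhoods of $-\infty$ are the semi-infinite open intervals; $\nu:\mathbb{A}^N\to\mathbb{T}^N$ also denotes coordinatewise valuation. $z_1,\dots,z_n$ are the coordinates on $\mathbb{A}^n$ and $K[X]$ is the coordinate ring of $X$. $X^{an}$ (the Berkovich analytification) is the set of multiplicative seminorms $[\ ]_x$ on $K[X]$ compatible with $\nu$, i.e. $[a]_x=\exp(\nu(a))$ for $a\in K$, with the weakest topology making all maps $x\mapsto[f]_x$ continuous. $X^{cl}\subset X^{an}$ is the set of seminorms $[f]_x=\exp(\nu(f(x)))$ coming from closed points $x\in X$. A morphism $i:X\to\mathbb{A}^N$, $i(x)=(f_1(x),\dots,f_N(x))$, is linear if each $f_j$ is a $K$-linear combination of $z_1,\dots,z_n$ and $1$; a linear embedding is a linear morphism that is an isomorphism onto its image. For such $i$, $\mathrm{Trop}_i(X)=\nu(i(X))\subset\mathbb{T}^N$ is the linear tropicalization,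 and $\pi_i:X^{an}\to\mathbb{T}^N$ is $x\mapsto(\log[f_1]_x,\dots,\log[f_N]_x)$. $\mathcal{G}$ is partially ordered by: $i:X\to\mathbb{A}^N$ dominates $j:X\to\mathbb{A}^M$ if there is a morphism $\varphi:\mathbb{A}^N\to\mathbb{A}^M$ restricting to a homomorphism of tori $(K^* )^N\to(K^* )^M$, which is a composition of a linear embedding and a coordinate projection, with $\varphi\circ i=j$; such $\varphi$ induces a map $\mathrm{Trop}_i(X)\to\mathrm{Trop}_j(X)$, and the inverse limit is taken in topological spaces over this directed system.
   Formalization: Trop_i(X) is taken to be the closure of ν(i(X)) in T^N rather than ν(i(X)) itself, since when the value group is not all of R the map π_i sends some points of X^an outside ν(i(X)), so π would not be defined. *)

theory Defs
  imports "HOL-Analysis.Analysis" "HOL-Computational_Algebra.Polynomial"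
begin

definition aff :: "nat \<Rightarrow> (nat \<Rightarrow> 'a::zero) set" where
  "aff m = {x. \<forall>k\<ge>m. x k = 0}"

definition torus :: "nat \<Rightarrow> (nat \<Rightarrow> 'a::zero) set" where
  "torus m = {x \<in> aff m. \<forall>k<m. x k \<noteq> 0}"

inductive_set polyfun :: "nat \<Rightarrow> ((nat \<Rightarrow> 'a::comm_ring_1) \<Rightarrow> 'a) set" for m where
  const: "(\<lambda>x. c) \<in> polyfun m"
| var: "k < m \<Longrightarrow> (\<lambda>x. x k) \<in> polyfun m"
| add: "f \<in> polyfun m \<Longrightarrow> g \<in> polyfun m \<Longrightarrow> (\<lambda>x. f x + g x) \<in> polyfun m"
| mult: "f \<in> polyfun m \<Longrightarrow> g \<in> polyfun m \<Longrightarrow> (\<lambda>x. f x * g x) \<in> polyfun m"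

definition zariski_closed :: "nat \<Rightarrow> (nat \<Rightarrow> 'a::comm_ring_1) set \<Rightarrow> bool" where
  "zariski_closed m X \<longleftrightarrow> (\<exists>S \<subseteq> polyfun m. X = {x \<in> aff m. \<forall>f\<in>S. f x = 0})"

definition expT :: "ereal \<Rightarrow> real" where
  "expT t = (if t = -\<infinity> then 0 else exp (real_of_ereal t))"

definition logT :: "real \<Rightarrow> ereal" where
  "logT r = (if r = 0 then -\<infinity> else ereal (ln r))"

definition nonarch_valuation :: "('a::field \<Rightarrow> ereal) \<Rightarrow> bool" where
  "nonarch_valuation \<nu> \<longleftrightarrow>
     (\<forall>a. \<nu> a \<noteq> \<infinity>) \<and> (\<forall>a. \<nu> a = -\<infinity> \<longleftrightarrow> a = 0) \<and>
     (\<forall>a b. \<nu> (a * b) = \<nu> a + \<nu> b) \<and> (\<forall>a b. \<nu> (a + b) \<le> max (\<nu> a) (\<nu> b))"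

definition nontrivial_valuation :: "('a::field \<Rightarrow> ereal) \<Rightarrow> bool" where
  "nontrivial_valuation \<nu> \<longleftrightarrow> (\<exists>a. a \<noteq> 0 \<and> \<nu> a \<noteq> 0)"

definition valuation_complete :: "('a::field \<Rightarrow> ereal) \<Rightarrow> bool" where
  "valuation_complete \<nu> \<longleftrightarrow>
     (\<forall>s::nat \<Rightarrow> 'a. (\<forall>e>0. \<exists>N. \<forall>m\<ge>N. \<forall>k\<ge>N. expT (\<nu> (s m - s k)) < e) \<longrightarrow>
        (\<exists>L. \<forall>e>0. \<exists>N. \<forall>m\<ge>N. expT (\<nu> (s m - L)) < e))"

definition alg_closed :: "'a::field itself \<Rightarrow> bool" where
  "alg_closed _ \<longleftrightarrow> (\<forall>p::'a poly. degree p > 0 \<longrightarrow> (\<exists>x. poly p x = 0))"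

(* Berkovich analytification X^an: multiplicative seminorms on K[X] compatible with \<nu>.
   An element of K[X] is represented by a polynomial function on A^n, two of them being
   identified when they agree on X; the seminorm is extended by 0 outside polyfun n. *)
definition Xan :: "nat \<Rightarrow> ('a::field \<Rightarrow> ereal) \<Rightarrow> (nat \<Rightarrow> 'a) set
                   \<Rightarrow> (((nat \<Rightarrow> 'a) \<Rightarrow> 'a) \<Rightarrow> real) set" where
  "Xan n \<nu> X = {s.
     (\<forall>f. f \<notin> polyfun n \<longrightarrow> s f = 0) \<and>
     (\<forall>f\<in>polyfun n. \<forall>g\<in>polyfun n. (\<forall>x\<in>X. f x = g x) \<longrightarrow> s f = s g) \<and>
     (\<forall>f\<in>polyfun n. 0 \<le> s f) \<and>
     (\<forall>f\<in>polyfun n. \<forall>g\<in>polyfun n. s (\<lambda>x. f x * g x) = s f * s g) \<and>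
     (\<forall>f\<in>polyfun n. \<forall>g\<in>polyfun n. s (\<lambda>x. f x + g x) \<le> s f + s g) \<and>
     (\<forall>c. s (\<lambda>x. c) = expT (\<nu> c))}"

definition Xcl :: "nat \<Rightarrow> ('a::field \<Rightarrow> ereal) \<Rightarrow> (nat \<Rightarrow> 'a) set
                   \<Rightarrow> (((nat \<Rightarrow> 'a) \<Rightarrow> 'a) \<Rightarrow> real) set" where
  "Xcl n \<nu> X = (\<lambda>x. (\<lambda>f. if f \<in> polyfun n then expT (\<nu> (f x)) else 0)) ` X"

definition lin_map :: "nat \<Rightarrow> nat \<Rightarrow> ((nat \<Rightarrow> 'a::comm_ring_1) \<Rightarrow> nat \<Rightarrow> 'a) \<Rightarrow> bool" where
  "lin_map n N i \<longleftrightarrow>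
     (\<forall>k<N. \<exists>c a. \<forall>x. i x k = c + (\<Sum>j<n. a j * x j)) \<and> (\<forall>k\<ge>N. \<forall>x. i x k = 0)"

(* linear embedding: linear morphism that is an isomorphism onto its image,
   i.e. it has a polynomial inverse on its image *)
definition lin_emb :: "nat \<Rightarrow> (nat \<Rightarrow> 'a::comm_ring_1) set \<Rightarrow> nat
                       \<Rightarrow> ((nat \<Rightarrow> 'a) \<Rightarrow> nat \<Rightarrow> 'a) \<Rightarrow> bool" where
  "lin_emb n X N i \<longleftrightarrow> lin_map n N i \<and>
     (\<exists>g. (\<forall>j<n. g j \<in> polyfun N) \<and> (\<forall>x\<in>X. \<forall>j<n. g j (i x) = x j))"

definition coord_proj :: "nat \<Rightarrow> nat \<Rightarrow> ((nat \<Rightarrow> 'a::zero) \<Rightarrow> nat \<Rightarrow> 'a) \<Rightarrow> bool" where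
  "coord_proj L M p \<longleftrightarrow> (\<exists>\<tau>. inj_on \<tau> {..<M} \<and> \<tau> ` {..<M} \<subseteq> {..<L} \<and>
     (\<forall>y k. p y k = (if k < M then y (\<tau> k) else 0)))"

definition admissible :: "nat \<Rightarrow> nat \<Rightarrow> ((nat \<Rightarrow> 'a::field) \<Rightarrow> nat \<Rightarrow> 'a) \<Rightarrow> bool" where
  "admissible N M \<phi> \<longleftrightarrow>
     (\<exists>L e p. lin_emb N (aff N) L e \<and> coord_proj L M p \<and> \<phi> = p \<circ> e) \<and>
     \<phi> ` torus N \<subseteq> torus M \<and>
     (\<forall>y\<in>torus N. \<forall>z\<in>torus N. \<phi> (\<lambda>k. y k * z k) = (\<lambda>k. \<phi> y k * \<phi> z k))"

definition lin_embs :: "nat \<Rightarrow> (nat \<Rightarrow> 'a::field) set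
                        \<Rightarrow> (nat \<times> ((nat \<Rightarrow> 'a) \<Rightarrow> nat \<Rightarrow> 'a)) set" where
  "lin_embs n X = {(N, i). lin_emb n X N i}"

(* T^N, padded with -\<infinity>; topology: subspace of the product topology on nat \<Rightarrow> ereal *)
definition TT :: "nat \<Rightarrow> (nat \<Rightarrow> ereal) set" where
  "TT N = {t. \<forall>k. t k \<noteq> \<infinity> \<and> (k \<ge> N \<longrightarrow> t k = -\<infinity>)}"

definition nuv :: "('a \<Rightarrow> ereal) \<Rightarrow> (nat \<Rightarrow> 'a) \<Rightarrow> nat \<Rightarrow> ereal" where
  "nuv \<nu> y = (\<lambda>k. \<nu> (y k))"

definition Trop :: "('a \<Rightarrow> ereal) \<Rightarrow> (nat \<Rightarrow> 'a) set \<Rightarrow> nat \<Rightarrow> ((nat \<Rightarrow> 'a) \<Rightarrow> nat \<Rightarrow> 'a)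
                    \<Rightarrow> (nat \<Rightarrow> ereal) set" where
  "Trop \<nu> X N i = closure ((\<lambda>x. nuv \<nu> (i x)) ` X) \<inter> TT N"

definition induced_trop :: "('a::zero \<Rightarrow> ereal) \<Rightarrow> nat \<Rightarrow> nat \<Rightarrow> ((nat \<Rightarrow> 'a) \<Rightarrow> nat \<Rightarrow> 'a)
                            \<Rightarrow> ((nat \<Rightarrow> ereal) \<Rightarrow> nat \<Rightarrow> ereal) \<Rightarrow> bool" where
  "induced_trop \<nu> N M \<phi> \<psi> \<longleftrightarrow> continuous_on (TT N) \<psi> \<and> \<psi> ` TT N \<subseteq> TT M \<and>
     (\<forall>y\<in>aff N. \<psi> (nuv \<nu> y) = nuv \<nu> (\<phi> y))"

definition trop_limit :: "nat \<Rightarrow> ('a::field \<Rightarrow> ereal) \<Rightarrow> (nat \<Rightarrow> 'a) set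
     \<Rightarrow> ((nat \<times> ((nat \<Rightarrow> 'a) \<Rightarrow> nat \<Rightarrow> 'a)) \<Rightarrow> nat \<Rightarrow> ereal) set" where
  "trop_limit n \<nu> X = {t.
     (\<forall>g. g \<notin> lin_embs n X \<longrightarrow> t g = undefined) \<and>
     (\<forall>(N, i)\<in>lin_embs n X. t (N, i) \<in> Trop \<nu> X N i) \<and>
     (\<forall>(N, i)\<in>lin_embs n X. \<forall>(M, j)\<in>lin_embs n X. \<forall>\<phi> \<psi>.
        admissible N M \<phi> \<and> (\<forall>x\<in>X. \<phi> (i x) = j x) \<and> induced_trop \<nu> N M \<phi> \<psi>
        \<longrightarrow> t (M, j) = \<psi> (t (N, i)))}"

definition pi_i :: "nat \<Rightarrow> ((nat \<Rightarrow> 'a) \<Rightarrow> nat \<Rightarrow> 'a) \<Rightarrow> (((nat \<Rightarrow> 'a) \<Rightarrow> 'a) \<Rightarrow> real)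
                    \<Rightarrow> nat \<Rightarrow> ereal" where
  "pi_i N i s = (\<lambda>k. if k < N then logT (s (\<lambda>y. i y k)) else -\<infinity>)"

definition pi_lim :: "nat \<Rightarrow> (nat \<Rightarrow> 'a::field) set \<Rightarrow> (((nat \<Rightarrow> 'a) \<Rightarrow> 'a) \<Rightarrow> real)
                      \<Rightarrow> (nat \<times> ((nat \<Rightarrow> 'a) \<Rightarrow> nat \<Rightarrow> 'a)) \<Rightarrow> nat \<Rightarrow> ereal" where
  "pi_lim n X s = (\<lambda>g. if g \<in> lin_embs n X then pi_i (fst g) (snd g) s else undefined)"

end

theory Submission
  imports Defs "HOL-Library.Function_Algebras" "Subresultants.Resultant_Prelim"
begin

text \<open>
  Injectivity on closed points uses the coordinates \<open>z\<^sub>j - x\<^sub>j\<close>. A compatible family \<open>t\<close> is a limit of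
  valuations of points of \<open>X\<close> along each embedding; as embeddings are directed and the evaluation seminorms of
  these points stay in a compact box, they have a common limit, a seminorm mapping to \<open>t\<close>.

  That \<open>\<pi>\<close> takes values in the limit amounts to density: a multiplicative seminorm \<open>s\<close> on
  \<open>K[z\<^sub>1,\<dots>,z\<^sub>n]\<close> is approximated on finitely many polynomials by points killing \<open>ker s\<close>. This goes by
  induction on \<open>n\<close>, writing the ring as \<open>R[z]\<close>. Elimination by resultants and Newton polygons approximate two
  polynomials \<open>G, H\<close> at once. If \<open>z\<close> is algebraic over \<open>R\<close> modulo \<open>ker s\<close>, let \<open>G\<close> be a minimal relation;
  otherwise let \<open>G\<close> be the product of the given polynomials \<open>q\<^sub>k\<close>. Running \<open>H\<close> through many monomials
  \<open>\<Prod> q\<^sub>k\<^bsup>t^k\<^esup>\<close>, two of the resulting points near the same root of \<open>G\<close> give almost the same sizes to all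
  \<open>q\<^sub>k\<close>, and a Vandermonde argument shows that these sizes are the right ones.
\<close>

section \<open>Resultants and elimination\<close>

text \<open>As \<open>Trop\<close> is a closure, landing in the limit means that finitely many
  values of a seminorm can be matched by points of \<open>X\<close>, and only up to a logarithmic
  error: the values of the field are dense but need not be all reals. The obstacle is that one new
  variable has to match arbitrarily many polynomials. Two polynomials in one variable over
  \<open>R\<close> satisfy a relation over \<open>R\<close>, and by the ultrametric inequality two
  of its terms tie for the largest size; this is enough for a pair, but says nothing about a longer
  list. The product of a list can be matched, yet it does not determine its factors, hence the
  varying exponents. The points then depend on the exponent, and the number of roots of
  \<open>G\<close> bounds how many essentially different ones there are. Kernel elements must vanish
  exactly and not just approximately, since this keeps the points on \<open>X\<close>; so degrees
  are read modulo the kernel, and an algebraic \<open>z\<close> has to be specialized to an exact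
  root of its minimal relation.\<close>

lemma dvd_mult_no_common_root:
  fixes p q w :: "'a::field poly"
  assumes ac: "alg_closed TYPE('a)" and "p \<noteq> 0" "p dvd w * q" "\<And>a. poly p a = 0 \<Longrightarrow> poly q a \<noteq> 0"
  shows "p dvd w"
  using assms(2-)
proof (induction "degree p" arbitrary: p w)
  case 0
  then show ?case by (metis dvd_trans is_unit_iff_degree one_dvd)
next
  case (Suc d)
  then obtain a where a: "poly p a = 0" using ac unfolding alg_closed_def by (metis zero_less_Suc)
  then obtain p' where p': "p = [:-a,1:] * p'" by (metis dvdE poly_eq_0_iff_dvd)
  \<comment> \<open>A root of \<open>p\<close> is not one of \<open>q\<close>, so it is one of
    \<open>w\<close>: each linear factor of \<open>p\<close> comes off \<open>w\<close> as
    well.\<close>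
  have "poly w a * poly q a = 0" using Suc.prems(2) a by (metis dvdE poly_mult mult_zero_left)
  then have "poly w a = 0" using Suc.prems(3)[OF a] by simp
  then obtain w' where w': "w = [:-a,1:] * w'" by (metis dvdE poly_eq_0_iff_dvd)
  have p0: "p' \<noteq> 0" using p' Suc.prems(1) by auto
  have "degree p = Suc (degree p')" unfolding p' using p0 by (subst degree_mult_eq) auto
  then have d: "d = degree p'" using Suc.hyps(2) by simp
  have "[:-a,1:] * p' dvd [:-a,1:] * (w' * q)" using Suc.prems(2) by (simp only: p' w' mult.assoc)
  then have dv: "p' dvd w' * q" by (subst (asm) dvd_mult_cancel_left) auto
  have "p' dvd w'"
    by (rule Suc.hyps(1)[OF d p0 dv]) (use Suc.prems(3) p' in auto)
  then show ?case unfolding p' w' by (rule mult_dvd_mono[OF dvd_refl])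
qed

text \<open>The rows of the Sylvester matrix repackaged as shifts of \<open>p\<close> and
  \<open>q\<close>: a common root then gives a right kernel vector, and a left kernel vector gives a
  relation \<open>u * p + w * q = 0\<close>.\<close>

definition sylvester_row :: "'b::comm_ring_1 poly \<Rightarrow> 'b poly \<Rightarrow> nat \<Rightarrow> 'b poly" where
  "sylvester_row p q i = (if i < degree q then monom 1 (degree q - 1 - i) * p
     else monom 1 (degree p + degree q - 1 - i) * q)"

lemma sylvester_mat_row:
  assumes "i < degree p + degree q" "j < degree p + degree q"
  shows "sylvester_mat p q $$ (i,j) = coeff (sylvester_row p q i) (degree p + degree q - 1 - j)"
  using assms by (auto simp: sylvester_index_mat2 sylvester_row_def coeff_monom_mult Suc_diff_Suc)

lemma degree_sylvester_row:
  assumes "i < degree p + degree q"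
  shows "degree (sylvester_row p q i) < degree p + degree q"
proof -
  have "degree (monom (1::'a) k * r) \<le> k + degree r" for k and r :: "'a poly"
    using degree_mult_le[of "monom 1 k" r] degree_monom_le[of "1::'a" k] by linarith
  from this[of "degree q - 1 - i" p] this[of "degree p + degree q - 1 - i" q] assms
  show ?thesis by (auto simp: sylvester_row_def)
qed

lemma poly_sylvester_row:
  assumes "poly p z = 0" "poly q z = 0" shows "poly (sylvester_row p q i) z = 0"
  using assms by (simp add: sylvester_row_def)

lemma poly_eq_sum_lessThan:
  fixes p :: "'b::comm_ring_1 poly"
  assumes "degree p < N" shows "poly p z = (\<Sum>k<N. coeff p k * z ^ k)"
  unfolding poly_altdef
  by (rule sum.mono_neutral_left) (use assms in \<open>auto simp: coeff_eq_0\<close>)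

text \<open>Over any commutative ring, the powers of \<open>z\<close> form a right kernel vector of
  the Sylvester matrix. The adjugate turns this into \<open>resultant p q\<close> times that vector
  being zero, and its last entry is \<open>z ^ 0 = 1\<close>, so nothing has to be
  cancelled.\<close>

lemma resultant_common_root:
  fixes p q :: "'b::comm_ring_1 poly"
  assumes "poly p z = 0" "poly q z = 0" "degree p + degree q > 0"
  shows "resultant p q = 0"
proof -
  let ?N = "degree p + degree q"
  let ?A = "sylvester_mat p q"
  let ?v = "vec ?N (\<lambda>j. z ^ (?N - 1 - j))"
  have A: "?A \<in> carrier_mat ?N ?N" by (rule sylvester_carrier_mat)
  have v: "?v \<in> carrier_vec ?N" by simp
  have mult_zero: "B *\<^sub>v 0\<^sub>v ?N = 0\<^sub>v ?N" if "B \<in> carrier_mat ?N ?N" for B :: "'b mat"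
    by (rule eq_vecI) (use that in \<open>simp_all add: scalar_prod_def\<close>)
  have Av: "?A *\<^sub>v ?v = 0\<^sub>v ?N"
  proof (rule eq_vecI)
    fix i assume "i < dim_vec (0\<^sub>v ?N :: 'b vec)"
    then have i: "i < ?N" by simp
    have "vec_index (?A *\<^sub>v ?v) i = (\<Sum>j<?N. ?A $$ (i,j) * z ^ (?N - 1 - j))"
      using i by (simp add: scalar_prod_def atLeast0LessThan)
    also have "\<dots> = (\<Sum>j<?N. (\<lambda>k. coeff (sylvester_row p q i) k * z ^ k) (?N - Suc j))"
      using i by (intro sum.cong) (auto simp: sylvester_mat_row)
    also have "\<dots> = (\<Sum>k<?N. coeff (sylvester_row p q i) k * z ^ k)"
      by (rule sum.nat_diff_reindex)
    also have "\<dots> = poly (sylvester_row p q i) z"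
      by (rule poly_eq_sum_lessThan[symmetric, OF degree_sylvester_row[OF i]])
    finally show "vec_index (?A *\<^sub>v ?v) i = vec_index (0\<^sub>v ?N) i" using poly_sylvester_row[OF assms(1,2)] i by simp
  qed simp
  have "adj_mat ?A *\<^sub>v (?A *\<^sub>v ?v) = (adj_mat ?A * ?A) *\<^sub>v ?v"
    using assoc_mult_mat_vec[OF adj_mat(1)[OF A] A v] by simp
  also have "\<dots> = resultant p q \<cdot>\<^sub>v ?v"
    unfolding adj_mat(3)[OF A] resultant_def by (intro eq_vecI) auto
  finally have "resultant p q \<cdot>\<^sub>v ?v = 0\<^sub>v ?N"
    unfolding Av using mult_zero[OF adj_mat(1)[OF A]] by simp
  then have "vec_index (resultant p q \<cdot>\<^sub>v ?v) (?N - 1) = vec_index (0\<^sub>v ?N) (?N - 1)" by simp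
  then show ?thesis using assms(3) by simp
qed

text \<open>A left kernel vector splits into \<open>u\<close> and \<open>w\<close> with
  \<open>u * p + w * q = 0\<close> and \<open>degree w < degree p\<close>. Without a common root
  \<open>p\<close> divides \<open>w\<close>, so both cofactors are zero, and with them the
  vector.\<close>

lemma resultant_0_common_root:
  fixes p q :: "'a::field poly"
  assumes ac: "alg_closed TYPE('a)" and dp: "degree p > 0" and r: "resultant p q = 0"
  shows "\<exists>z. poly p z = 0 \<and> poly q z = 0"
proof (rule ccontr)
  assume nr: "\<not> ?thesis"
  let ?m = "degree p" and ?n = "degree q"
  let ?N = "?m + ?n"
  let ?A = "sylvester_mat p q"
  have A: "?A \<in> carrier_mat ?N ?N" by (rule sylvester_carrier_mat)
  then have At: "transpose_mat ?A \<in> carrier_mat ?N ?N" by simp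
  have "Determinant.det (transpose_mat ?A) = 0" using r det_transpose[OF A] by (simp add: resultant_def)
  then obtain v where v: "v \<in> carrier_vec ?N" "v \<noteq> 0\<^sub>v ?N" "transpose_mat ?A *\<^sub>v v = 0\<^sub>v ?N"
    using det_0_iff_vec_prod_zero_field[OF At] by auto
  define V where "V i = vec_index v i" for i
  define u where "u = (\<Sum>i<?n. monom (V i) (?n - 1 - i))"
  define w where "w = (\<Sum>i=?n..<?N. monom (V i) (?N - 1 - i))"
  define W where "W = (\<Sum>i<?N. Polynomial.smult (V i) (sylvester_row p q i))"
  have sums: "{..<?N} = {..<?n} \<union> {?n..<?N}" "{..<?n} \<inter> {?n..<?N} = {}" by auto
  have "W = u * p + w * q"
    unfolding W_def u_def w_def sums(1) sum_distrib_right
    by (subst sum.union_disjoint[OF _ _ sums(2)])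
       (auto simp: sylvester_row_def smult_monom simp flip: mult_smult_left intro!: arg_cong2[where f="(+)"] sum.cong)
  moreover have "W = 0"
  proof (rule poly_eqI)
    fix k
    show "coeff W k = coeff 0 k"
    proof (cases "k < ?N")
      case True
      define j where "j = ?N - 1 - k"
      have j: "j < ?N" "k = ?N - 1 - j" using True by (auto simp: j_def)
      have "coeff W k = (\<Sum>i<?N. ?A $$ (i,j) * V i)"
        unfolding W_def coeff_sum using j by (intro sum.cong) (auto simp: sylvester_mat_row)
      also have "\<dots> = vec_index (transpose_mat ?A *\<^sub>v v) j"
        using j v(1) by (simp add: scalar_prod_def atLeast0LessThan V_def)
      finally show ?thesis using v(3) j by simp
    next
      case False
      then have "coeff (sylvester_row p q i) k = 0" if "i < ?N" for i
        using degree_sylvester_row[OF that] by (intro coeff_eq_0) linarith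
      then show ?thesis unfolding W_def coeff_sum by simp
    qed
  qed
  ultimately have uw: "u * p = - (w * q)" by (simp add: add_eq_0_iff2)
  then have "p dvd w * q" by (metis dvd_minus_iff dvd_triv_right)
  moreover have "p \<noteq> 0" "\<And>a. poly p a = 0 \<Longrightarrow> poly q a \<noteq> 0" using nr dp by auto
  ultimately have "p dvd w" using dvd_mult_no_common_root[OF ac, of p w q] by simp
  moreover have "degree w < ?m"
    unfolding w_def using dp by (intro degree_sum_less) (auto intro: le_less_trans[OF degree_monom_le])
  ultimately have w0: "w = 0" by (metis dvd_imp_degree_le not_le)
  then have u0: "u = 0" using uw dp by auto
  have "V i = 0" if i: "i < ?N" for i
  proof (cases "i < ?n")
    case True
    have "coeff u (?n - 1 - i) = (\<Sum>k<?n. if k = i then V k else 0)"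
      unfolding u_def coeff_sum using True by (intro sum.cong) auto
    then show ?thesis using u0 True by simp
  next
    case False
    have "coeff w (?N - 1 - i) = (\<Sum>k=?n..<?N. if k = i then V k else 0)"
      unfolding w_def coeff_sum using False i by (intro sum.cong) auto
    then show ?thesis using w0 False i by simp
  qed
  then have "v = 0\<^sub>v ?N" using v(1) by (intro eq_vecI) (auto simp: V_def)
  then show False using v(2) by simp
qed

section \<open>Subrings and elimination of a variable\<close>

definition ring_closed :: "'r::comm_ring_1 set \<Rightarrow> bool" where
  "ring_closed S \<longleftrightarrow> 0 \<in> S \<and> 1 \<in> S \<and> (\<forall>a\<in>S. - a \<in> S) \<and> (\<forall>a\<in>S. \<forall>b\<in>S. a + b \<in> S \<and> a * b \<in> S)"

lemma ring_closed_sum: "ring_closed S \<Longrightarrow> (\<And>i. i \<in> A \<Longrightarrow> f i \<in> S) \<Longrightarrow> sum f A \<in> S"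
  by (induction A rule: infinite_finite_induct) (auto simp: ring_closed_def)

lemma ring_closed_prod: "ring_closed S \<Longrightarrow> (\<And>i. i \<in> A \<Longrightarrow> f i \<in> S) \<Longrightarrow> prod f A \<in> S"
  by (induction A rule: infinite_finite_induct) (auto simp: ring_closed_def)

lemma ring_closed_power: "ring_closed S \<Longrightarrow> a \<in> S \<Longrightarrow> a ^ n \<in> S"
  by (induction n) (auto simp: ring_closed_def)

text \<open>Subrings are sets and not types because the coefficient ring of the later induction is
  \<open>polyfun n\<close> with varying \<open>n\<close>, always inside the same function type;
  \<open>poly_over S\<close> plays the role of \<open>S[z]\<close>.\<close>

definition poly_over :: "'r::comm_ring_1 set \<Rightarrow> 'r poly set" where
  "poly_over S = {p. \<forall>i. coeff p i \<in> S}"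

lemma ring_closed_poly_over: "ring_closed S \<Longrightarrow> ring_closed (poly_over S)"
  unfolding ring_closed_def[of "poly_over S"]
  by (auto simp: poly_over_def coeff_mult ring_closed_def coeff_1 intro!: ring_closed_sum)

lemma poly_over_pCons: "ring_closed S \<Longrightarrow> pCons a p \<in> poly_over S \<longleftrightarrow> a \<in> S \<and> p \<in> poly_over S"
  by (auto simp: poly_over_def coeff_pCons ring_closed_def split: nat.splits)

lemma poly_over_const: "ring_closed S \<Longrightarrow> a \<in> S \<Longrightarrow> [:a:] \<in> poly_over S"
  by (auto simp: poly_over_def coeff_pCons ring_closed_def split: nat.splits)

lemma resultant_in_ring_closed:
  assumes S: "ring_closed S" and p: "p \<in> poly_over S" and q: "q \<in> poly_over S"
  shows "resultant p q \<in> S"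
proof -
  have e: "sylvester_mat p q $$ (i,j) \<in> S" if "i < degree p + degree q" "j < degree p + degree q" for i j
    using p q S by (auto simp: sylvester_index_mat[OF that] poly_over_def ring_closed_def)
  show ?thesis unfolding resultant_def det_def'[OF sylvester_carrier_mat]
  proof (rule ring_closed_sum[OF S])
    fix \<pi> assume "\<pi> \<in> {\<pi>. \<pi> permutes {0..<degree p + degree q}}"
    then have pi: "\<pi> i < degree p + degree q" if "i < degree p + degree q" for i
      using permutes_in_image[of \<pi> "{0..<degree p + degree q}" i] that by auto
    have "(\<Prod>i = 0..<degree p + degree q. sylvester_mat p q $$ (i, \<pi> i)) \<in> S"
      using pi by (intro ring_closed_prod[OF S] e) auto
    then show "signof \<pi> * (\<Prod>i = 0..<degree p + degree q. sylvester_mat p q $$ (i, \<pi> i)) \<in> S"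
      using S by (auto simp: sign_def ring_closed_def)
  qed
qed

text \<open>The inner polynomial variable receives \<open>F\<close>, the outer one
  \<open>T\<close>.\<close>

definition eval2 :: "('r::comm_ring_1 \<Rightarrow> 'b::comm_ring_1) \<Rightarrow> 'b \<Rightarrow> 'b \<Rightarrow> 'r poly poly \<Rightarrow> 'b" where
  "eval2 h F T P = poly (map_poly (\<lambda>q. poly (map_poly h q) F) P) T"

lemma eval2_const: "h 0 = 0 \<Longrightarrow> eval2 h F T [:[:c:]:] = h c"
  by (simp add: eval2_def Polynomial.map_poly_pCons)

lemma eval2_vars:
  assumes "h 0 = 0" "h 1 = 1" shows "eval2 h F T [:[:0,1:]:] = F" "eval2 h F T [:0,1:] = T"
  by (simp_all add: eval2_def assms Polynomial.map_poly_pCons)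

lemma comm_ring_hom_eval: "comm_ring_hom h \<Longrightarrow> comm_ring_hom (\<lambda>q. poly (map_poly h q) F)"
proof -
  assume "comm_ring_hom h"
  then interpret comm_ring_hom h .
  interpret m: map_poly_comm_ring_hom h ..
  show ?thesis by unfold_locales (auto simp: hom_distribs m.hom_mult m.hom_add)
qed

lemma comm_ring_hom_eval2: "comm_ring_hom h \<Longrightarrow> comm_ring_hom (eval2 h F T)"
  unfolding eval2_def[abs_def] by (intro comm_ring_hom_eval)

lemma degree_diff_const:
  fixes p :: "'b::comm_ring_1 poly" assumes "degree p > 0" shows "degree (p - [:c:]) = degree p"
  using degree_add_eq_left[of "- [:c:]" p] assms by (simp only: diff_conv_add_uminus) simp

lemma degree_map_poly_lead:
  assumes "h 0 = 0" "h (lead_coeff p) \<noteq> 0" shows "degree (map_poly h p) = degree p"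
  by (rule antisym[OF degree_map_poly_le]) (use assms in \<open>auto intro!: le_degree simp: coeff_map_poly\<close>)

text \<open>\<open>P\<close> is the resultant of \<open>G(y) - F\<close> and \<open>H(y) - T\<close>
  with \<open>F\<close> and \<open>T\<close> as new variables. The same formula serves both
  directions: with \<open>F\<close>, \<open>T\<close> specialized to \<open>G\<close>,
  \<open>H\<close> the original variable is a common root, and over a field, as long as both leading
  coefficients survive, a zero of \<open>P\<close> is a vanishing resultant and hence yields a
  common root.\<close>

lemma elimination:
  fixes G H :: "'r::comm_ring_1 poly"
  assumes S: "ring_closed S" and G: "G \<in> poly_over S" "degree G > 0" and H: "H \<in> poly_over S" "degree H > 0"
  shows "\<exists>P. P \<in> poly_over (poly_over S) \<and> eval2 (\<lambda>c. [:c:]) G H P = 0 \<and>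
    (\<forall>h :: 'r \<Rightarrow> 'a::field. \<forall>F T. alg_closed TYPE('a) \<longrightarrow> comm_ring_hom h \<longrightarrow> h (lead_coeff G) \<noteq> 0 \<longrightarrow>
      h (lead_coeff H) \<noteq> 0 \<longrightarrow> eval2 h F T P = 0 \<longrightarrow>
      (\<exists>z. poly (map_poly h G) z = F \<and> poly (map_poly h H) z = T))"
proof -
  define k where "k = (\<lambda>c::'r. [:[:c:]:])"
  define p where "p = map_poly k G - [:[:[:0,1:]:]:]"
  define q where "q = map_poly k H - [:[:0,1:]:]"
  define P where "P = resultant p q"
  have dk: "degree (map_poly k A) = degree A" for A
    by (cases "A = 0") (auto intro!: degree_map_poly_lead simp: k_def)
  have dp: "degree p = degree G" and dq: "degree q = degree H"
    using G(2) H(2) degree_diff_const[of "map_poly k G"] degree_diff_const[of "map_poly k H"]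
    by (simp_all add: dk p_def q_def)
  have ev: "map_poly (eval2 h F T) p = map_poly h G - [:F:]" "map_poly (eval2 h F T) q = map_poly h H - [:T:]"
    if h: "comm_ring_hom h" for h :: "'r \<Rightarrow> 'b::comm_ring_1" and F T
  proof -
    interpret h: comm_ring_hom h by (rule h)
    interpret e: comm_ring_hom "eval2 h F T" by (rule comm_ring_hom_eval2[OF h])
    interpret m: map_poly_comm_ring_hom "eval2 h F T" ..
    have "eval2 h F T (k c) = h c" for c by (simp add: k_def eval2_const)
    then have kk: "map_poly (eval2 h F T) (map_poly k A) = map_poly h A" for A
      by (subst map_poly_map_poly) (auto simp: k_def o_def)
    have v: "eval2 h F T [:[:0,1:]:] = F" "eval2 h F T [:0,1:] = T"
      by (simp_all add: eval2_vars)
    show "map_poly (eval2 h F T) p = map_poly h G - [:F:]" "map_poly (eval2 h F T) q = map_poly h H - [:T:]"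
      by (simp_all add: p_def q_def m.hom_minus kk v Polynomial.map_poly_pCons)
  qed
  \<comment> \<open>Surviving leading coefficients keep both degrees, hence the shape of the
    Sylvester matrix, so its determinant commutes with the specialization.\<close>
  have res: "resultant (map_poly h G - [:F:]) (map_poly h H - [:T:]) = eval2 h F T P"
    and deg: "degree (map_poly h G - [:F:]) = degree G" "degree (map_poly h H - [:T:]) = degree H"
    if h: "comm_ring_hom h" and l: "h (lead_coeff G) \<noteq> 0" "h (lead_coeff H) \<noteq> 0"
    for h :: "'r \<Rightarrow> 'b::comm_ring_1" and F T
  proof -
    interpret h: comm_ring_hom h by (rule h)
    have d: "degree (map_poly h G) = degree G" "degree (map_poly h H) = degree H"
      using l by (auto intro!: degree_map_poly_lead)
    then show deg: "degree (map_poly h G - [:F:]) = degree G" "degree (map_poly h H - [:T:]) = degree H"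
      using G(2) H(2) by (auto simp: degree_diff_const)
    show "resultant (map_poly h G - [:F:]) (map_poly h H - [:T:]) = eval2 h F T P"
      unfolding ev[OF h, of F T, symmetric] P_def
      by (rule comm_ring_hom.resultant_map_poly[OF comm_ring_hom_eval2[OF h]])
         (simp_all add: ev[OF h] deg dp dq)
  qed
  have SS: "ring_closed (poly_over (poly_over S))" by (intro ring_closed_poly_over S)
  have k: "map_poly k A \<in> poly_over (poly_over (poly_over S))" if "A \<in> poly_over S" for A
    using that S by (auto simp: poly_over_def k_def coeff_map_poly coeff_pCons ring_closed_def split: nat.splits)
  have S1: "ring_closed (poly_over S)" and S01: "0 \<in> S" "1 \<in> S" using S ring_closed_poly_over by (auto simp: ring_closed_def)
  have Z: "0 \<in> poly_over S" "0 \<in> poly_over (poly_over S)" "0 \<in> poly_over (poly_over (poly_over S))"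
    using S01 by (auto simp: poly_over_def)
  have O: "1 \<in> poly_over S" using S1 by (auto simp: ring_closed_def)
  have minus: "a - b \<in> X" if "ring_closed X" "a \<in> X" "b \<in> X" for a b and X :: "'r poly poly poly set"
    using that by (metis ring_closed_def diff_conv_add_uminus)
  have pq: "p \<in> poly_over (poly_over (poly_over S))" "q \<in> poly_over (poly_over (poly_over S))"
    by (simp_all add: p_def q_def minus[OF ring_closed_poly_over[OF SS]] k G H Z O S01 poly_over_pCons S S1 SS)
  show ?thesis
  proof (rule exI[of _ P], intro conjI allI impI)
    show "P \<in> poly_over (poly_over S)" unfolding P_def by (rule resultant_in_ring_closed[OF SS pq])
    have hC: "comm_ring_hom (\<lambda>c::'r. [:c:])" by unfold_locales (auto simp: one_pCons)
    have lC: "[:lead_coeff G:] \<noteq> 0" "[:lead_coeff H:] \<noteq> 0" using G H by auto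
    \<comment> \<open>Substituting the variable into \<open>A\<close> gives \<open>A\<close> back,
      so the variable is a root of \<open>A(y) - A\<close>.\<close>
    have rt: "poly (map_poly (\<lambda>c. [:c:]) A - [:A:]) [:0,1:] = 0" for A :: "'r poly"
      using pcompose_idR[of A] by (simp add: pcompose_altdef)
    show "eval2 (\<lambda>c. [:c:]) G H P = 0"
      unfolding res[OF hC lC, symmetric]
      by (rule resultant_common_root[OF rt rt]) (simp add: deg[OF hC lC] G)
  next
    fix h :: "'r \<Rightarrow> 'a" and F T
    assume ac: "alg_closed TYPE('a)" and h: "comm_ring_hom h" and l: "h (lead_coeff G) \<noteq> 0" "h (lead_coeff H) \<noteq> 0"
      and z: "eval2 h F T P = 0"
    show "\<exists>z. poly (map_poly h G) z = F \<and> poly (map_poly h H) z = T"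
      using resultant_0_common_root[OF ac _ res[OF h l, of F T, unfolded z]] by (auto simp: deg[OF h l] G)
  qed
qed

lemma eval2_sum:
  assumes "h 0 = 0" "degree P \<le> I" "\<And>i. degree (coeff P i) \<le> J"
  shows "eval2 h F T P = (\<Sum>i\<le>I. \<Sum>j\<le>J. h (coeff (coeff P i) j) * F ^ j * T ^ i)"
proof -
  have "degree (map_poly h (coeff P i)) < Suc J" for i
    using assms(3)[of i] degree_map_poly_le[of h "coeff P i"] by linarith
  moreover have "degree (map_poly (\<lambda>q. poly (map_poly h q) F) P) < Suc I"
    using assms(2) degree_map_poly_le[of "\<lambda>q. poly (map_poly h q) F" P] by linarith
  ultimately show ?thesis unfolding eval2_def
    by (simp add: poly_eq_sum_lessThan[where N="Suc J"] poly_eq_sum_lessThan[where N="Suc I"]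
        coeff_map_poly assms(1) lessThan_Suc_atMost sum_distrib_right del: sum.lessThan_Suc)
qed

section \<open>Polynomials with small values at integers\<close>

text \<open>Quantitative interpolation with a constant depending on \<open>N\<close> and
  \<open>M\<close> only. Division by a node \<open>t0\<close> produces the difference quotient;
  distinct integers are at least \<open>1\<close> apart, so its values at the other nodes are at
  most \<open>2 * \<delta>\<close>, and the induction hypothesis applies to it. The alternative
  \<open>U = 0\<close> covers \<open>N = 0\<close>.\<close>

lemma small_values_small_coeffs:
  "\<exists>C>0. \<forall>(U::real poly) S \<delta>. (U = 0 \<or> degree U < N) \<longrightarrow> S \<subseteq> {..M::nat} \<longrightarrow> N \<le> card S \<longrightarrow> 0 \<le> \<delta> \<longrightarrow>
     (\<forall>t\<in>S. \<bar>poly U (real t)\<bar> \<le> \<delta>) \<longrightarrow> (\<forall>k. \<bar>coeff U k\<bar> \<le> C * \<delta>)"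
proof (induction N)
  case 0
  show ?case by (rule exI[of _ 1]) auto
next
  case (Suc N)
  then obtain C where C: "C > 0" and IH: "\<forall>(U::real poly) S \<delta>. (U = 0 \<or> degree U < N) \<longrightarrow> S \<subseteq> {..M::nat} \<longrightarrow> N \<le> card S \<longrightarrow> 0 \<le> \<delta> \<longrightarrow>
     (\<forall>t\<in>S. \<bar>poly U (real t)\<bar> \<le> \<delta>) \<longrightarrow> (\<forall>k. \<bar>coeff U k\<bar> \<le> C * \<delta>)"
    by (elim exE conjE)
  show ?case
  \<comment> \<open>The constant bounds the coefficients of \<open>(x - t0) * Q + U(t0)\<close>:
    \<open>1\<close> for the value at \<open>t0\<close>, \<open>2 * C\<close> for the shifted
    \<open>Q\<close>, and \<open>M\<close> times \<open>2 * C\<close> for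
    \<open>t0 * Q\<close>.\<close>
  proof (rule exI[of _ "1 + 2 * C + M * (2 * C)"], intro conjI allI impI)
    show "0 < 1 + 2 * C + real M * (2 * C)" using C by (intro add_pos_nonneg) auto
    fix U :: "real poly" and S \<delta> k
    assume U: "U = 0 \<or> degree U < Suc N" and S: "S \<subseteq> {..M}" "Suc N \<le> card S" and d: "0 \<le> \<delta>"
      and v: "\<forall>t\<in>S. \<bar>poly U (real t)\<bar> \<le> \<delta>"
    have fS: "finite S" using S(1) finite_subset by blast
    obtain t0 where t0: "t0 \<in> S" using S(2) by fastforce
    define Q where "Q = synthetic_div U (real t0)"
    have UQ: "U = [:- real t0, 1:] * Q + [:poly U (real t0):]" unfolding Q_def by (rule synthetic_div_correct'[symmetric])
    have Q: "Q = 0 \<or> degree Q < N"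
    proof (cases "degree U")
      case 0
      then show ?thesis by (metis Q_def degree_0 synthetic_div_eq_0_iff)
    next
      case (Suc d)
      then show ?thesis using U by (auto simp: Q_def degree_synthetic_div)
    qed
    have Qv: "\<bar>poly Q (real t)\<bar> \<le> 2 * \<delta>" if t: "t \<in> S - {t0}" for t
    proof -
      have "poly U (real t) - poly U (real t0) = (real t - real t0) * poly Q (real t)"
        by (subst UQ) (simp add: algebra_simps)
      moreover have "\<bar>poly U (real t)\<bar> \<le> \<delta>" "\<bar>poly U (real t0)\<bar> \<le> \<delta>" using v t t0 by auto
      ultimately have "\<bar>real t - real t0\<bar> * \<bar>poly Q (real t)\<bar> \<le> 2 * \<delta>"
        unfolding abs_mult[symmetric] by linarith
      moreover have "1 * \<bar>poly Q (real t)\<bar> \<le> \<bar>real t - real t0\<bar> * \<bar>poly Q (real t)\<bar>"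
        using t by (intro mult_right_mono) auto
      ultimately show ?thesis by linarith
    qed
    have Qc: "\<bar>coeff Q k\<bar> \<le> C * (2 * \<delta>)" for k
      by (rule IH[rule_format, OF Q, of "S - {t0}"]) (use S t0 fS d Qv in auto)
    have "coeff U k = (case k of 0 \<Rightarrow> poly U (real t0) | Suc j \<Rightarrow> coeff Q j) - real t0 * coeff Q k"
      by (subst UQ) (auto simp: coeff_pCons split: nat.splits)
    moreover have "\<bar>case k of 0 \<Rightarrow> poly U (real t0) | Suc j \<Rightarrow> coeff Q j\<bar> \<le> \<delta> + C * (2 * \<delta>)"
      using v t0 Qc C d by (auto split: nat.splits intro: add_increasing add_increasing2)
    moreover have "\<bar>real t0 * coeff Q k\<bar> \<le> M * (C * (2 * \<delta>))"
      unfolding abs_mult using Qc[of k] t0 S by (intro mult_mono) auto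
    ultimately have "\<bar>coeff U k\<bar> \<le> \<delta> + C * (2 * \<delta>) + M * (C * (2 * \<delta>))" by linarith
    then show "\<bar>coeff U k\<bar> \<le> (1 + 2 * C + real M * (2 * C)) * \<delta>" by (simp add: algebra_simps)
  qed
qed

lemma pigeonhole_card_class:
  assumes "finite Z" "card Z \<le> m" "\<And>t. t \<in> {1..N * m + 1} \<Longrightarrow> cl t \<in> Z"
  shows "\<exists>z. N < card {t \<in> {1..N * m + 1}. cl t = z}"
proof (rule ccontr)
  assume "\<not> ?thesis"
  then have le: "card {t \<in> {1..N * m + 1}. cl t = z} \<le> N" for z by (simp add: not_less)
  have U: "{1..N * m + 1} = (\<Union>z\<in>Z. {t \<in> {1..N * m + 1}. cl t = z})" using assms(3) by auto
  have "N * m + 1 = card (\<Union>z\<in>Z. {t \<in> {1..N * m + 1}. cl t = z})" by (subst U[symmetric]) simp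
  also have "\<dots> \<le> (\<Sum>z\<in>Z. card {t \<in> {1..N * m + 1}. cl t = z})" by (rule card_UN_le[OF assms(1)])
  also have "\<dots> \<le> (\<Sum>z\<in>Z. N)" by (rule sum_mono) (rule le)
  also have "\<dots> \<le> N * m" using assms(2) by simp
  finally show False by simp
qed

text \<open>Each row \<open>u t\<close> is tested at its own node \<open>t\<close> only. Some class
  contains more than \<open>N\<close> nodes, and there all rows nearly agree; so the row of one
  representative, read as a polynomial of degree below \<open>N\<close>, is small at all these
  nodes, and interpolation bounds its coefficients.\<close>

lemma simultaneous_smallness:
  fixes N m :: nat and \<delta> :: real
  assumes "\<delta> > 0"
  shows "\<exists>\<delta>'>0. \<forall>(Z::'z set) cl u. finite Z \<longrightarrow> card Z \<le> m \<longrightarrow> (\<forall>t\<in>{1..N*m+1}. cl t \<in> Z) \<longrightarrow>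
     (\<forall>t\<in>{1..N*m+1}. \<bar>\<Sum>k<N. u t k * real t ^ k\<bar> \<le> \<delta>') \<longrightarrow>
     (\<forall>t\<in>{1..N*m+1}. \<forall>t'\<in>{1..N*m+1}. cl t = cl t' \<longrightarrow> (\<forall>k<N. \<bar>u t k - u t' k\<bar> \<le> \<delta>')) \<longrightarrow>
     (\<exists>t\<in>{1..N*m+1}. \<forall>k<N. \<bar>u t k\<bar> \<le> \<delta>)"
proof -
  define M where "M = N * m + 1"
  obtain C where C: "C > 0" and CC: "\<forall>(U::real poly) S \<delta>. (U = 0 \<or> degree U < N) \<longrightarrow> S \<subseteq> {..M::nat} \<longrightarrow> N \<le> card S \<longrightarrow> 0 \<le> \<delta> \<longrightarrow>
     (\<forall>t\<in>S. \<bar>poly U (real t)\<bar> \<le> \<delta>) \<longrightarrow> (\<forall>k. \<bar>coeff U k\<bar> \<le> C * \<delta>)"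
    using small_values_small_coeffs[of N M] by (elim exE conjE)
  \<comment> \<open>Two errors at a node: \<open>1\<close> for the given value,
    \<open>N * M ^ N\<close> for exchanging the row of \<open>t\<close> for that of
    \<open>t0\<close>.\<close>
  define D where "D = 1 + real N * real M ^ N"
  have D: "D > 0" unfolding D_def by (intro add_pos_nonneg) auto
  show ?thesis
  proof (rule exI[of _ "\<delta> / (C * D)"], intro conjI allI impI, goal_cases)
    case 1
    then show ?case using C D assms by simp
  next
    case (2 Z cl u)
    define \<delta>' where "\<delta>' = \<delta> / (C * D)"
    note A = 2[folded \<delta>'_def M_def]
    have d': "\<delta>' > 0" unfolding \<delta>'_def using C D assms by simp
    obtain z where z: "N < card {t \<in> {1..M}. cl t = z}"
      using pigeonhole_card_class[of Z m N cl] 2 unfolding M_def by blast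
    define S where "S = {t \<in> {1..M}. cl t = z}"
    have "S \<noteq> {}" using z unfolding S_def[symmetric] by auto
    then obtain t0 where t0: "t0 \<in> S" by blast
    define U where "U = (\<Sum>k<N. monom (u t0 k) k)"
    have cU: "coeff U k = (if k < N then u t0 k else 0)" for k
      unfolding U_def coeff_sum by (simp add: if_distrib cong: if_cong)
    have dU: "U = 0 \<or> degree U < N"
      by (metis cU leading_coeff_0_iff)
    have pU: "poly U x = (\<Sum>k<N. u t0 k * x ^ k)" for x
      unfolding U_def poly_sum by (simp add: poly_monom)
    have "\<bar>poly U (real t)\<bar> \<le> \<delta>' * D" if t: "t \<in> S" for t
    proof -
      have "poly U (real t) = (\<Sum>k<N. u t k * real t ^ k) + (\<Sum>k<N. (u t0 k - u t k) * real t ^ k)"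
        unfolding pU by (simp add: algebra_simps sum_subtractf flip: sum.distrib)
      moreover have "\<bar>\<Sum>k<N. u t k * real t ^ k\<bar> \<le> \<delta>'" using A(4) t by (auto simp: S_def)
      moreover have "\<bar>\<Sum>k<N. (u t0 k - u t k) * real t ^ k\<bar> \<le> (\<Sum>k<N. \<delta>' * real M ^ N)"
      proof (rule order_trans[OF sum_abs], rule sum_mono)
        fix k assume k: "k \<in> {..<N}"
        have "real t ^ k \<le> real M ^ k" using t by (intro power_mono) (auto simp: S_def)
        also have "\<dots> \<le> real M ^ N" using k by (intro power_increasing) (auto simp: M_def)
        finally have "real t ^ k \<le> real M ^ N" .
        moreover have "\<bar>u t0 k - u t k\<bar> \<le> \<delta>'" using A(5) t t0 k by (auto simp: S_def)
        ultimately show "\<bar>(u t0 k - u t k) * real t ^ k\<bar> \<le> \<delta>' * real M ^ N"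
          unfolding abs_mult using d' by (intro mult_mono) auto
      qed
      ultimately show ?thesis unfolding D_def by (simp add: algebra_simps)
    qed
    then have "\<bar>coeff U k\<bar> \<le> C * (\<delta>' * D)" for k
      by (intro CC[rule_format, OF dU, of S]) (use z d' D in \<open>auto simp: S_def\<close>)
    moreover have "C * (\<delta>' * D) = \<delta>" unfolding \<delta>'_def using C D by simp
    ultimately have "\<forall>k<N. \<bar>u t0 k\<bar> \<le> \<delta>" using cU by (metis (full_types))
    then show ?case using t0 unfolding M_def[symmetric] by (auto simp: S_def)
  qed
qed

section \<open>Algebraically closed valued fields\<close>

locale alg_closed_valued =
  fixes v :: "'a::field \<Rightarrow> real"
  assumes v_nonneg: "0 \<le> v a"
    and v_eq_0_iff [simp]: "v a = 0 \<longleftrightarrow> a = 0"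
    and v_mult: "v (a * b) = v a * v b"
    and v_add: "v (a + b) \<le> max (v a) (v b)"
    and v_nontrivial: "\<exists>a. a \<noteq> 0 \<and> v a \<noteq> 1"
    and alg_closed: "alg_closed TYPE('a)"
begin

lemma v_0 [simp]: "v 0 = 0" by simp

lemma v_pos: "a \<noteq> 0 \<Longrightarrow> 0 < v a" using v_nonneg[of a] by (simp add: less_le)

lemma v_1 [simp]: "v 1 = 1"
  using v_mult[of 1 1] v_pos[of 1] by simp

lemma v_power: "v (a ^ n) = v a ^ n" by (induction n) (auto simp: v_mult)

lemma v_minus [simp]: "v (- a) = v a"
proof -
  have "v (-1) * v (-1) = 1" using v_mult[of "-1" "-1"] by simp
  then have "v (-1) = 1" using v_nonneg[of "-1"] by (metis abs_of_nonneg abs_mult_self_eq mult_cancel_left2 real_sqrt_abs2 real_sqrt_one)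
  then show ?thesis using v_mult[of "-1" a] by simp
qed

lemma v_diff: "v (a - b) \<le> max (v a) (v b)"
  using v_add[of a "- b"] by simp

lemma v_diff_commute: "v (a - b) = v (b - a)"
  using v_minus[of "a - b"] by simp

lemma v_diff_eq: "v b < v a \<Longrightarrow> v (a - b) = v a"
  using v_diff[of a b] v_add[of "a - b" b] by (simp add: max_def split: if_splits)

lemma v_inverse: "v (inverse a) = inverse (v a)"
proof (cases "a = 0")
  case False
  then have "v a * v (inverse a) = 1" by (metis right_inverse v_1 v_mult)
  then show ?thesis by (metis inverse_unique)
qed simp

text \<open>The value group is divisible, because roots can be extracted: an \<open>n\<close>-th
  root of an element with \<open>v a > 1\<close> has a logarithm of at most \<open>\<delta>\<close>,
  and its integer powers come that close to any real number.\<close>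

lemma value_dense:
  assumes "\<delta> > 0" shows "\<exists>c. c \<noteq> 0 \<and> \<bar>ln (v c) - r\<bar> \<le> \<delta>"
proof -
  obtain a where a: "a \<noteq> 0" "v a > 1"
  proof -
    obtain a where a: "a \<noteq> 0" "v a \<noteq> 1" using v_nontrivial by blast
    show ?thesis
    proof (cases "v a > 1")
      case False
      then have "v (inverse a) > 1" using a v_pos[of a] by (simp add: v_inverse one_less_inverse_iff)
      then show ?thesis using that a(1) by (metis nonzero_imp_inverse_nonzero)
    qed (use that a in blast)
  qed
  define l where "l = ln (v a)"
  have l: "l > 0" using a unfolding l_def by simp
  obtain n :: nat where n: "n > 0" "l / n \<le> \<delta>"
  proof -
    obtain n :: nat where n: "l / \<delta> < real n" using reals_Archimedean2 by blast
    then have n0: "0 < real n" using l assms by (meson divide_pos_pos less_trans)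
    then have "l / n \<le> \<delta>" using n assms by (simp add: field_simps)
    then show ?thesis using that n0 by simp
  qed
  obtain b where b: "b ^ n = a"
  proof -
    have "degree (monom 1 n - [:a:]) = n" using n(1) by (subst degree_diff_const) (auto simp: degree_monom_eq)
    then obtain b where "poly (monom 1 n - [:a:]) b = 0"
      using alg_closed n(1) unfolding alg_closed_def by metis
    then show ?thesis using that by (simp add: poly_monom)
  qed
  have b0: "b \<noteq> 0" using a b n by (metis power_0_left not_gr_zero)
  define e where "e = ln (v b)"
  have e: "e = l / n" unfolding l_def e_def b[symmetric] v_power using n(1) v_pos[OF b0] by (simp add: ln_realpow)
  have e0: "e > 0" "e \<le> \<delta>" using e l n by auto
  define k where "k = \<lfloor>r / e\<rfloor>"
  define c where "c = (if k \<ge> 0 then b ^ nat k else inverse b ^ nat (- k))"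
  have "ln (v c) = k * e"
    unfolding c_def e_def using v_pos[OF b0] by (auto simp: v_power v_inverse ln_realpow ln_inverse)
  moreover have "k * e \<le> r" "r \<le> k * e + e"
  proof -
    have "real_of_int k \<le> r / e" "r / e \<le> real_of_int k + 1" unfolding k_def by linarith+
    then show "k * e \<le> r" "r \<le> k * e + e" using e0(1) by (simp_all add: field_simps)
  qed
  moreover have "c \<noteq> 0" unfolding c_def using b0 by simp
  ultimately show ?thesis using e0 by (intro exI[of _ c]) auto
qed

text \<open>Finitely many elements would bound the logarithms of the values, which are dense in the
  reals.\<close>

lemma infinite_field: "infinite (UNIV :: 'a set)"
proof
  assume f: "finite (UNIV :: 'a set)"
  define B where "B = Max ((\<lambda>c. ln (v c)) ` UNIV)"
  obtain c where "\<bar>ln (v c) - (B + 2)\<bar> \<le> 1" using value_dense[of 1 "B + 2"] by auto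
  moreover have "ln (v c) \<le> B" unfolding B_def using f by (intro Max_ge) auto
  ultimately show False by linarith
qed

abbreviation lin_prod :: "'a list \<Rightarrow> 'a poly" where
  "lin_prod as \<equiv> (\<Prod>a\<leftarrow>as. [:- a, 1:])"

lemma splits: "\<exists>as. p = Polynomial.smult (lead_coeff p) (lin_prod as)"
proof (induction "degree p" arbitrary: p)
  case 0
  then obtain c where "p = [:c:]" by (metis degree_eq_zeroE)
  then show ?case by (intro exI[of _ "[]"]) simp
next
  case (Suc d)
  then obtain a where "poly p a = 0" using alg_closed unfolding alg_closed_def by (metis zero_less_Suc)
  then obtain q where q: "p = [:-a,1:] * q" by (metis dvdE poly_eq_0_iff_dvd)
  then have "q \<noteq> 0" using Suc.hyps(2) by auto
  then have "degree p = Suc (degree q)" unfolding q by (subst degree_mult_eq) auto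
  then have "d = degree q" using Suc.hyps(2) by simp
  then obtain as where as: "q = Polynomial.smult (lead_coeff q) (lin_prod as)" using Suc.hyps(1) by blast
  define c where "c = lead_coeff q"
  have lc: "lead_coeff p = c" unfolding q c_def by (simp only: lead_coeff_mult) simp
  have pe: "p = Polynomial.smult c (lin_prod (a # as))"
    unfolding q as[folded c_def] by simp
  have "p = Polynomial.smult (lead_coeff p) (lin_prod (a # as))" unfolding lc by (rule pe)
  then show ?case by blast
qed

section \<open>Gauss norms and the Newton polygon\<close>

lemma poly_lin_prod: "poly (lin_prod as) z = (\<Prod>a\<leftarrow>as. z - a)"
  by (induction as) (auto simp: algebra_simps)

lemma v_prod_list: "v (prod_list xs) = prod_list (map v xs)"
  by (induction xs) (auto simp: v_mult)

lemma v_prod: "v (\<Prod>k\<in>A. f k) = (\<Prod>k\<in>A. v (f k))"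
  by (induction A rule: infinite_finite_induct) (auto simp: v_mult)

text \<open>The Gauss norm of radius \<open>r\<close> is multiplicative, with
  \<open>max r (v a)\<close> as the norm of \<open>z - a\<close>. This is the submultiplicative
  half.\<close>

lemma gauss_norm_upper:
  assumes "r > 0" shows "v (coeff (lin_prod as) k) * r ^ k \<le> (\<Prod>a\<leftarrow>as. max r (v a))"
proof (induction as arbitrary: k)
  case Nil
  then show ?case by (auto simp: coeff_1)
next
  case (Cons a as)
  define Q where "Q = lin_prod as"
  define G where "G = (\<Prod>a\<leftarrow>as. max r (v a))"
  have IH: "v (coeff Q k) * r ^ k \<le> G" for k using Cons unfolding Q_def G_def .
  have G0: "0 \<le> G" using IH[of 0] v_nonneg[of "coeff Q 0"] by simp
  define b where "b = (case k of 0 \<Rightarrow> 0 | Suc j \<Rightarrow> coeff Q j)"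
  have e: "coeff (lin_prod (a # as)) k = b - a * coeff Q k"
    unfolding Q_def b_def by (auto simp: coeff_pCons split: nat.splits)
  have "v b * r ^ k \<le> r * G"
  proof (cases k)
    case (Suc j)
    then have "v b * r ^ k = r * (v (coeff Q j) * r ^ j)" by (simp add: b_def)
    then show ?thesis using IH[of j] assms by simp
  qed (use assms G0 in \<open>auto simp: b_def\<close>)
  then have 1: "v b * r ^ k \<le> max r (v a) * G" using G0 by (meson max.cobounded1 mult_right_mono order_trans)
  have "v (a * coeff Q k) * r ^ k = v a * (v (coeff Q k) * r ^ k)" by (simp add: v_mult)
  also have "\<dots> \<le> max r (v a) * G" using IH[of k] v_nonneg assms by (intro mult_mono) (auto intro: mult_nonneg_nonneg v_nonneg)
  finally have 2: "v (a * coeff Q k) * r ^ k \<le> max r (v a) * G" .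
  have "v (b - a * coeff Q k) * r ^ k \<le> max (v b) (v (a * coeff Q k)) * r ^ k"
    using v_diff assms by (intro mult_right_mono) auto
  then show ?case unfolding e using 1 2 by (auto simp: G_def max_def split: if_splits)
qed

text \<open>The other half of multiplicativity. When a factor \<open>z - a\<close> is multiplied in,
  the right index avoids cancellation: for \<open>v a \<le> r\<close> the largest maximizing index
  of \<open>Q\<close> moves up by one, for \<open>v a > r\<close> any maximizing index stays where
  it is.\<close>

lemma gauss_norm_attained:
  assumes r: "r > 0" shows "\<exists>k. v (coeff (lin_prod as) k) * r ^ k = (\<Prod>a\<leftarrow>as. max r (v a))"
proof (induction as)
  case Nil
  show ?case by (intro exI[of _ 0]) auto
next
  case (Cons a as)
  define Q where "Q = lin_prod as"
  define G where "G = (\<Prod>a\<leftarrow>as. max r (v a))"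
  define A where "A = {k. v (coeff Q k) * r ^ k = G}"
  have U: "v (coeff Q k) * r ^ k \<le> G" for k using gauss_norm_upper[OF r] unfolding Q_def G_def .
  have G0: "G > 0" unfolding G_def using r by (induction as) (auto simp: max_def)
  have fA: "finite A"
    by (rule finite_subset[of _ "{..degree Q}"]) (use G0 in \<open>auto simp: A_def intro: le_degree\<close>)
  have nA: "A \<noteq> {}" using Cons unfolding A_def Q_def G_def by auto
  show ?case
  proof (cases "v a \<le> r")
    case True
    define k where "k = Max A"
    have k: "k \<in> A" "Suc k \<notin> A" unfolding k_def using fA nA by (auto dest: Max_ge)
    have "v (coeff Q (Suc k)) * r ^ Suc k < v (coeff Q k) * r ^ k" using U[of "Suc k"] k by (auto simp: A_def)
    then have "r * v (coeff Q (Suc k)) < v (coeff Q k)" using r by (simp add: algebra_simps)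
    moreover have "v a * v (coeff Q (Suc k)) \<le> r * v (coeff Q (Suc k))" using True v_nonneg by (intro mult_right_mono) auto
    ultimately have "v (coeff Q k - a * coeff Q (Suc k)) = v (coeff Q k)" by (intro v_diff_eq) (simp add: v_mult)
    then have "v (coeff (lin_prod (a # as)) (Suc k)) = v (coeff Q k)" by (simp add: Q_def)
    then have "v (coeff (lin_prod (a # as)) (Suc k)) * r ^ Suc k = r * G" using k by (simp add: A_def)
    then show ?thesis using True by (intro exI[of _ "Suc k"]) (simp add: G_def max_def)
  next
    case False
    obtain k where k: "k \<in> A" using nA by blast
    define b where "b = (case k of 0 \<Rightarrow> 0 | Suc j \<Rightarrow> coeff Q j)"
    have e: "coeff (lin_prod (a # as)) k = b - a * coeff Q k"
      unfolding Q_def b_def by (auto simp: coeff_pCons split: nat.splits)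
    have c0: "v (coeff Q k) > 0" using k G0 r by (auto simp: A_def zero_less_mult_iff)
    have "v b \<le> r * v (coeff Q k)"
    proof (cases k)
      case (Suc j)
      then have "v b * r ^ j \<le> (r * v (coeff Q k)) * r ^ j" using U[of j] k by (simp add: b_def A_def algebra_simps)
      then show ?thesis using r by simp
    qed (use r c0 in \<open>auto simp: b_def\<close>)
    also have "\<dots> < v a * v (coeff Q k)" using False c0 by simp
    finally have "v (a * coeff Q k - b) = v a * v (coeff Q k)" by (subst v_diff_eq) (auto simp: v_mult)
    then have "v (coeff (lin_prod (a # as)) k) * r ^ k = v a * G"
      unfolding e v_diff_commute[of b] using k by (simp add: A_def)
    then show ?thesis using False by (intro exI[of _ k]) (simp add: G_def max_def)
  qed
qed

text \<open>Two almost maximal coefficients at different indices mean an edge of the Newton polygon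
  with slope almost zero. Without a root in the annulus from \<open>1 / \<eta>\<close> to
  \<open>\<eta>\<close>, the Gauss norm grows exactly like \<open>r ^ n\<close> there, where
  \<open>n\<close> counts the roots of size below \<open>1\<close>. Its values at the two ends show
  that every coefficient except the \<open>n\<close>-th is at most
  \<open>M / \<eta>\<close>.\<close>

lemma root_near_unit:
  assumes eta: "\<eta> > 1" and M: "M > 0" and U: "\<And>k. v (coeff Q k) \<le> M"
    and ij: "i \<noteq> j" "v (coeff Q i) > M / \<eta>" "v (coeff Q j) > M / \<eta>"
  shows "\<exists>z. poly Q z = 0 \<and> 1 / \<eta> < v z \<and> v z < \<eta>"
proof (rule ccontr)
  assume nr: "\<not> ?thesis"
  define L where "L = lead_coeff Q"
  obtain as where as: "Q = Polynomial.smult L (lin_prod as)" unfolding L_def using splits by blast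
  have c: "coeff Q k = L * coeff (lin_prod as) k" for k by (subst as) simp
  have pz: "poly Q z = L * (\<Prod>a\<leftarrow>as. z - a)" for z by (subst as) (simp add: poly_lin_prod)
  have "\<forall>a\<in>set as. poly Q a = 0" unfolding pz by (auto simp: prod_list_zero_iff)
  then have gap: "\<forall>a\<in>set as. v a \<le> 1 / \<eta> \<or> \<eta> \<le> v a" using nr by (meson not_le)
  define n where "n = length (filter (\<lambda>a. v a < 1) as)"
  define G where "G = (\<Prod>a\<leftarrow>as. max 1 (v a))"
  \<comment> \<open>A root below the annulus contributes the radius, a root above it contributes its
    own size.\<close>
  have "(\<Prod>a\<leftarrow>as. max \<eta> (v a)) = \<eta> ^ n * G \<and> \<eta> ^ n * (\<Prod>a\<leftarrow>as. max (1 / \<eta>) (v a)) = G"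
    using gap unfolding n_def G_def
  proof (induction as)
    case (Cons a as)
    have "1 / \<eta> < 1" using eta by simp
    moreover have "v a \<le> 1 / \<eta> \<or> \<eta> \<le> v a" using Cons.prems by simp
    ultimately have "v a < 1 \<and> v a < \<eta> \<and> v a \<le> 1 / \<eta> \<or> \<not> v a < 1 \<and> \<eta> \<le> v a \<and> 1 / \<eta> \<le> v a" using eta by linarith
    then show ?case using Cons eta by (elim disjE) (auto simp: max_def)
  qed simp
  then have up: "(\<Prod>a\<leftarrow>as. max \<eta> (v a)) = \<eta> ^ n * G" and dn: "\<eta> ^ n * (\<Prod>a\<leftarrow>as. max (1 / \<eta>) (v a)) = G" by auto
  obtain k0 where "v (coeff (lin_prod as) k0) * 1 ^ k0 = G" unfolding G_def using gauss_norm_attained[of 1 as] by auto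
  then have LG: "v L * G \<le> M" using U[of k0] by (simp add: c v_mult)
  have "k = n" if k: "v (coeff Q k) > M / \<eta>" for k
  proof (rule ccontr)
    assume "k \<noteq> n"
    then consider "n < k" | "k < n" by linarith
    then show False
    proof cases
      case 1
      have "v (coeff Q k) * \<eta> ^ k = v L * (v (coeff (lin_prod as) k) * \<eta> ^ k)" by (simp add: c v_mult)
      also have "\<dots> \<le> v L * (\<eta> ^ n * G)"
        using gauss_norm_upper[of \<eta> as k] eta up v_nonneg by (intro mult_left_mono) auto
      also have "\<dots> \<le> M * \<eta> ^ n" using LG eta mult_right_mono[OF LG, of "\<eta> ^ n"] by (simp add: algebra_simps)
      finally have "v (coeff Q k) * \<eta> ^ (k - n) * \<eta> ^ n \<le> M * \<eta> ^ n" using 1 by (simp add: mult.assoc flip: power_add)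
      then have "v (coeff Q k) * \<eta> ^ (k - n) \<le> M" using eta by simp
      moreover have "v (coeff Q k) * \<eta> ^ 1 \<le> v (coeff Q k) * \<eta> ^ (k - n)"
        using 1 eta v_nonneg by (intro mult_left_mono power_increasing) auto
      ultimately show False using k eta by (simp add: field_simps)
    next
      case 2
      have "v (coeff Q k) * (1 / \<eta>) ^ k = v L * (v (coeff (lin_prod as) k) * (1 / \<eta>) ^ k)" by (simp add: c v_mult)
      also have "\<dots> \<le> v L * (\<Prod>a\<leftarrow>as. max (1 / \<eta>) (v a))"
        using gauss_norm_upper[of "1 / \<eta>" as k] eta v_nonneg by (intro mult_left_mono) auto
      finally have "v (coeff Q k) * (1 / \<eta>) ^ k * \<eta> ^ n \<le> v L * (\<Prod>a\<leftarrow>as. max (1 / \<eta>) (v a)) * \<eta> ^ n"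
        using eta by (intro mult_right_mono) auto
      also have "\<dots> = v L * G" unfolding dn[symmetric] by simp
      also have "(1 / \<eta>) ^ k * \<eta> ^ n = \<eta> ^ (n - k)" using 2 eta by (simp add: power_diff field_simps)
      then have "v (coeff Q k) * (1 / \<eta>) ^ k * \<eta> ^ n = v (coeff Q k) * \<eta> ^ (n - k)" by (simp add: mult.assoc)
      finally have "v (coeff Q k) * \<eta> ^ (n - k) \<le> M" using LG by linarith
      moreover have "v (coeff Q k) * \<eta> ^ 1 \<le> v (coeff Q k) * \<eta> ^ (n - k)"
        using 2 eta v_nonneg by (intro mult_left_mono power_increasing) auto
      ultimately show False using k eta by (simp add: field_simps)
    qed
  qed
  then show False using ij by blast
qed

text \<open>If \<open>b\<close> is the root nearest to \<open>z\<close>, then \<open>v (z - a) = max (v (z - b)) (v (b - a))\<close> for every root \<open>a\<close>.\<close>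

lemma v_poly_mono_nearest_root:
  assumes r: "\<And>a. poly p a = 0 \<Longrightarrow> v (z - b) \<le> v (z - a)" "\<And>a. poly p a = 0 \<Longrightarrow> v (z' - b) \<le> v (z' - a)"
    and le: "v (z - b) \<le> v (z' - b)"
  shows "v (poly p z) \<le> v (poly p z')"
proof -
  obtain as where as: "p = Polynomial.smult (lead_coeff p) (lin_prod as)" using splits by blast
  have pz: "poly p z = lead_coeff p * (\<Prod>a\<leftarrow>as. z - a)" for z by (subst as) (simp add: poly_lin_prod)
  have rt: "poly p a = 0" if "a \<in> set as" for a unfolding pz using that by (auto simp: prod_list_zero_iff)
  have "v (z - a) \<le> v (z' - a)" if a: "a \<in> set as" for a
  proof -
    have "v (z - a) \<le> max (v (z - b)) (v (b - a))" using v_add[of "z - b" "b - a"] by simp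
    moreover have "v (b - a) \<le> max (v (z' - a)) (v (z' - b))" using v_diff[of "z' - a" "z' - b"] by simp
    ultimately show ?thesis using r(2)[OF rt[OF a]] le by (simp add: max_def split: if_splits)
  qed
  then have "(\<Prod>a\<leftarrow>as. v (z - a)) \<le> (\<Prod>a\<leftarrow>as. v (z' - a))"
    by (induction as) (auto intro!: mult_mono prod_list_nonneg v_nonneg)
  then show ?thesis unfolding pz v_mult v_prod_list by (auto intro!: mult_left_mono v_nonneg simp: o_def)
qed

end

section \<open>Approximating a seminorm on a polynomial ring over a subring\<close>

text \<open>Here \<open>\<sigma>\<close> is a multiplicative seminorm on \<open>R[z]\<close>, whose restriction to \<open>R\<close> is a limit of the
  \<open>K\<close>-valued points \<open>Pts\<close> of \<open>R\<close>.\<close>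

locale approximable_ring = alg_closed_valued v for v :: "'a::field \<Rightarrow> real" +
  fixes R :: "'r::comm_ring_1 set" and \<sigma> :: "'r poly \<Rightarrow> real" and Pts :: "('r \<Rightarrow> 'a) set"
  assumes R: "ring_closed R"
    and Pts_hom: "h \<in> Pts \<Longrightarrow> comm_ring_hom h"
    and \<sigma>_nonneg: "p \<in> poly_over R \<Longrightarrow> 0 \<le> \<sigma> p"
    and \<sigma>_0 [simp]: "\<sigma> 0 = 0"
    and \<sigma>_1 [simp]: "\<sigma> 1 = 1"
    and \<sigma>_mult: "p \<in> poly_over R \<Longrightarrow> q \<in> poly_over R \<Longrightarrow> \<sigma> (p * q) = \<sigma> p * \<sigma> q"
    and \<sigma>_add: "p \<in> poly_over R \<Longrightarrow> q \<in> poly_over R \<Longrightarrow> \<sigma> (p + q) \<le> max (\<sigma> p) (\<sigma> q)"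
    and approx: "finite E \<Longrightarrow> E \<subseteq> R \<Longrightarrow> \<delta> > 0 \<Longrightarrow>
      \<exists>h\<in>Pts. (\<forall>a\<in>R. \<sigma> [:a:] = 0 \<longrightarrow> h a = 0) \<and>
        (\<forall>a\<in>E. \<sigma> [:a:] > 0 \<longrightarrow> h a \<noteq> 0 \<and> \<bar>ln (v (h a)) - ln (\<sigma> [:a:])\<bar> \<le> \<delta>)"
begin

section \<open>The seminorm modulo its kernel\<close>

abbreviation PR :: "'r poly set" where "PR \<equiv> poly_over R"

text \<open>Sizes are compared logarithmically, so that errors add up over products. All constants
  of size zero have to be killed, not only those in \<open>E\<close>.\<close>

definition near :: "'r set \<Rightarrow> real \<Rightarrow> ('r \<Rightarrow> 'a) \<Rightarrow> bool" where
  "near E \<delta> h \<longleftrightarrow> h \<in> Pts \<and> (\<forall>a\<in>R. \<sigma> [:a:] = 0 \<longrightarrow> h a = 0) \<and>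
     (\<forall>a\<in>E. \<sigma> [:a:] > 0 \<longrightarrow> h a \<noteq> 0 \<and> \<bar>ln (v (h a)) - ln (\<sigma> [:a:])\<bar> \<le> \<delta>)"

definition apx :: "real \<Rightarrow> ('r \<Rightarrow> 'a) \<Rightarrow> 'a \<Rightarrow> 'r poly \<Rightarrow> bool" where
  "apx \<delta> h z p \<longleftrightarrow> (\<sigma> p = 0 \<longrightarrow> poly (map_poly h p) z = 0) \<and>
     (\<sigma> p > 0 \<longrightarrow> poly (map_poly h p) z \<noteq> 0 \<and> \<bar>ln (v (poly (map_poly h p) z)) - ln (\<sigma> p)\<bar> \<le> \<delta>)"

text \<open>Such a leading coefficient survives every \<open>h\<close> that is \<open>near\<close> a
  set containing it, so the degree is kept and resultants can be specialized.\<close>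

definition nonnull_lead :: "'r poly \<Rightarrow> bool" where
  "nonnull_lead p \<longleftrightarrow> p \<in> PR \<and> \<sigma> [:lead_coeff p:] > 0"

lemma near_mono:
  assumes "near E \<delta> h" "E' \<subseteq> E" "\<delta> \<le> \<delta>'" shows "near E' \<delta>' h"
proof -
  have "h a \<noteq> 0 \<and> \<bar>ln (v (h a)) - ln (\<sigma> [:a:])\<bar> \<le> \<delta>'" if "a \<in> E'" "\<sigma> [:a:] > 0" for a
  proof -
    have "a \<in> E" using that assms by blast
    then have "h a \<noteq> 0 \<and> \<bar>ln (v (h a)) - ln (\<sigma> [:a:])\<bar> \<le> \<delta>" using assms(1) that(2) unfolding near_def by blast
    then show ?thesis using assms(3) by linarith
  qed
  then show ?thesis using assms(1) unfolding near_def by simp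
qed

lemma near_hom: "near E \<delta> h \<Longrightarrow> comm_ring_hom h" by (auto simp: near_def Pts_hom)

lemma ex_near: "finite E \<Longrightarrow> E \<subseteq> R \<Longrightarrow> \<delta> > 0 \<Longrightarrow> \<exists>h. near E \<delta> h"
  using approx[of E \<delta>] unfolding near_def Bex_def by simp

lemma R_closed: "0 \<in> R" "1 \<in> R" "a \<in> R \<Longrightarrow> - a \<in> R" "a \<in> R \<Longrightarrow> b \<in> R \<Longrightarrow> a + b \<in> R" "a \<in> R \<Longrightarrow> b \<in> R \<Longrightarrow> a * b \<in> R"
  using R by (auto simp: ring_closed_def)

lemma PR_ring_closed: "ring_closed PR" by (rule ring_closed_poly_over[OF R])

lemma PR_closed: "0 \<in> PR" "1 \<in> PR" "p \<in> PR \<Longrightarrow> - p \<in> PR" "p \<in> PR \<Longrightarrow> q \<in> PR \<Longrightarrow> p + q \<in> PR"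
    "p \<in> PR \<Longrightarrow> q \<in> PR \<Longrightarrow> p * q \<in> PR" "a \<in> R \<Longrightarrow> [:a:] \<in> PR" "p \<in> PR \<Longrightarrow> coeff p i \<in> R"
  using PR_ring_closed R by (auto simp: ring_closed_def[of PR] poly_over_const) (auto simp: poly_over_def)

lemma PR_diff: "p \<in> PR \<Longrightarrow> q \<in> PR \<Longrightarrow> p - q \<in> PR"
  using PR_closed(3,4) by (metis diff_conv_add_uminus)

lemma PR_monom: "a \<in> R \<Longrightarrow> monom a k \<in> PR"
  using R_closed by (auto simp: poly_over_def)

lemma PR_power: "p \<in> PR \<Longrightarrow> p ^ k \<in> PR"
  by (induction k) (auto intro: PR_closed)

lemma PR_prod: "(\<And>i. i \<in> A \<Longrightarrow> f i \<in> PR) \<Longrightarrow> prod f A \<in> PR"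
  by (rule ring_closed_prod[OF PR_ring_closed])

lemma PR_sum: "(\<And>i. i \<in> A \<Longrightarrow> f i \<in> PR) \<Longrightarrow> sum f A \<in> PR"
  by (rule ring_closed_sum[OF PR_ring_closed])

lemma \<sigma>_minus: "p \<in> PR \<Longrightarrow> \<sigma> (- p) = \<sigma> p"
proof -
  assume p: "p \<in> PR"
  have m: "- 1 \<in> PR" by (intro PR_closed)
  have "\<sigma> (- 1) * \<sigma> (- 1) = 1" using \<sigma>_mult[OF m m] by simp
  then have "\<sigma> (- 1) = 1" using \<sigma>_nonneg[OF m] by (metis abs_of_nonneg abs_mult_self_eq mult_cancel_left2 real_sqrt_abs2 real_sqrt_one)
  then show ?thesis using \<sigma>_mult[OF m p] by simp
qed

lemma \<sigma>_diff: "p \<in> PR \<Longrightarrow> q \<in> PR \<Longrightarrow> \<sigma> (p - q) \<le> max (\<sigma> p) (\<sigma> q)"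
  using \<sigma>_add[of p "- q"] by (simp add: \<sigma>_minus PR_closed)

lemma \<sigma>_power: "p \<in> PR \<Longrightarrow> \<sigma> (p ^ k) = \<sigma> p ^ k"
  by (induction k) (auto simp: \<sigma>_mult PR_power)

lemma \<sigma>_prod: "(\<And>i. i \<in> A \<Longrightarrow> f i \<in> PR) \<Longrightarrow> \<sigma> (prod f A) = (\<Prod>i\<in>A. \<sigma> (f i))"
  by (induction A rule: infinite_finite_induct) (auto simp: \<sigma>_mult PR_prod)

lemma \<sigma>_sum: "(\<And>i. i \<in> A \<Longrightarrow> f i \<in> PR) \<Longrightarrow> (\<And>i. i \<in> A \<Longrightarrow> \<sigma> (f i) \<le> B) \<Longrightarrow> 0 \<le> B \<Longrightarrow> \<sigma> (sum f A) \<le> B"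
proof (induction A rule: infinite_finite_induct)
  case (insert x F)
  then have "\<sigma> (f x + sum f F) \<le> max (\<sigma> (f x)) (\<sigma> (sum f F))" by (intro \<sigma>_add PR_sum) auto
  also have "\<dots> \<le> B" using insert by auto
  finally show ?case using insert by simp
qed auto

lemma \<sigma>_eq_of_diff_null: "p \<in> PR \<Longrightarrow> q \<in> PR \<Longrightarrow> \<sigma> (p - q) = 0 \<Longrightarrow> \<sigma> p = \<sigma> q"
  using \<sigma>_add[of "p - q" q] \<sigma>_diff[of p "p - q"] \<sigma>_nonneg[of p] \<sigma>_nonneg[of q] by (simp add: PR_diff)

lemma \<sigma>_null_coeffs:
  assumes p: "p \<in> PR" and c: "\<And>i. \<sigma> [:coeff p i:] = 0"
  shows "\<sigma> p = 0"
proof -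
  have "\<sigma> (\<Sum>i\<le>degree p. monom (coeff p i) i) \<le> 0"
  proof (rule \<sigma>_sum)
    fix i
    have "monom (coeff p i) i = [:coeff p i:] * monom 1 i" by (simp add: smult_monom)
    then show "\<sigma> (monom (coeff p i) i) \<le> 0" using c[of i] p R_closed
      by (metis PR_closed(6,7) PR_monom \<sigma>_mult mult_zero_left order_refl)
  qed (use p PR_monom PR_closed in auto)
  then show ?thesis using \<sigma>_nonneg[OF p] by (simp add: poly_as_sum_of_monoms)
qed

text \<open>Null leading terms are subtracted one by one, which stops at the index \<open>i\<close>
  at the latest.\<close>

lemma ex_nonnull_lead:
  assumes "p \<in> PR" "\<sigma> [:coeff p i:] > 0"
  shows "\<exists>q. nonnull_lead q \<and> \<sigma> (p - q) = 0 \<and> degree q \<le> degree p"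
  using assms
proof (induction "degree p" arbitrary: p rule: less_induct)
  case less
  show ?case
  proof (cases "\<sigma> [:lead_coeff p:] > 0")
    case True
    then show ?thesis using less.prems by (intro exI[of _ p]) (auto simp: nonnull_lead_def)
  next
    case False
    define r where "r = monom (lead_coeff p) (degree p)"
    have lz: "\<sigma> [:lead_coeff p:] = 0" using False \<sigma>_nonneg[OF PR_closed(6)[OF PR_closed(7)[OF less.prems(1), of "degree p"]]] by linarith
    have r: "r \<in> PR" unfolding r_def by (intro PR_monom PR_closed less.prems)
    have "r = [:lead_coeff p:] * monom 1 (degree p)" unfolding r_def by (simp add: smult_monom)
    then have sr: "\<sigma> r = 0" using lz less.prems R_closed by (simp only: \<sigma>_mult PR_closed PR_monom)
    have i: "i \<noteq> degree p" using less.prems(2) lz by auto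
    have pos: "degree p > 0"
    proof (rule ccontr)
      assume "\<not> degree p > 0"
      then have "coeff p i = 0" using i by (intro coeff_eq_0) auto
      then show False using less.prems(2) by simp
    qed
    have c: "coeff (p - r) j = (if j = degree p then 0 else coeff p j)" for j unfolding r_def by simp
    have "coeff (p - r) k = 0" if "k \<ge> degree p" for k
      unfolding c using that by (auto intro: coeff_eq_0)
    then have d: "degree (p - r) < degree p" using pos by (intro degree_lessI) auto
    have "p - r \<in> PR" "\<sigma> [:coeff (p - r) i:] > 0" unfolding c using less.prems r i by (auto simp: PR_diff)
    from less.hyps[OF d this] obtain q where q: "nonnull_lead q" "\<sigma> (p - r - q) = 0" "degree q \<le> degree (p - r)" by blast
    have qP: "q \<in> PR" using q by (auto simp: nonnull_lead_def)
    have "\<sigma> (p - q) = \<sigma> (p - r - q)"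
      by (rule \<sigma>_eq_of_diff_null) (use qP r less.prems sr in \<open>auto simp: PR_diff\<close>)
    then show ?thesis using q d by (intro exI[of _ q]) auto
  qed
qed

text \<open>The coefficient ring may have zero divisors; the product of the leading coefficients is
  nonzero because its seminorm is positive.\<close>

lemma nonnull_lead_mult:
  assumes p: "nonnull_lead p" and q: "nonnull_lead q" shows "nonnull_lead (p * q) \<and> degree (p * q) = degree p + degree q"
proof -
  have "[:lead_coeff p * lead_coeff q:] = [:lead_coeff p:] * [:lead_coeff q:]" by simp
  then have s: "\<sigma> [:lead_coeff p * lead_coeff q:] > 0"
    using p q by (simp only: nonnull_lead_def \<sigma>_mult PR_closed zero_less_mult_iff) auto
  then have "lead_coeff p * lead_coeff q \<noteq> 0" by auto
  then have "degree (p * q) = degree p + degree q"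
    by (intro antisym degree_mult_le le_degree) (simp add: coeff_mult_degree_sum)
  then show ?thesis using s p q by (auto simp: nonnull_lead_def coeff_mult_degree_sum PR_closed)
qed

lemma nonnull_lead_1: "nonnull_lead 1" by (auto simp: nonnull_lead_def PR_closed simp flip: one_pCons)

lemma nonnull_lead_power: "nonnull_lead p \<Longrightarrow> nonnull_lead (p ^ k) \<and> degree (p ^ k) = k * degree p"
  by (induction k) (auto simp: nonnull_lead_1 nonnull_lead_mult)

lemma nonnull_lead_prod: "finite A \<Longrightarrow> (\<And>i. i \<in> A \<Longrightarrow> nonnull_lead (f i)) \<Longrightarrow> nonnull_lead (prod f A) \<and> degree (prod f A) = (\<Sum>i\<in>A. degree (f i))"
  by (induction A rule: finite_induct) (auto simp: nonnull_lead_1 nonnull_lead_mult)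

text \<open>A unique largest term would be the difference of the null sum and of strictly smaller
  terms, against the ultrametric inequality. The term \<open>a0\<close> makes the maximum
  positive.\<close>

lemma tie:
  assumes A: "finite A" and f: "\<And>a. a \<in> A \<Longrightarrow> f a \<in> PR" and s: "\<sigma> (sum f A) = 0" and a0: "a0 \<in> A" "\<sigma> (f a0) > 0"
  shows "\<exists>a\<in>A. \<exists>b\<in>A. a \<noteq> b \<and> \<sigma> (f a) = \<sigma> (f b) \<and> \<sigma> (f a) > 0 \<and> (\<forall>c\<in>A. \<sigma> (f c) \<le> \<sigma> (f a))"
proof (rule ccontr)
  assume n: "\<not> ?thesis"
  define M where "M = Max ((\<lambda>a. \<sigma> (f a)) ` A)"
  have "M \<in> (\<lambda>a. \<sigma> (f a)) ` A" unfolding M_def using A a0 by (intro Max_in) auto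
  then obtain a where a: "a \<in> A" "\<sigma> (f a) = M" by auto
  have le: "\<sigma> (f c) \<le> M" if "c \<in> A" for c unfolding M_def using A that by (intro Max_ge) auto
  have M0: "M > 0" using le[OF a0(1)] a0(2) by simp
  have lt: "\<sigma> (f c) < M" if "c \<in> A - {a}" for c
    using n a le that M0 by (metis DiffE insertI1 less_le)
  define B where "B = Max (insert 0 ((\<lambda>a. \<sigma> (f a)) ` (A - {a})))"
  have B: "B < M" unfolding B_def using A lt M0 by (subst Max_less_iff) auto
  have "\<sigma> (sum f (A - {a})) \<le> B" unfolding B_def
    by (rule \<sigma>_sum) (use A f in \<open>auto intro!: Max_ge\<close>)
  moreover have "f a = sum f A - sum f (A - {a})" using A a by (simp add: sum.remove)
  then have "\<sigma> (f a) \<le> max (\<sigma> (sum f A)) (\<sigma> (sum f (A - {a})))" using f by (metis DiffD1 PR_sum \<sigma>_diff)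
  ultimately show False using s B M0 a by auto
qed

text \<open>Needed for \<open>\<sigma> G = 0\<close>, where only monomials free of \<open>F\<close>
  can have positive size. If their coefficients were all null, \<open>P(0,T)\<close> would vanish
  after specialization for every \<open>T\<close>, making each element of the infinite field a value
  of \<open>H\<close> at one of finitely many roots of \<open>G\<close>.\<close>

lemma exists_nonnull_constant_row:
  assumes G: "nonnull_lead G" "degree G > 0" and H: "nonnull_lead H"
    and P: "P \<in> poly_over PR"
    and lift: "\<And>(h :: 'r \<Rightarrow> 'a) F T. comm_ring_hom h \<Longrightarrow> h (lead_coeff G) \<noteq> 0 \<Longrightarrow> h (lead_coeff H) \<noteq> 0 \<Longrightarrow>
      eval2 h F T P = 0 \<Longrightarrow> \<exists>z. poly (map_poly h G) z = F \<and> poly (map_poly h H) z = T"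
  shows "\<exists>i. \<sigma> [:coeff (coeff P i) 0:] > 0"
proof (rule ccontr)
  assume n: "\<not> ?thesis"
  have cR: "coeff (coeff P i) j \<in> R" for i j using P by (auto simp: poly_over_def)
  have null: "\<sigma> [:coeff (coeff P i) 0:] = 0" for i
    using n \<sigma>_nonneg[OF PR_closed(6)[OF cR, of i 0]] by (metis less_le)
  have lR: "lead_coeff G \<in> R" "lead_coeff H \<in> R" using G H by (auto simp: nonnull_lead_def PR_closed)
  obtain h where h: "near {lead_coeff G, lead_coeff H} 1 h"
    using ex_near[of "{lead_coeff G, lead_coeff H}" 1] lR by auto
  interpret h: comm_ring_hom h by (rule near_hom[OF h])
  have l: "h (lead_coeff G) \<noteq> 0" "h (lead_coeff H) \<noteq> 0" using h G H by (auto simp: near_def nonnull_lead_def)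
  have "h (coeff (coeff P i) 0) = 0" for i using h null cR by (auto simp: near_def)
  then have z: "map_poly (\<lambda>q. poly (map_poly h q) 0) P = 0"
    by (intro poly_eqI) (simp add: coeff_map_poly poly_0_coeff_0)
  have "\<exists>z. poly (map_poly h G) z = 0 \<and> poly (map_poly h H) z = T" for T
    by (rule lift[OF near_hom[OF h] l]) (simp only: eval2_def z poly_0)
  then have "UNIV = poly (map_poly h H) ` {z. poly (map_poly h G) z = 0}" by (auto simp: image_iff) metis
  moreover have "map_poly h G \<noteq> 0" using l(1) by (metis coeff_0 coeff_map_poly h.hom_zero)
  ultimately show False using infinite_field poly_roots_finite by (metis finite_imageI)
qed

text \<open>The resultant \<open>P(F,T)\<close> of \<open>G(y) - F\<close> and \<open>H(y) - T\<close> vanishes at \<open>(G,H)\<close>, so by the ultrametric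
  inequality two of its monomials have the same, maximal, size there. After specialization, the substitution
  \<open>F = d\<^sub>1 y\<close>, \<open>T = d\<^sub>2 y\<^sup>B\<close> with \<open>B\<close> larger than the degree in \<open>F\<close> keeps all monomials apart and
  produces a polynomial in \<open>y\<close> with a root of size about \<open>1\<close>.\<close>

lemma approximate_pair:
  assumes G: "nonnull_lead G" "degree G > 0" and H: "nonnull_lead H" "degree H > 0" "\<sigma> H > 0" and \<delta>: "\<delta> > 0"
  shows "\<exists>E \<delta>'. finite E \<and> E \<subseteq> R \<and> \<delta>' > 0 \<and> (\<forall>h. near E \<delta>' h \<longrightarrow> (\<exists>z. apx \<delta> h z G \<and> apx \<delta> h z H))"
proof -
  have GH: "G \<in> PR" "H \<in> PR" using G H by (auto simp: nonnull_lead_def)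
  obtain P where P: "P \<in> poly_over PR" and P0: "eval2 (\<lambda>c. [:c:]) G H P = 0"
    and lift: "\<And>(h :: 'r \<Rightarrow> 'a) F T. comm_ring_hom h \<Longrightarrow> h (lead_coeff G) \<noteq> 0 \<Longrightarrow> h (lead_coeff H) \<noteq> 0 \<Longrightarrow>
      eval2 h F T P = 0 \<Longrightarrow> \<exists>z. poly (map_poly h G) z = F \<and> poly (map_poly h H) z = T"
    using elimination[OF R GH(1) G(2) GH(2) H(2), where 'a='a] alg_closed by auto
  define c where "c i j = coeff (coeff P i) j" for i j
  have cR: "c i j \<in> R" for i j using P by (auto simp: poly_over_def c_def)
  define I where "I = degree P"
  define J where "J = Max ((\<lambda>i. degree (coeff P i)) ` {..I})"
  have J: "degree (coeff P i) \<le> J" for i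
  proof (cases "i \<le> I")
    case True
    then show ?thesis unfolding J_def by (intro Max_ge) auto
  next
    case False
    then have "coeff P i = 0" unfolding I_def by (intro coeff_eq_0) simp
    then show ?thesis by simp
  qed
  have ev: "eval2 h F T P = (\<Sum>i\<le>I. \<Sum>j\<le>J. h (c i j) * F ^ j * T ^ i)" if "h 0 = 0" for h :: "'r \<Rightarrow> 'b::comm_ring_1" and F T
    unfolding c_def using that by (intro eval2_sum) (auto simp: J I_def)
  define A where "A = {..I} \<times> {..J}"
  define f where "f = (\<lambda>(i,j). [:c i j:] * G ^ j * H ^ i)"
  define w where "w = (\<lambda>(i,j). \<sigma> [:c i j:] * \<sigma> G ^ j * \<sigma> H ^ i)"
  have fA: "finite A" unfolding A_def by simp
  have fPR: "f a \<in> PR" for a unfolding f_def by (cases a) (simp add: PR_closed PR_power GH cR del: mult_pCons_left)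
  have \<sigma>f: "\<sigma> (f a) = w a" for a unfolding f_def w_def
    by (cases a) (simp add: \<sigma>_mult \<sigma>_power PR_closed PR_power GH cR del: mult_pCons_left)
  have "sum f A = eval2 (\<lambda>c. [:c:]) G H P"
    unfolding f_def A_def by (subst ev) (simp_all add: sum.cartesian_product)
  then have s0: "\<sigma> (sum f A) = 0" using P0 by simp
  obtain i0 where i0: "\<sigma> [:c i0 0:] > 0"
    using exists_nonnull_constant_row[OF G H(1) P lift] unfolding c_def by blast
  have "i0 \<le> I"
  proof (rule ccontr)
    assume "\<not> i0 \<le> I"
    then have "c i0 0 = 0" unfolding I_def c_def by (simp add: coeff_eq_0)
    then show False using i0 by simp
  qed
  then have a0: "(i0, 0) \<in> A" "\<sigma> (f (i0, 0)) > 0" using i0 H(3) unfolding \<sigma>f by (auto simp: A_def w_def)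
  obtain a b where ab: "a \<in> A" "b \<in> A" "a \<noteq> b" "w a = w b" "w a > 0" and top: "\<And>c. c \<in> A \<Longrightarrow> w c \<le> w a"
    using tie[OF fA fPR s0 a0] unfolding \<sigma>f by blast
  define M where "M = w a"
  define B where "B = Suc J"
  \<comment> \<open>A monomial consists of one coefficient, at most \<open>J\<close> factors
    \<open>d1\<close> and at most \<open>I\<close> factors \<open>d2\<close>, so its logarithmic
    error is at most \<open>\<rho> = D * \<delta>'\<close>. The root \<open>y\<close> found below
    has a logarithm of at most \<open>3 * \<rho>\<close>, and passing to \<open>y ^ B\<close>
    multiplies this by \<open>B\<close>; hence the denominator of \<open>\<delta>'\<close>.\<close>
  define D where "D = real (1 + I + J)"
  define \<delta>' where "\<delta>' = \<delta> / (1 + 3 * D * B)"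
  have D0: "D > 0" "real B \<ge> 1" unfolding D_def B_def by auto
  have D1: "1 + 3 * D * B > 0" using D0 by (intro add_pos_nonneg) auto
  have \<delta>': "\<delta>' > 0" unfolding \<delta>'_def using D1 \<delta> by simp
  have \<delta>_eq: "\<delta> = \<delta>' + 3 * D * \<delta>' * B" 
  proof -
    have "\<delta>' * (1 + 3 * D * B) = \<delta>" unfolding \<delta>'_def using D1 by simp
    then show ?thesis by (simp add: algebra_simps)
  qed
  define \<rho> where "\<rho> = D * \<delta>'"
  have \<rho>: "\<rho> > 0" unfolding \<rho>_def using D0 \<delta>' by simp
  have \<delta>_ge: "\<delta>' + 3 * \<rho> \<le> \<delta>"
    using mult_left_mono[OF D0(2), of "3 * \<rho>"] \<rho> unfolding \<delta>_eq \<rho>_def by simp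
  define E where "E = {lead_coeff G, lead_coeff H} \<union> (\<lambda>(i,j). c i j) ` A"
  have fE: "finite E" unfolding E_def using fA by simp
  have ER: "E \<subseteq> R" unfolding E_def using cR GH by (auto simp: PR_closed)
  show ?thesis
  proof (rule exI[of _ E], rule exI[of _ \<delta>'], intro conjI allI impI fE ER \<delta>')
    fix h assume h: "near E \<delta>' h"
    interpret h: comm_ring_hom h by (rule near_hom[OF h])
    have l: "h (lead_coeff G) \<noteq> 0" "h (lead_coeff H) \<noteq> 0"
      using h G H by (auto simp: near_def nonnull_lead_def E_def)
    \<comment> \<open>For a null \<open>G\<close>, taking \<open>d1 = 0\<close> makes the lifted
      point an exact root of \<open>G\<close>.\<close>
    obtain d1 where d1: "\<sigma> G = 0 \<longrightarrow> d1 = 0" "\<sigma> G > 0 \<longrightarrow> d1 \<noteq> 0 \<and> \<bar>ln (v d1) - ln (\<sigma> G)\<bar> \<le> \<delta>'"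
      using value_dense[OF \<delta>', of "ln (\<sigma> G)"] by (metis less_irrefl)
    obtain d2 where d2: "d2 \<noteq> 0" "\<bar>ln (v d2) - ln (\<sigma> H)\<bar> \<le> \<delta>'" using value_dense[OF \<delta>'] by blast
    define x where "x = (\<lambda>(i,j). h (c i j) * d1 ^ j * d2 ^ i)"
    define k where "k = (\<lambda>(i,j). j + B * i)"
    define Q where "Q = (\<Sum>a\<in>A. monom (x a) (k a))"
    have kinj: "inj_on k A"
    proof (rule inj_onI, clarsimp simp: A_def k_def)
      fix i j i' j' assume "j \<le> J" "j' \<le> J" and e: "j + B * i = j' + B * i'"
      then have jb: "j < B" "j' < B" by (auto simp: B_def)
      have "(j + B * i) mod B = (j' + B * i') mod B" "(j + B * i) div B = (j' + B * i') div B" using e by auto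
      then show "i = i' \<and> j = j'" using jb by simp
    qed
    have xz: "x p = 0" if "p \<in> A" "w p = 0" for p
    proof -
      obtain i j where p: "p = (i,j)" by (cases p)
      have "\<sigma> [:c i j:] = 0 \<or> (\<sigma> G = 0 \<and> j > 0)" using that(2) H(3) by (auto simp: p w_def)
      then show ?thesis
      proof
        assume "\<sigma> [:c i j:] = 0"
        then have "h (c i j) = 0" using h cR by (auto simp: near_def)
        then show ?thesis by (simp add: p x_def)
      qed (use d1 in \<open>simp add: p x_def\<close>)
    qed
    have xa: "x p \<noteq> 0 \<and> \<bar>ln (v (x p)) - ln (w p)\<bar> \<le> \<rho>" if pA: "p \<in> A" and wp: "w p > 0" for p
    proof -
      obtain i j where p: "p = (i,j)" by (cases p)
      have ij: "i \<le> I" "j \<le> J" using pA by (auto simp: p A_def)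
      have s0: "\<sigma> [:c i j:] \<ge> 0" "\<sigma> G \<ge> 0" using \<sigma>_nonneg PR_closed(6)[OF cR] GH by auto
      have "\<sigma> [:c i j:] * \<sigma> G ^ j * \<sigma> H ^ i > 0" using wp by (simp only: p w_def prod.case)
      then have "\<sigma> [:c i j:] * \<sigma> G ^ j * \<sigma> H ^ i \<noteq> 0" by linarith
      then have "\<sigma> [:c i j:] \<noteq> 0" "\<sigma> G ^ j \<noteq> 0" by (metis mult_zero_left mult_zero_right)+
      then have s: "\<sigma> [:c i j:] > 0" and Gj: "\<sigma> G ^ j > 0" using s0 zero_le_power[OF s0(2), of j] by linarith+
      have hc: "h (c i j) \<noteq> 0" "\<bar>ln (v (h (c i j))) - ln (\<sigma> [:c i j:])\<bar> \<le> \<delta>'"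
        using h s pA by (auto simp: near_def E_def p)
      have gj: "d1 ^ j \<noteq> 0 \<and> \<bar>ln (v (d1 ^ j)) - ln (\<sigma> G ^ j)\<bar> \<le> j * \<delta>'"
      proof (cases "j = 0")
        case False
        then have "\<sigma> G \<noteq> 0" using Gj by (metis power_0_left less_irrefl)
        then have sG: "\<sigma> G > 0" using s0(2) by linarith
        then have "ln (v (d1 ^ j)) - ln (\<sigma> G ^ j) = j * (ln (v d1) - ln (\<sigma> G))"
          using d1 v_pos by (simp add: v_power ln_realpow algebra_simps)
        then show ?thesis using d1 sG by (simp add: abs_mult mult_left_mono)
      qed simp
      have hi: "d2 ^ i \<noteq> 0" "\<bar>ln (v (d2 ^ i)) - ln (\<sigma> H ^ i)\<bar> \<le> i * \<delta>'"
      proof -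
        have "ln (v (d2 ^ i)) - ln (\<sigma> H ^ i) = i * (ln (v d2) - ln (\<sigma> H))"
          using d2 v_pos H(3) by (simp add: v_power ln_realpow algebra_simps)
        then show "\<bar>ln (v (d2 ^ i)) - ln (\<sigma> H ^ i)\<bar> \<le> i * \<delta>'" using d2 by (simp add: abs_mult mult_left_mono)
      qed (use d2 in simp)
      have "ln (v (x p)) = ln (v (h (c i j))) + ln (v (d1 ^ j)) + ln (v (d2 ^ i))"
        using hc gj hi v_pos by (simp add: p x_def v_mult ln_mult)
      moreover have "ln (w p) = ln (\<sigma> [:c i j:]) + ln (\<sigma> G ^ j) + ln (\<sigma> H ^ i)"
        unfolding p w_def prod.case using s Gj zero_less_power[OF H(3), of i]
        by (simp only: ln_mult_pos mult_pos_pos)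
      ultimately have "\<bar>ln (v (x p)) - ln (w p)\<bar> \<le> \<delta>' + j * \<delta>' + i * \<delta>'" using hc gj hi by linarith
      also have "\<dots> = (1 + real i + real j) * \<delta>'" by (simp add: algebra_simps)
      also have "\<dots> \<le> \<rho>" unfolding \<rho>_def D_def using ij \<delta>' by (intro mult_right_mono) auto
      finally show ?thesis using hc gj hi by (simp add: p x_def)
    qed
    have cQ: "coeff Q (k p) = x p" if "p \<in> A" for p
    proof -
      have "coeff Q (k p) = (\<Sum>q\<in>A. if q = p then x q else 0)"
        unfolding Q_def coeff_sum using kinj that by (intro sum.cong) (auto simp: inj_on_def)
      then show ?thesis using that fA by simp
    qed
    have cQ0: "coeff Q m = 0" if "m \<notin> k ` A" for m
      unfolding Q_def coeff_sum using that by (intro sum.neutral) auto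
    have M0: "M > 0" using ab by (simp add: M_def)
    have upper: "v (coeff Q m) \<le> M * exp \<rho>" for m
    proof (cases "m \<in> k ` A")
      case True
      then obtain p where p: "p \<in> A" "m = k p" by blast
      show ?thesis
      proof (cases "w p > 0")
        case True
        have "ln (v (x p)) \<le> ln (w p) + \<rho>" using xa[OF p(1) True] by linarith
        then have "v (x p) \<le> w p * exp \<rho>"
          using xa[OF p(1) True] True v_pos by (metis exp_add exp_le_cancel_iff exp_ln)
        also have "\<dots> \<le> M * exp \<rho>" using top[OF p(1)] by (simp add: M_def)
        finally show ?thesis using cQ p by simp
      next
        case False
        then have "w p = 0" using \<sigma>_nonneg[OF fPR, of p] by (simp add: \<sigma>f)
        then show ?thesis using xz[OF p(1)] cQ[OF p(1)] p M0 by simp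
      qed
    qed (use cQ0 M0 in simp)
    \<comment> \<open>The tied coefficients are at least \<open>M * exp (- \<rho>)\<close>, and none
      exceeds \<open>M * exp \<rho>\<close>; the ratio \<open>exp (3 * \<rho>)\<close> adds one more
      \<open>\<rho>\<close> to obtain a strict inequality.\<close>
    have lower: "v (coeff Q (k p)) > M * exp \<rho> / exp (3 * \<rho>)" if p: "p \<in> A" "w p = M" for p
    proof -
      have "ln M - 2 * \<rho> < ln (v (x p))" using xa[of p] p M0 \<rho> by auto
      then have "exp (ln M - 2 * \<rho>) < v (x p)" using xa[of p] p M0 v_pos by (metis exp_less_cancel_iff exp_ln)
      moreover have "exp (ln M - 2 * \<rho>) = M * exp \<rho> / exp (3 * \<rho>)" using M0 by (simp add: exp_diff field_simps flip: exp_add)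
      ultimately show ?thesis using cQ p by simp
    qed
    have kab: "k a \<noteq> k b" using kinj ab by (auto simp: inj_on_def)
    obtain y where y: "poly Q y = 0" "1 / exp (3 * \<rho>) < v y" "v y < exp (3 * \<rho>)"
      using root_near_unit[of "exp (3 * \<rho>)" "M * exp \<rho>" Q "k a" "k b"] upper lower[OF ab(1)] lower[OF ab(2)] kab M0 \<rho> ab(4)
      by (auto simp: M_def)
    have y0: "v y > 0" using y(2) by (smt (verit) divide_pos_pos exp_gt_zero)
    then have yn: "y \<noteq> 0" by auto
    have "exp (- (3 * \<rho>)) < v y" using y(2) by (simp add: exp_minus inverse_eq_divide)
    then have "- (3 * \<rho>) < ln (v y)" using y0 by (metis exp_less_cancel_iff exp_ln)
    moreover have "ln (v y) < 3 * \<rho>" using y(3) y0 by (metis exp_less_cancel_iff exp_ln)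
    ultimately have ly: "\<bar>ln (v y)\<bar> \<le> 3 * \<rho>" by linarith
    have yB: "(y ^ B) ^ i = (y ^ i) ^ B" for i by (simp only: mult.commute flip: power_mult)
    have "eval2 h (d1 * y) (d2 * y ^ B) P = poly Q y"
      unfolding ev[of h, OF h.hom_zero] Q_def A_def poly_sum sum.cartesian_product
      by (intro sum.cong refl) (clarsimp simp only: poly_monom x_def k_def power_mult_distrib power_add power_mult mult_ac prod.case yB)
    then obtain z where z: "poly (map_poly h G) z = d1 * y" "poly (map_poly h H) z = d2 * y ^ B"
      using lift[OF near_hom[OF h] l] y(1) by metis
    have "apx \<delta> h z G"
      using d1 yn z(1) ly \<delta>_ge v_pos by (auto simp: apx_def v_mult ln_mult)
    moreover have "apx \<delta> h z H"
    proof -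
      have "ln (v (d2 * y ^ B)) = ln (v d2) + B * ln (v y)"
        using d2 yn v_pos by (simp add: v_mult v_power ln_mult ln_realpow)
      moreover have "\<bar>B * ln (v y)\<bar> \<le> B * (3 * \<rho>)" unfolding abs_mult using ly by (intro mult_mono) auto
      ultimately have "\<bar>ln (v (d2 * y ^ B)) - ln (\<sigma> H)\<bar> \<le> \<delta>' + B * (3 * \<rho>)" using d2 by linarith
      also have "\<dots> = \<delta>" unfolding \<delta>_eq \<rho>_def by simp
      finally show ?thesis using H(3) d2 yn z(2) by (auto simp: apx_def)
    qed
    ultimately show "\<exists>z. apx \<delta> h z G \<and> apx \<delta> h z H" by blast
  qed
qed

section \<open>Logarithmic deviations and approximation of a whole family\<close>

definition dev :: "('r \<Rightarrow> 'a) \<Rightarrow> 'a \<Rightarrow> 'r poly \<Rightarrow> real" where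
  "dev h z p = ln (v (poly (map_poly h p) z)) - ln (\<sigma> p)"

lemma near_finite_union:
  assumes "finite T" "\<And>t. t \<in> T \<Longrightarrow> \<exists>E \<delta>. finite E \<and> E \<subseteq> R \<and> \<delta> > 0 \<and> (\<forall>h. near E \<delta> h \<longrightarrow> Q t h)"
  shows "\<exists>E \<delta>. finite E \<and> E \<subseteq> R \<and> \<delta> > 0 \<and> (\<forall>h. near E \<delta> h \<longrightarrow> (\<forall>t\<in>T. Q t h))"
  using assms
proof (induction T rule: finite_induct)
  case empty
  then show ?case by (intro exI[of _ "{}"] exI[of _ 1]) auto
next
  case (insert t T)
  obtain E1 d1 where 1: "finite E1" "E1 \<subseteq> R" "d1 > 0" "\<forall>h. near E1 d1 h \<longrightarrow> (\<forall>t\<in>T. Q t h)"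
    using insert.IH insert.prems by auto
  obtain E2 d2 where 2: "finite E2" "E2 \<subseteq> R" "d2 > 0" "\<forall>h. near E2 d2 h \<longrightarrow> Q t h"
    using insert.prems[OF insertI1] by blast
  have "near E1 d1 h \<and> near E2 d2 h" if "near (E1 \<union> E2) (min d1 d2) h" for h
    using near_mono[OF that, of E1 d1] near_mono[OF that, of E2 d2] by simp
  then show ?case using 1 2 by (intro exI[of _ "E1 \<union> E2"] exI[of _ "min d1 d2"]) auto
qed

lemma map_poly_prod_eval:
  assumes "comm_ring_hom h"
  shows "poly (map_poly h (\<Prod>k\<in>A. q k ^ e k)) z = (\<Prod>k\<in>A. poly (map_poly h (q k)) z ^ e k)"
proof -
  interpret comm_ring_hom "\<lambda>q. poly (map_poly h q) z" by (rule comm_ring_hom_eval[OF assms])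
  show ?thesis by (simp add: hom_prod hom_power)
qed

text \<open>Linearity in the exponents: with exponents \<open>t ^ k\<close>, the deviation of the
  product is the value at \<open>t\<close> of a polynomial whose coefficients are the deviations of
  the factors.\<close>

lemma dev_prod:
  fixes q :: "'b \<Rightarrow> 'r poly"
  assumes "comm_ring_hom h" "finite A" "\<And>k. k \<in> A \<Longrightarrow> q k \<in> PR \<and> \<sigma> (q k) > 0 \<and> poly (map_poly h (q k)) z \<noteq> 0"
  shows "dev h z (\<Prod>k\<in>A. q k ^ e k) = (\<Sum>k\<in>A. dev h z (q k) * e k)"
proof -
  have "\<sigma> (\<Prod>k\<in>A. q k ^ e k) = (\<Prod>k\<in>A. \<sigma> (q k) ^ e k)"
    using assms by (simp add: \<sigma>_prod PR_power \<sigma>_power)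
  moreover
  have ln: "ln (\<Prod>k\<in>A. f k ^ e k) = (\<Sum>k\<in>A. e k * ln (f k))" if "\<And>k. k \<in> A \<Longrightarrow> f k > 0" for f :: "'b \<Rightarrow> real"
    using assms(2) that
  proof (induction A rule: finite_induct)
    case (insert x F)
    have "f x ^ e x > 0" "(\<Prod>k\<in>F. f k ^ e k) > 0" using insert.prems by (auto intro!: prod_pos)
    then show ?case using insert by (simp add: ln_mult_pos ln_realpow)
  qed simp
  have "ln (\<Prod>k\<in>A. \<sigma> (q k) ^ e k) = (\<Sum>k\<in>A. e k * ln (\<sigma> (q k)))"
    by (rule ln) (use assms(3) in auto)
  moreover have "ln (\<Prod>k\<in>A. v (poly (map_poly h (q k)) z) ^ e k) = (\<Sum>k\<in>A. e k * ln (v (poly (map_poly h (q k)) z)))"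
    by (rule ln) (use assms(3) v_pos in auto)
  ultimately show ?thesis
    unfolding dev_def map_poly_prod_eval[OF assms(1)] v_prod v_power
    by (simp add: sum_subtractf[symmetric] algebra_simps)
qed

text \<open>Each product of the \<open>q k\<close> with exponents \<open>t ^ k\<close> can be approximated on its own. Pigeonholing the
  resulting points over the classes \<open>cl\<close>, one class serves so many \<open>t\<close> that the individual deviations,
  seen as coefficients of a polynomial in \<open>t\<close> with small values, must be small.\<close>

lemma approximate_family:
  fixes q :: "nat \<Rightarrow> 'r poly" and cl :: "('r \<Rightarrow> 'a) \<Rightarrow> 'a \<Rightarrow> 'a"
  assumes G: "nonnull_lead G" "degree G > 0" and q: "\<And>k. k < N \<Longrightarrow> nonnull_lead (q k)" "\<And>k. k < N \<Longrightarrow> \<sigma> (q k) > 0"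
    and l: "l < N" "degree (q l) > 0" and \<delta>: "\<delta> > 0"
    and cl: "\<And>h z \<delta>. near {} 1 h \<Longrightarrow> apx \<delta> h z G \<Longrightarrow> poly (map_poly h G) (cl h z) = 0"
    and close: "\<And>h z z' \<delta> k. near {} 1 h \<Longrightarrow> apx \<delta> h z G \<Longrightarrow> apx \<delta> h z' G \<Longrightarrow> cl h z = cl h z' \<Longrightarrow>
      (\<And>k. k < N \<Longrightarrow> poly (map_poly h (q k)) z \<noteq> 0 \<and> poly (map_poly h (q k)) z' \<noteq> 0) \<Longrightarrow>
      0 < \<delta> \<Longrightarrow> k < N \<Longrightarrow> dev h z (q k) - dev h z' (q k) \<le> 2 * \<delta>"
  shows "\<exists>h z. near {lead_coeff G} 1 h \<and> (\<sigma> G = 0 \<longrightarrow> poly (map_poly h G) z = 0) \<and>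
    (\<forall>k<N. poly (map_poly h (q k)) z \<noteq> 0 \<and> \<bar>dev h z (q k)\<bar> \<le> \<delta>)"
proof -
  define m where "m = degree G"
  define T where "T = {1..N * m + 1}"
  obtain d where d: "d > 0" and small: "\<forall>(Z::'a set) c u. finite Z \<longrightarrow> card Z \<le> m \<longrightarrow> (\<forall>t\<in>T. c t \<in> Z) \<longrightarrow>
     (\<forall>t\<in>T. \<bar>\<Sum>k<N. u t k * real t ^ k\<bar> \<le> d) \<longrightarrow>
     (\<forall>t\<in>T. \<forall>t'\<in>T. c t = c t' \<longrightarrow> (\<forall>k<N. \<bar>u t k - u t' k\<bar> \<le> d)) \<longrightarrow>
     (\<exists>t\<in>T. \<forall>k<N. \<bar>u t k\<bar> \<le> \<delta>)"
    using simultaneous_smallness[OF \<delta>, of m N, where 'z='a] unfolding T_def by (elim exE conjE)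
  define H where "H t = (\<Prod>k<N. q k ^ (t ^ k))" for t :: nat
  have qP: "q k \<in> PR" if "k < N" for k using q(1)[OF that] by (simp add: nonnull_lead_def)
  have nH: "nonnull_lead (H t)" "degree (H t) = (\<Sum>k<N. t ^ k * degree (q k))" for t
    unfolding H_def using nonnull_lead_prod[of "{..<N}" "\<lambda>k. q k ^ (t ^ k)"] nonnull_lead_power q(1) by auto
  \<comment> \<open>\<open>T\<close> starts at \<open>1\<close>, so \<open>q l\<close> occurs in
    each \<open>H t\<close> with a positive exponent.\<close>
  have dH: "degree (H t) > 0" if "t \<in> T" for t
    unfolding nH by (rule sum_pos2[of _ l]) (use l that in \<open>auto simp: T_def\<close>)
  have sH: "\<sigma> (H t) > 0" for t
    unfolding H_def using q(2) qP by (subst \<sigma>_prod) (auto simp: \<sigma>_power PR_power intro!: prod_pos)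
  have d2: "d / 2 > 0" using d by simp
  have fT: "finite T" unfolding T_def by simp
  \<comment> \<open>One \<open>h\<close> has to serve all exponents; only the point \<open>z\<close>
    above it may depend on \<open>t\<close>. The tolerance is \<open>d / 2\<close> because
    \<open>close\<close> doubles it.\<close>
  obtain E \<delta>' where E: "finite E" "E \<subseteq> R" "\<delta>' > 0"
    and ap: "\<forall>h. near E \<delta>' h \<longrightarrow> (\<forall>t\<in>T. \<exists>z. apx (d/2) h z G \<and> apx (d/2) h z (H t))"
    using near_finite_union[OF fT, of "\<lambda>t h. \<exists>z. apx (d/2) h z G \<and> apx (d/2) h z (H t)"]
      approximate_pair[OF G nH(1) dH sH d2] by blast
  have lG: "lead_coeff G \<in> R" using G by (simp add: nonnull_lead_def PR_closed)
  obtain h where h: "near (insert (lead_coeff G) E) (min 1 \<delta>') h"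
    using ex_near[of "insert (lead_coeff G) E" "min 1 \<delta>'"] E lG by auto
  have hE: "near E \<delta>' h" and h1: "near {} 1 h" and hG: "near {lead_coeff G} 1 h"
    by (rule near_mono[OF h]; auto)+
  note hom = near_hom[OF h]
  interpret comm_ring_hom h by (rule hom)
  obtain z where z: "\<And>t. t \<in> T \<Longrightarrow> apx (d/2) h (z t) G \<and> apx (d/2) h (z t) (H t)"
    using ap hE by metis
  have nz: "poly (map_poly h (q k)) (z t) \<noteq> 0" if "t \<in> T" "k < N" for t k
  proof -
    have "poly (map_poly h (H t)) (z t) \<noteq> 0" using z[OF that(1)] sH[of t] by (auto simp: apx_def)
    moreover have "t ^ k > 0" using that by (auto simp: T_def)
    ultimately show ?thesis using that(2) unfolding H_def map_poly_prod_eval[OF hom] by (auto simp: prod_zero_iff)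
  qed
  define Z where "Z = {a. poly (map_poly h G) a = 0}"
  have "h (lead_coeff G) \<noteq> 0" using hG G by (auto simp: near_def nonnull_lead_def)
  then have G0: "map_poly h G \<noteq> 0" by (metis coeff_0 coeff_map_poly hom_zero)
  have "finite Z" unfolding Z_def by (rule poly_roots_finite[OF G0])
  moreover have "card Z \<le> m" unfolding Z_def m_def
    using card_poly_roots_bound[OF G0] degree_map_poly_le[of h G] by linarith
  moreover have "\<forall>t\<in>T. cl h (z t) \<in> Z" unfolding Z_def using cl[OF h1] z by blast
  moreover have "\<forall>t\<in>T. \<bar>\<Sum>k<N. dev h (z t) (q k) * real t ^ k\<bar> \<le> d"
  proof
    fix t assume t: "t \<in> T"
    have "dev h (z t) (H t) = (\<Sum>k<N. dev h (z t) (q k) * real (t ^ k))"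
      unfolding H_def by (rule dev_prod[OF hom]) (use qP q(2) nz[OF t] in auto)
    moreover have "\<bar>dev h (z t) (H t)\<bar> \<le> d / 2" using z[OF t] sH[of t] by (auto simp: apx_def dev_def)
    ultimately show "\<bar>\<Sum>k<N. dev h (z t) (q k) * real t ^ k\<bar> \<le> d" using d by simp
  qed
  moreover have "\<forall>t\<in>T. \<forall>t'\<in>T. cl h (z t) = cl h (z t') \<longrightarrow> (\<forall>k<N. \<bar>dev h (z t) (q k) - dev h (z t') (q k)\<bar> \<le> d)"
  proof (intro ballI impI allI)
    fix t t' k assume t: "t \<in> T" "t' \<in> T" and e: "cl h (z t) = cl h (z t')" and k: "k < N"
    have "dev h (z t) (q k) - dev h (z t') (q k) \<le> 2 * (d / 2)"
      by (rule close[OF h1 _ _ e _ d2 k]) (use z t nz in auto)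
    moreover have "dev h (z t') (q k) - dev h (z t) (q k) \<le> 2 * (d / 2)"
      by (rule close[OF h1 _ _ e[symmetric] _ d2 k]) (use z t nz in auto)
    ultimately show "\<bar>dev h (z t) (q k) - dev h (z t') (q k)\<bar> \<le> d" by linarith
  qed
  ultimately obtain t where t: "t \<in> T" "\<forall>k<N. \<bar>dev h (z t) (q k)\<bar> \<le> \<delta>"
    using small[rule_format, of Z "\<lambda>t. cl h (z t)" "\<lambda>t k. dev h (z t) (q k)"] by blast
  show ?thesis
    by (rule exI[of _ h], rule exI[of _ "z t"]) (use hG t nz z in \<open>auto simp: apx_def\<close>)
qed

section \<open>Adjoining a transcendental or an algebraic variable\<close>

lemma poly_map_poly_diff:
  assumes "comm_ring_hom h"
  shows "poly (map_poly h (p - q)) z = poly (map_poly h p) z - poly (map_poly h q) z"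
proof -
  interpret comm_ring_hom "\<lambda>q. poly (map_poly h q) z" by (rule comm_ring_hom_eval[OF assms])
  show ?thesis by (rule hom_minus)
qed

lemma ex_nonnull_representative:
  assumes p: "p \<in> PR" "\<sigma> p > 0"
  shows "\<exists>q. nonnull_lead q \<and> \<sigma> (p - q) = 0 \<and> \<sigma> q = \<sigma> p"
proof -
  obtain i where "\<sigma> [:coeff p i:] \<noteq> 0" using \<sigma>_null_coeffs[OF p(1)] p(2) by fastforce
  then have "\<sigma> [:coeff p i:] > 0" using \<sigma>_nonneg[OF PR_closed(6)[OF PR_closed(7)[OF p(1), of i]]] by linarith
  then obtain q where q: "nonnull_lead q" "\<sigma> (p - q) = 0" using ex_nonnull_lead[OF p(1)] by blast
  moreover have "\<sigma> p = \<sigma> q" using \<sigma>_eq_of_diff_null[OF p(1) _ q(2)] q(1) by (simp add: nonnull_lead_def)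
  ultimately show ?thesis by auto
qed

lemma near_null_coeffs:
  assumes "near E \<delta> h" "p \<in> PR" "\<And>i. \<sigma> [:coeff p i:] = 0"
  shows "map_poly h p = 0"
proof -
  interpret comm_ring_hom h by (rule near_hom[OF assms(1)])
  have "h (coeff p i) = 0" for i using assms PR_closed(7) unfolding near_def by blast
  then show ?thesis by (intro poly_eqI) (simp add: coeff_map_poly)
qed

text \<open>Null polynomials have null coefficients here, so a near \<open>h\<close> kills them for
  every \<open>z\<close>, and only sizes matter. Points are classified by a nearest root
  \<open>b\<close> of the product \<open>G\<close>: if \<open>z\<close> is at least as close to
  \<open>b\<close> as \<open>z'\<close>, no factor is larger at \<open>z\<close> than at
  \<open>z'\<close>. All deviations thus change in the same direction, and none changes by more than
  that of \<open>G\<close>.\<close>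

lemma approximable_extension_transcendental:
  assumes tr: "\<And>p i. p \<in> PR \<Longrightarrow> \<sigma> p = 0 \<Longrightarrow> \<sigma> [:coeff p i:] = 0"
    and E: "finite E" "E \<subseteq> PR" and \<delta>: "\<delta> > 0"
  shows "\<exists>h\<in>Pts. \<exists>z. (\<forall>p\<in>PR. \<sigma> p = 0 \<longrightarrow> poly (map_poly h p) z = 0) \<and>
    (\<forall>p\<in>E. \<sigma> p > 0 \<longrightarrow> poly (map_poly h p) z \<noteq> 0 \<and> \<bar>dev h z p\<bar> \<le> \<delta>)"
proof -
  have kill: "map_poly h p = 0" if "near E' \<delta>' h" "p \<in> PR" "\<sigma> p = 0" for E' \<delta>' h p
    using near_null_coeffs[OF that(1,2)] tr that by blast
  \<comment> \<open>The variable joins the family: it makes the degree of \<open>G\<close> positive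
    and provides \<open>G\<close> with the root \<open>0\<close>.\<close>
  define X where "X = [:0, 1 :: 'r:]"
  have XP: "X \<in> PR" unfolding X_def using R_closed by (auto simp: poly_over_def coeff_pCons split: nat.splits)
  have "\<sigma> [:coeff X 1:] = 1" by (simp add: X_def flip: one_pCons)
  then have "\<sigma> X \<noteq> 0" using tr[OF XP, of 1] by auto
  then have X: "nonnull_lead X" "\<sigma> X > 0" "degree X = 1"
    using \<sigma>_nonneg[OF XP] XP by (auto simp: nonnull_lead_def X_def simp flip: one_pCons)
  obtain rep where rep: "\<And>p. p \<in> PR \<Longrightarrow> \<sigma> p > 0 \<Longrightarrow> nonnull_lead (rep p) \<and> \<sigma> (p - rep p) = 0 \<and> \<sigma> (rep p) = \<sigma> p"
    using ex_nonnull_representative by metis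
  obtain xs where xs: "set xs = {p \<in> E. \<sigma> p > 0}" using finite_list[of "{p \<in> E. \<sigma> p > 0}"] E by auto
  define N where "N = Suc (length xs)"
  define q where "q k = (case k of 0 \<Rightarrow> X | Suc j \<Rightarrow> rep (xs ! j))" for k
  have q: "nonnull_lead (q k)" "\<sigma> (q k) > 0" if "k < N" for k
  proof -
    have "nonnull_lead (q k) \<and> \<sigma> (q k) > 0"
    proof (cases k)
      case (Suc j)
      then have "xs ! j \<in> set xs" using that by (simp add: N_def)
      then show ?thesis using rep[of "xs ! j"] E xs by (auto simp: q_def Suc)
    qed (use X in \<open>simp add: q_def\<close>)
    then show "nonnull_lead (q k)" "\<sigma> (q k) > 0" by auto
  qed
  have qP: "q k \<in> PR" if "k < N" for k using q(1)[OF that] by (simp add: nonnull_lead_def)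
  define G where "G = (\<Prod>k<N. q k ^ 1)"
  have G: "nonnull_lead G" "degree G = (\<Sum>k<N. degree (q k))"
    unfolding G_def using nonnull_lead_prod[of "{..<N}" q] q(1) by auto
  have dG: "degree G > 0"
    unfolding G(2) by (rule sum_pos2[of _ 0]) (auto simp: N_def q_def X)
  have sG: "\<sigma> G > 0" unfolding G_def using q qP by (subst \<sigma>_prod) (auto intro!: prod_pos)
  define root where "root h b z \<longleftrightarrow> poly (map_poly h G) b = 0 \<and> (\<forall>a. poly (map_poly h G) a = 0 \<longrightarrow> v (z - b) \<le> v (z - a))" for h b z
  define cl where "cl h z = (SOME b. root h b z)" for h z
  have evG: "poly (map_poly h G) z = (\<Prod>k<N. poly (map_poly h (q k)) z)" if "near {} 1 h" for h z
    unfolding G_def map_poly_prod_eval[OF near_hom[OF that]] by simp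
  have cl: "root h (cl h z) z" if h: "near {} 1 h" and ap: "apx d h z G" for h z d
  proof -
    interpret comm_ring_hom h by (rule near_hom[OF h])
    define Z where "Z = {a. poly (map_poly h G) a = 0}"
    have "map_poly h G \<noteq> 0" using ap sG by (auto simp: apx_def)
    then have fZ: "finite Z" unfolding Z_def by (rule poly_roots_finite)
    have "poly (map_poly h (q 0)) 0 = 0" by (simp add: q_def X_def Polynomial.map_poly_pCons)
    then have "0 \<in> Z" unfolding Z_def using evG[OF h, of 0] by (auto simp: prod_zero_iff N_def)
    then have "Min ((\<lambda>b. v (z - b)) ` Z) \<in> (\<lambda>b. v (z - b)) ` Z" using fZ by (intro Min_in) auto
    then obtain b where b: "b \<in> Z" "v (z - b) = Min ((\<lambda>b. v (z - b)) ` Z)" by auto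
    have "\<forall>a\<in>Z. v (z - b) \<le> v (z - a)" unfolding b(2) using fZ by auto
    with b(1)
    have "root h b z" by (auto simp: root_def Z_def)
    then show ?thesis unfolding cl_def by (rule someI)
  qed
  have "\<exists>h z. near {lead_coeff G} 1 h \<and> (\<sigma> G = 0 \<longrightarrow> poly (map_poly h G) z = 0) \<and>
    (\<forall>k<N. poly (map_poly h (q k)) z \<noteq> 0 \<and> \<bar>dev h z (q k)\<bar> \<le> \<delta>)"
  proof (rule approximate_family[where l=0 and cl=cl, OF G(1) dG _ _ _ _ \<delta>])
    show "nonnull_lead (q k)" "\<sigma> (q k) > 0" if "k < N" for k using q[OF that] by auto
    show "0 < N" by (simp add: N_def)
    show "degree (q 0) > 0" by (simp add: q_def X)
    show "poly (map_poly h G) (cl h z) = 0" if "near {} 1 h" "apx d h z G" for h z d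
      using cl[OF that] by (simp add: root_def)
    fix h z z' d k
    assume h: "near {} 1 h" and ap: "apx d h z G" "apx d h z' G" and eq: "cl h z = cl h z'"
      and nz: "\<And>k. k < N \<Longrightarrow> poly (map_poly h (q k)) z \<noteq> 0 \<and> poly (map_poly h (q k)) z' \<noteq> 0"
      and d: "0 < d" and k: "k < N"
    define b where "b = cl h z"
    have b: "root h b z" "root h b z'" using cl[OF h ap(1)] cl[OF h ap(2)] eq by (auto simp: b_def)
    have near1: "v (z - b) \<le> v (z - a)" "v (z' - b) \<le> v (z' - a)" if "poly (map_poly h (q i)) a = 0" "i < N" for i a
    proof -
      have "poly (map_poly h G) a = 0" using evG[OF h, of a] that by (auto simp: prod_zero_iff)
      then show "v (z - b) \<le> v (z - a)" "v (z' - b) \<le> v (z' - a)" using b by (auto simp: root_def)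
    qed
    show "dev h z (q k) - dev h z' (q k) \<le> 2 * d"
    proof (cases "v (z - b) \<le> v (z' - b)")
      case True
      have "v (poly (map_poly h (q k)) z) \<le> v (poly (map_poly h (q k)) z')"
        by (rule v_poly_mono_nearest_root[OF _ _ True]) (use near1 k in auto)
      then have "dev h z (q k) \<le> dev h z' (q k)" unfolding dev_def using nz[OF k] v_pos by simp
      then show ?thesis using d by simp
    next
      case False
      then have le: "v (z' - b) \<le> v (z - b)" by simp
      have mono: "0 \<le> dev h z (q i) - dev h z' (q i)" if i: "i < N" for i
      proof -
        have "v (poly (map_poly h (q i)) z') \<le> v (poly (map_poly h (q i)) z)"
          by (rule v_poly_mono_nearest_root[OF _ _ le]) (use near1 i in auto)
        then show ?thesis unfolding dev_def using nz[OF i] v_pos by simp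
      qed
      have sums: "dev h y G = (\<Sum>i<N. dev h y (q i))" if "\<And>i. i < N \<Longrightarrow> poly (map_poly h (q i)) y \<noteq> 0" for y
        unfolding G_def using dev_prod[OF near_hom[OF h], of "{..<N}" q y "\<lambda>_. 1"] q qP that by auto
      \<comment> \<open>All summands are nonnegative, and their total is the change of the deviation
        of \<open>G\<close>, which is at most \<open>d\<close> in absolute value at either
        point.\<close>
      have "dev h z (q k) - dev h z' (q k) \<le> (\<Sum>i<N. dev h z (q i) - dev h z' (q i))"
        by (rule member_le_sum) (use k mono in auto)
      also have "\<dots> = dev h z G - dev h z' G" using sums nz by (simp add: sum_subtractf)
      also have "\<dots> \<le> 2 * d" using ap sG by (auto simp: apx_def dev_def)
      finally show ?thesis .
    qed
  qed
  then obtain h z where h: "near {lead_coeff G} 1 h" and app: "\<forall>k<N. poly (map_poly h (q k)) z \<noteq> 0 \<and> \<bar>dev h z (q k)\<bar> \<le> \<delta>"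
    by blast
  have "poly (map_poly h p) z \<noteq> 0 \<and> \<bar>dev h z p\<bar> \<le> \<delta>" if p: "p \<in> E" "\<sigma> p > 0" for p
  proof -
    obtain j where j: "j < length xs" "xs ! j = p" using p xs by (metis (mono_tags, lifting) in_set_conv_nth mem_Collect_eq)
    have pP: "p \<in> PR" using p E by auto
    note r = rep[OF pP p(2)]
    have "poly (map_poly h (p - rep p)) z = 0" using kill[OF h, of "p - rep p"] r pP by (simp add: nonnull_lead_def PR_diff)
    then have "poly (map_poly h p) z = poly (map_poly h (rep p)) z" by (simp add: poly_map_poly_diff[OF near_hom[OF h]])
    moreover have "q (Suc j) = rep p" "Suc j < N" using j by (auto simp: q_def N_def)
    ultimately show ?thesis using app r by (metis dev_def)
  qed
  moreover have "poly (map_poly h p) z = 0" if "p \<in> PR" "\<sigma> p = 0" for p using kill[OF h that] by simp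
  moreover have "h \<in> Pts" using h by (simp add: near_def)
  ultimately show ?thesis by blast
qed

text \<open>\<open>g\<close> is a relation for \<open>z\<close> of least degree among those whose
  leading coefficient is not null. As \<open>g\<close> is null, only exact roots approximate it, so
  each point can be its own class and there are at most \<open>degree g\<close> classes.\<close>

lemma approximable_extension_algebraic:
  assumes alg: "p0 \<in> PR" "\<sigma> p0 = 0" "\<sigma> [:coeff p0 i0:] \<noteq> 0"
    and E: "finite E" "E \<subseteq> PR" and \<delta>: "\<delta> > 0"
  shows "\<exists>h\<in>Pts. \<exists>z. (\<forall>p\<in>PR. \<sigma> p = 0 \<longrightarrow> poly (map_poly h p) z = 0) \<and>
    (\<forall>p\<in>E. \<sigma> p > 0 \<longrightarrow> poly (map_poly h p) z \<noteq> 0 \<and> \<bar>dev h z p\<bar> \<le> \<delta>)"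
proof -
  have ex: "\<exists>q. nonnull_lead q \<and> \<sigma> q = 0 \<and> degree q \<le> degree p" if "p \<in> PR" "\<sigma> p = 0" "\<sigma> [:coeff p i:] \<noteq> 0" for p i
  proof -
    have "\<sigma> [:coeff p i:] > 0" using \<sigma>_nonneg[OF PR_closed(6)[OF PR_closed(7)[OF that(1), of i]]] that(3) by linarith
    from ex_nonnull_lead[OF that(1) this] obtain q where q: "nonnull_lead q" "\<sigma> (p - q) = 0" "degree q \<le> degree p" by blast
    then have "\<sigma> q = 0" using \<sigma>_eq_of_diff_null[of p q] that by (simp add: nonnull_lead_def)
    then show ?thesis using q by blast
  qed
  obtain g where g: "nonnull_lead g" "\<sigma> g = 0" and gmin: "\<And>q. nonnull_lead q \<Longrightarrow> \<sigma> q = 0 \<Longrightarrow> degree g \<le> degree q"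
    using ex_has_least_nat[of "\<lambda>q. nonnull_lead q \<and> \<sigma> q = 0" _ degree] ex[OF alg] by blast
  have gP: "g \<in> PR" using g by (simp add: nonnull_lead_def)
  have dg: "degree g > 0"
  proof (rule ccontr)
    assume "\<not> degree g > 0"
    then have "g = [:lead_coeff g:]" by (metis degree_0_id gr0I)
    then show False using g by (metis nonnull_lead_def less_irrefl)
  qed
  \<comment> \<open>Pseudo-division by \<open>g\<close>, whose leading coefficient survives
    \<open>h\<close>; below the degree of \<open>g\<close>, minimality makes all coefficients of a
    null polynomial null. Hence a root of \<open>g\<close> kills the whole kernel.\<close>
  have kill: "poly (map_poly h f) z = 0"
    if h: "near {lead_coeff g} 1 h" and z: "poly (map_poly h g) z = 0" and f: "f \<in> PR" "\<sigma> f = 0" for h z f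
    using f
  proof (induction "degree f" arbitrary: f rule: less_induct)
    case less
    interpret h: comm_ring_hom h by (rule near_hom[OF h])
    interpret e: comm_ring_hom "\<lambda>q. poly (map_poly h q) z" by (rule comm_ring_hom_eval[OF near_hom[OF h]])
    show ?case
    proof (cases "degree f < degree g")
      case True
      then have "\<sigma> [:coeff f i:] = 0" for i using ex[OF less.prems] gmin by (meson leD le_less_trans)
      then show ?thesis using near_null_coeffs[OF h less.prems(1)] by simp
    next
      case False
      define a where "a = lead_coeff g"
      define m where "m = monom (lead_coeff f) (degree f - degree g)"
      define f' where "f' = [:a:] * f - m * g"
      have aR: "a \<in> R" unfolding a_def using gP by (rule PR_closed)
      have mP: "m \<in> PR" unfolding m_def by (intro PR_monom PR_closed less.prems)
      have f'P: "f' \<in> PR" unfolding f'_def by (intro PR_diff PR_closed aR mP gP less.prems)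
      have s1: "\<sigma> ([:a:] * f) = 0" "\<sigma> (m * g) = 0"
        using less.prems g by (simp_all add: \<sigma>_mult PR_closed aR mP gP del: mult_pCons_left)
      have "\<sigma> f' \<le> 0" unfolding f'_def using \<sigma>_diff[of "[:a:] * f" "m * g"] s1
        by (simp add: PR_closed aR mP gP less.prems del: mult_pCons_left)
      then have sf': "\<sigma> f' = 0" using \<sigma>_nonneg[OF f'P] by simp
      have "coeff f' k = 0" if k: "k \<ge> degree f" for k
      proof -
        have *: "coeff f' k = a * coeff f k - lead_coeff f * coeff g (k - (degree f - degree g))"
          using k by (simp add: f'_def m_def coeff_monom_mult)
        show ?thesis
        proof (cases "k = degree f")
          case True
          then show ?thesis using False unfolding * a_def by simp
        next
          case ne: False
          then have "coeff f k = 0" "coeff g (k - (degree f - degree g)) = 0" using k False by (auto intro!: coeff_eq_0)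
          then show ?thesis unfolding * by simp
        qed
      qed
      moreover have "degree f > 0" using False dg by simp
      ultimately have "degree f' < degree f" by (intro degree_lessI) auto
      then have "poly (map_poly h f') z = 0" using less.hyps f'P sf' by blast
      moreover have "poly (map_poly h f') z = poly (map_poly h [:a:]) z * poly (map_poly h f) z - poly (map_poly h m) z * poly (map_poly h g) z"
        unfolding f'_def by (simp only: e.hom_minus e.hom_mult)
      ultimately have "h a * poly (map_poly h f) z = 0" using z by (simp add: Polynomial.map_poly_pCons)
      moreover have "h a \<noteq> 0" using h g unfolding near_def nonnull_lead_def a_def by auto
      ultimately show ?thesis by simp
    qed
  qed
  \<comment> \<open>Adding \<open>g\<close> times a high power of the variable changes nothing
    modulo the kernel and makes the degree positive, as elimination demands.\<close>
  have exrep: "\<exists>q. nonnull_lead q \<and> \<sigma> (p - q) = 0 \<and> \<sigma> q = \<sigma> p \<and> degree q > 0" if p: "p \<in> PR" "\<sigma> p > 0" for p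
  proof -
    obtain q where q: "nonnull_lead q" "\<sigma> (p - q) = 0" "\<sigma> q = \<sigma> p" using ex_nonnull_representative[OF p] by blast
    define r where "r = monom 1 (Suc (degree q)) * g"
    have qP: "q \<in> PR" using q by (simp add: nonnull_lead_def)
    have m1: "nonnull_lead (monom 1 (Suc (degree q)))"
      unfolding nonnull_lead_def using R_closed by (auto simp: PR_monom lead_coeff_monom degree_monom_eq simp flip: one_pCons)
    have r: "nonnull_lead r" "degree r = Suc (degree q) + degree g" unfolding r_def using nonnull_lead_mult[OF m1 g(1)] by (auto simp: degree_monom_eq)
    then have rP: "r \<in> PR" by (simp add: nonnull_lead_def)
    have sr: "\<sigma> r = 0" unfolding r_def using g(2) gP m1 by (subst \<sigma>_mult) (auto simp: nonnull_lead_def)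
    have dq: "degree (q + r) = degree r" using r by (intro degree_add_eq_right) simp
    then have "lead_coeff (q + r) = lead_coeff r" using r by (simp add: coeff_eq_0)
    then have "nonnull_lead (q + r)" using r qP rP by (simp add: nonnull_lead_def PR_closed dq)
    moreover have "\<sigma> (p - (q + r)) = \<sigma> (p - q)"
      by (rule \<sigma>_eq_of_diff_null) (use p qP rP sr in \<open>auto simp: PR_diff PR_closed \<sigma>_minus\<close>)
    moreover have "\<sigma> (q + r) = \<sigma> q"
      by (rule \<sigma>_eq_of_diff_null) (use qP rP sr in \<open>auto simp: PR_closed\<close>)
    moreover have "degree (q + r) > 0" using dq r by simp
    ultimately show ?thesis using q by metis
  qed
  then obtain rep where rep: "\<And>p. p \<in> PR \<Longrightarrow> \<sigma> p > 0 \<Longrightarrow> nonnull_lead (rep p) \<and> \<sigma> (p - rep p) = 0 \<and> \<sigma> (rep p) = \<sigma> p \<and> degree (rep p) > 0"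
    by metis
  \<comment> \<open>The element \<open>1\<close> keeps the family from being empty.\<close>
  obtain xs where xs: "set xs = insert 1 {p \<in> E. \<sigma> p > 0}" using finite_list[of "insert 1 {p \<in> E. \<sigma> p > 0}"] E by auto
  define N where "N = length xs"
  define q where "q k = rep (xs ! k)" for k
  have q: "nonnull_lead (q k)" "\<sigma> (q k) > 0" "degree (q k) > 0" if "k < N" for k
  proof -
    have "xs ! k \<in> set xs" using that by (simp add: N_def)
    then have "xs ! k \<in> PR" "\<sigma> (xs ! k) > 0" using xs E by (auto simp: PR_closed)
    then show "nonnull_lead (q k)" "\<sigma> (q k) > 0" "degree (q k) > 0" using rep[of "xs ! k"] by (auto simp: q_def)
  qed
  have N0: "0 < N" using xs by (auto simp: N_def)
  have "\<exists>h z. near {lead_coeff g} 1 h \<and> (\<sigma> g = 0 \<longrightarrow> poly (map_poly h g) z = 0) \<and>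
    (\<forall>k<N. poly (map_poly h (q k)) z \<noteq> 0 \<and> \<bar>dev h z (q k)\<bar> \<le> \<delta>)"
    by (rule approximate_family[where l=0 and cl="\<lambda>h z. z", OF g(1) dg _ _ _ _ \<delta>])
       (use g q N0 in \<open>auto simp: apx_def\<close>)
  then obtain h z where h: "near {lead_coeff g} 1 h" and z: "poly (map_poly h g) z = 0"
    and app: "\<forall>k<N. poly (map_poly h (q k)) z \<noteq> 0 \<and> \<bar>dev h z (q k)\<bar> \<le> \<delta>"
    using g by blast
  have "poly (map_poly h p) z \<noteq> 0 \<and> \<bar>dev h z p\<bar> \<le> \<delta>" if p: "p \<in> E" "\<sigma> p > 0" for p
  proof -
    obtain j where j: "j < length xs" "xs ! j = p" using p xs by (metis (mono_tags, lifting) in_set_conv_nth mem_Collect_eq insertI2)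
    have pP: "p \<in> PR" using p E by auto
    note r = rep[OF pP p(2)]
    have "poly (map_poly h (p - rep p)) z = 0" using kill[OF h z, of "p - rep p"] r pP by (simp add: nonnull_lead_def PR_diff)
    then have "poly (map_poly h p) z = poly (map_poly h (rep p)) z" by (simp add: poly_map_poly_diff[OF near_hom[OF h]])
    moreover have "q j = rep p" "j < N" using j by (auto simp: q_def N_def)
    ultimately show ?thesis using app r by (metis dev_def)
  qed
  moreover have "h \<in> Pts" using h by (simp add: near_def)
  ultimately show ?thesis using kill[OF h z] by blast
qed

lemma approximable_extension:
  assumes "finite E" "E \<subseteq> PR" "\<delta> > 0"
  shows "\<exists>h\<in>Pts. \<exists>z. (\<forall>p\<in>PR. \<sigma> p = 0 \<longrightarrow> poly (map_poly h p) z = 0) \<and>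
    (\<forall>p\<in>E. \<sigma> p > 0 \<longrightarrow> poly (map_poly h p) z \<noteq> 0 \<and> \<bar>dev h z p\<bar> \<le> \<delta>)"
proof (cases "\<forall>p\<in>PR. \<sigma> p = 0 \<longrightarrow> (\<forall>i. \<sigma> [:coeff p i:] = 0)")
  case True
  then show ?thesis using approximable_extension_transcendental[OF _ assms] by blast
next
  case False
  then show ?thesis using approximable_extension_algebraic[OF _ _ _ assms] by blast
qed

end

section \<open>Density of points among seminorms\<close>

lemma polyfun_ring_closed: "ring_closed (polyfun n :: ((nat \<Rightarrow> 'a::comm_ring_1) \<Rightarrow> 'a) set)"
proof -
  have "- f \<in> polyfun n" if "f \<in> polyfun n" for f :: "(nat \<Rightarrow> 'a) \<Rightarrow> 'a"
    using polyfun.mult[OF polyfun.const[of "-1"] that] by (simp add: fun_Compl_def)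
  then show ?thesis
    by (auto simp: ring_closed_def zero_fun_def one_fun_def plus_fun_def times_fun_def intro: polyfun.intros)
qed

lemma polyfun_Suc: "f \<in> polyfun n \<Longrightarrow> f \<in> polyfun (Suc n)"
  by (induction f rule: polyfun.induct) (auto intro: polyfun.intros)

lemma polyfun_mono:
  assumes "f \<in> polyfun m" "m \<le> m'" shows "f \<in> polyfun m'"
  using assms(2,1) by (induction m' rule: dec_induct) (auto intro: polyfun_Suc)

lemma polyfun_cong: "f \<in> polyfun n \<Longrightarrow> (\<And>k. k < n \<Longrightarrow> x k = y k) \<Longrightarrow> f x = f y"
  by (induction f rule: polyfun.induct) auto

text \<open>Functions form a ring pointwise, so a polynomial over \<open>polyfun n\<close> can be
  evaluated at the coordinate function \<open>\<lambda>x. x n\<close>. Together with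
  \<open>polyfun_Suc_ex_poly\<close> this presents polynomial functions as polynomials in the last
  variable.\<close>

lemma polyfun_Suc_of_poly:
  assumes "p \<in> poly_over (polyfun n)" shows "poly p (\<lambda>x. x n) \<in> polyfun (Suc n)"
proof -
  note C = polyfun_ring_closed[of "Suc n"]
  have X: "(\<lambda>x. x n) \<in> polyfun (Suc n)" by (intro polyfun.var) simp
  have pw: "(\<lambda>x. x n) ^ i \<in> polyfun (Suc n)" for i
    by (rule ring_closed_power[OF C X])
  have "coeff p i * (\<lambda>x. x n) ^ i \<in> polyfun (Suc n)" for i
  proof -
    have "coeff p i \<in> polyfun (Suc n)" using assms by (simp add: poly_over_def polyfun_Suc)
    then show ?thesis using pw[of i] C unfolding ring_closed_def by blast
  qed
  then show ?thesis unfolding poly_altdef by (intro ring_closed_sum[OF C])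
qed

lemma polyfun_Suc_ex_poly:
  assumes "f \<in> polyfun (Suc n)"
  shows "\<exists>p\<in>poly_over (polyfun n). f = poly p (\<lambda>x. x n)"
  using assms
proof (induction f rule: polyfun.induct)
  case (const c)
  show ?case
    by (rule bexI[of _ "[:\<lambda>x. c:]"]) (auto intro!: poly_over_const polyfun_ring_closed polyfun.const)
next
  case (var k)
  note C = polyfun_ring_closed[of n, where 'a='a]
  show ?case
  proof (cases "k = n")
    case True
    then show ?thesis
      by (intro bexI[of _ "[:0, 1:]"]) (use C in \<open>auto simp: poly_over_def coeff_pCons ring_closed_def split: nat.splits\<close>)
  next
    case False
    then show ?thesis using var
      by (intro bexI[of _ "[:\<lambda>x. x k:]"]) (auto intro!: poly_over_const C polyfun.var)
  qed
next
  case (add f g)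
  then obtain p q where pq: "p \<in> poly_over (polyfun n)" "q \<in> poly_over (polyfun n)"
    and "f = poly p (\<lambda>x. x n)" "g = poly q (\<lambda>x. x n)" by blast
  then have "(\<lambda>x. f x + g x) = poly (p + q) (\<lambda>x. x n)" by (simp add: fun_eq_iff)
  moreover have "p + q \<in> poly_over (polyfun n)"
    using pq ring_closed_poly_over[OF polyfun_ring_closed[of n]] unfolding ring_closed_def by blast
  ultimately show ?case by blast
next
  case (mult f g)
  then obtain p q where pq: "p \<in> poly_over (polyfun n)" "q \<in> poly_over (polyfun n)"
    and "f = poly p (\<lambda>x. x n)" "g = poly q (\<lambda>x. x n)" by blast
  then have "(\<lambda>x. f x * g x) = poly (p * q) (\<lambda>x. x n)" by (simp add: fun_eq_iff)
  moreover have "p * q \<in> poly_over (polyfun n)"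
    using pq ring_closed_poly_over[OF polyfun_ring_closed[of n]] unfolding ring_closed_def by blast
  ultimately show ?case by blast
qed

lemma comm_ring_hom_apply: "comm_ring_hom (\<lambda>f :: 'b \<Rightarrow> 'c::comm_ring_1. f x)"
  by unfold_locales auto

lemma poly_apply: "poly p g x = poly (map_poly (\<lambda>f. f x) p) (g x)" for g :: "'b \<Rightarrow> 'c::comm_ring_1"
proof -
  interpret comm_ring_hom "\<lambda>f :: 'b \<Rightarrow> 'c. f x" by (rule comm_ring_hom_apply)
  show ?thesis by (rule poly_map_poly[symmetric])
qed

context alg_closed_valued
begin

text \<open>The ultrametric inequality is built in, as ties depend on it; for elements of
  \<open>Xan\<close> it is derived from the triangle inequality.\<close>

definition mult_seminorm :: "nat \<Rightarrow> (((nat \<Rightarrow> 'a) \<Rightarrow> 'a) \<Rightarrow> real) \<Rightarrow> bool" where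
  "mult_seminorm n s \<longleftrightarrow> (\<forall>f\<in>polyfun n. 0 \<le> s f) \<and> (\<forall>c. s (\<lambda>x. c) = v c) \<and>
     (\<forall>f\<in>polyfun n. \<forall>g\<in>polyfun n. s (f * g) = s f * s g \<and> s (f + g) \<le> max (s f) (s g))"

text \<open>Transported to polynomials in the last variable over \<open>polyfun n\<close>, the
  seminorm becomes an instance of \<open>approximable_ring\<close>: the induction hypothesis is its
  assumption \<open>approx\<close>, with evaluations at points of \<open>aff n\<close> as
  homomorphisms.\<close>

theorem points_dense:
  assumes "mult_seminorm n s" "finite E" "E \<subseteq> polyfun n" "\<delta> > 0"
  shows "\<exists>x\<in>aff n. (\<forall>f\<in>polyfun n. s f = 0 \<longrightarrow> f x = 0) \<and>
    (\<forall>f\<in>E. s f > 0 \<longrightarrow> f x \<noteq> 0 \<and> \<bar>ln (v (f x)) - ln (s f)\<bar> \<le> \<delta>)"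
  using assms
proof (induction n arbitrary: s E \<delta>)
  case 0
  have c: "\<exists>c. f = (\<lambda>x. c)" if "f \<in> polyfun 0" for f :: "(nat \<Rightarrow> 'a) \<Rightarrow> 'a"
    using that by (induction f rule: polyfun.induct) auto
  have "s f = v (f (\<lambda>_. 0))" if "f \<in> polyfun 0" for f
    using c[OF that] 0(1) by (auto simp: mult_seminorm_def)
  then show ?case using 0 by (intro bexI[of _ "\<lambda>_. 0"]) (auto simp: aff_def subset_iff)
next
  case (Suc n)
  define X where "X = (\<lambda>x :: nat \<Rightarrow> 'a. x n)"
  define \<sigma> where "\<sigma> p = s (poly p X)" for p
  have PX: "poly p X \<in> polyfun (Suc n)" if "p \<in> poly_over (polyfun n)" for p
    unfolding X_def by (rule polyfun_Suc_of_poly[OF that])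
  have const: "\<sigma> [:a:] = s a" for a by (simp add: \<sigma>_def)
  have restrict: "mult_seminorm n s" using Suc.prems(1) by (auto simp: mult_seminorm_def polyfun_Suc)
  interpret A: approximable_ring v "polyfun n" \<sigma> "(\<lambda>x f. f x) ` aff n"
  proof
    fix E :: "((nat \<Rightarrow> 'a) \<Rightarrow> 'a) set" and \<delta> :: real
    assume "finite E" "E \<subseteq> polyfun n" "\<delta> > 0"
    from Suc.IH[OF restrict this]
    show "\<exists>h\<in>(\<lambda>x f. f x) ` aff n. (\<forall>a\<in>polyfun n. \<sigma> [:a:] = 0 \<longrightarrow> h a = 0) \<and>
        (\<forall>a\<in>E. \<sigma> [:a:] > 0 \<longrightarrow> h a \<noteq> 0 \<and> \<bar>ln (v (h a)) - ln (\<sigma> [:a:])\<bar> \<le> \<delta>)"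
      unfolding const by auto
  next
    show "\<sigma> 0 = 0" "\<sigma> 1 = 1" using Suc.prems(1) by (auto simp: \<sigma>_def mult_seminorm_def zero_fun_def one_fun_def)
  qed (use Suc.prems(1) PX polyfun_ring_closed comm_ring_hom_apply in \<open>auto simp: \<sigma>_def mult_seminorm_def\<close>)
  have "\<forall>f\<in>polyfun (Suc n). \<exists>p. p \<in> A.PR \<and> f = poly p X"
    unfolding X_def by (intro ballI polyfun_Suc_ex_poly[unfolded Bex_def])
  from bchoice[OF this] obtain r where r: "\<And>f. f \<in> polyfun (Suc n) \<Longrightarrow> r f \<in> A.PR \<and> f = poly (r f) X"
    by blast
  have rE: "finite (r ` E)" "r ` E \<subseteq> A.PR" using Suc.prems r by auto
  obtain y z where y: "y \<in> aff n" and kill: "\<And>p. p \<in> A.PR \<Longrightarrow> \<sigma> p = 0 \<Longrightarrow> poly (map_poly (\<lambda>f. f y) p) z = 0"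
    and ap: "\<And>p. p \<in> r ` E \<Longrightarrow> \<sigma> p > 0 \<Longrightarrow> poly (map_poly (\<lambda>f. f y) p) z \<noteq> 0 \<and> \<bar>A.dev (\<lambda>f. f y) z p\<bar> \<le> \<delta>"
    using A.approximable_extension[OF rE Suc.prems(4)] by auto
  define x where "x = y(n := z)"
  have x: "x \<in> aff (Suc n)" using y by (auto simp: x_def aff_def)
  \<comment> \<open>Coefficients from \<open>polyfun n\<close> do not see coordinate
    \<open>n\<close>, the only one where \<open>x\<close> and \<open>y\<close> can differ.\<close>
  have "map_poly (\<lambda>f. f x) p = map_poly (\<lambda>f. f y) p" if "p \<in> A.PR" for p
    by (rule poly_eqI) (use that in \<open>auto simp: coeff_map_poly poly_over_def x_def intro: polyfun_cong\<close>)
  then have ev: "f x = poly (map_poly (\<lambda>f. f y) (r f)) z" if "f \<in> polyfun (Suc n)" for f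
    using r[OF that] poly_apply[of "r f" X x] by (simp add: X_def x_def)
  have s: "\<sigma> (r f) = s f" if "f \<in> polyfun (Suc n)" for f using r[OF that] by (simp add: \<sigma>_def)
  show ?case
  proof (intro bexI[OF _ x] conjI ballI impI)
    fix f assume f: "f \<in> polyfun (Suc n)" "s f = 0"
    show "f x = 0" using kill[of "r f"] r s f by (simp add: ev)
  next
    fix f assume f: "f \<in> E" "s f > 0"
    then have fP: "f \<in> polyfun (Suc n)" using Suc.prems by auto
    show "f x \<noteq> 0" "\<bar>ln (v (f x)) - ln (s f)\<bar> \<le> \<delta>"
      using ap[of "r f"] f s[OF fP] by (auto simp: ev[OF fP] A.dev_def)
  qed
qed

end

section \<open>The inverse limit of linear tropicalizations\<close>

lemma tendsto_fun_iff:
  fixes f :: "'c \<Rightarrow> 'i \<Rightarrow> 'b::topological_space"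
  shows "(f \<longlongrightarrow> l) F \<longleftrightarrow> (\<forall>k. ((\<lambda>x. f x k) \<longlongrightarrow> l k) F)"
  unfolding limitin_canonical_iff[symmetric] euclidean_product_topology[symmetric] limitin_componentwise by simp

lemma compact_box: "compact (PiE UNIV (\<lambda>f :: 'i. {0..b f :: real}))"
proof -
  have "compactin (product_topology (\<lambda>_. euclidean) UNIV) (PiE UNIV (\<lambda>f :: 'i. {0..b f :: real}))"
    unfolding compactin_PiE by simp
  then show ?thesis by (simp add: euclidean_product_topology)
qed

lemma tendsto_of_bound_inverse_Suc:
  fixes a :: "nat \<Rightarrow> real"
  assumes "\<And>m. \<bar>a m - L\<bar> \<le> inverse (real (Suc m))" shows "a \<longlonglongrightarrow> L"
proof -
  have "(\<lambda>m. a m - L) \<longlonglongrightarrow> 0"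
    by (rule Lim_null_comparison[OF _ LIMSEQ_inverse_real_of_nat]) (use assms in auto)
  then show ?thesis by (rule LIM_zero_cancel)
qed

text \<open>Removes the factor \<open>N + 1\<close> from an estimate of \<open>N\<close>-th powers.
  Squaring Bernoulli's inequality gives quadratic growth of \<open>r ^ (2 * N)\<close>, which
  outruns \<open>2 * N + 1\<close>.\<close>

lemma power_le_linear_imp_le_1:
  fixes r :: real
  assumes "0 \<le> r" "\<And>N. r ^ N \<le> real N + 1" shows "r \<le> 1"
proof (rule ccontr)
  assume "\<not> r \<le> 1"
  then obtain e where e: "e > 0" "r = 1 + e" using that[of "r - 1"] by auto
  \<comment> \<open>For such \<open>N\<close>, \<open>3 * N < (N * e)^2 \<le> 2 * N + 1\<close>,
    which no positive integer satisfies.\<close>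
  obtain N :: nat where N: "3 / e\<^sup>2 < real N" using reals_Archimedean2 by blast
  then have N0: "0 < real N" using e by (meson divide_pos_pos less_trans zero_less_numeral zero_less_power)
  have "3 < e\<^sup>2 * N" using N e by (simp add: field_simps)
  then have "3 * real N < e\<^sup>2 * N * N" using N0 by simp
  moreover have "1 + real N * e \<le> r ^ N" unfolding e(2) using e by (intro Bernoulli_inequality) simp
  then have "real N * e \<le> r ^ N" by simp
  then have "(real N * e)\<^sup>2 \<le> (r ^ N)\<^sup>2" using e by (intro power_mono) auto
  moreover have "(r ^ N)\<^sup>2 \<le> real (2 * N) + 1" using assms(2)[of "2 * N"] by (simp add: power_mult[symmetric] mult.commute)
  ultimately have "3 * real N < 2 * real N + 1" by (simp add: power2_eq_square algebra_simps)
  then show False using N0 by simp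
qed

lemma expT_nonneg: "0 \<le> expT t" by (simp add: expT_def)

lemma expT_ereal [simp]: "expT (ereal r) = exp r" by (simp add: expT_def)

lemma expT_MInf [simp]: "expT (-\<infinity>) = 0" by (simp add: expT_def)

lemma logT_expT: "t \<noteq> \<infinity> \<Longrightarrow> logT (expT t) = t"
  by (cases t) (auto simp: logT_def)

lemma logT_not_PInf: "logT r \<noteq> \<infinity>" by (simp add: logT_def)

text \<open>The point \<open>\<infinity>\<close> is excluded because \<open>expT\<close> has the
  default value \<open>exp 0\<close> there. Near \<open>-\<infinity>\<close> the claim is that very
  negative numbers have small exponentials.\<close>

lemma expT_tendsto:
  assumes "t \<noteq> \<infinity>" shows "(expT \<longlongrightarrow> expT t) (nhds t)"
proof (cases t)
  case (real r)
  have "((\<lambda>y. exp (real_of_ereal y)) \<longlongrightarrow> exp r) (nhds t)"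
    by (intro tendsto_exp lim_real_of_ereal) (simp add: real filterlim_ident)
  moreover have "\<forall>\<^sub>F y in nhds t. exp (real_of_ereal y) = expT y"
  proof -
    have "\<forall>\<^sub>F y in nhds t. y \<noteq> -\<infinity>" using t1_space_nhds[of t "-\<infinity>"] real by auto
    then show ?thesis by eventually_elim (simp add: expT_def)
  qed
  ultimately show ?thesis unfolding real by (simp add: tendsto_cong[symmetric] Lim_transform_eventually)
next
  case MInf
  show ?thesis unfolding MInf
  proof (rule order_tendstoI)
    fix a :: real assume "expT (-\<infinity>) < a"
    then have a: "a > 0" by simp
    have "\<forall>\<^sub>F y in nhds (-\<infinity>). y < ereal (ln a)" 
      using eventually_nhds_in_open[of "{..<ereal (ln a)}" "-\<infinity>"] by simp
    then show "\<forall>\<^sub>F y in nhds (-\<infinity>). expT y < a"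
    proof eventually_elim
      case (elim y)
      show ?case
      proof (cases y)
        case (real r)
        then have "exp r < exp (ln a)" using elim by simp
        then show ?thesis using a real by simp
      qed (use elim a in auto)
    qed
  next
    fix a :: real assume "a < expT (-\<infinity>)"
    then show "\<forall>\<^sub>F y in nhds (-\<infinity>). a < expT y" by (auto intro!: always_eventually intro: less_le_trans expT_nonneg)
  qed
qed (use assms in simp)

lemma valued_field_expT:
  fixes \<nu> :: "'a::field \<Rightarrow> ereal"
  assumes "alg_closed TYPE('a)" "nonarch_valuation \<nu>" "nontrivial_valuation \<nu>"
  shows "alg_closed_valued (\<lambda>a. expT (\<nu> a))"
proof
  have nu: "\<nu> a \<noteq> \<infinity>" "\<nu> a = -\<infinity> \<longleftrightarrow> a = 0" "\<nu> (a * b) = \<nu> a + \<nu> b" "\<nu> (a + b) \<le> max (\<nu> a) (\<nu> b)" for a b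
    using assms(2) by (auto simp: nonarch_valuation_def)
  have mono: "expT s \<le> expT t" if "s \<le> t" "t \<noteq> \<infinity>" for s t
    using that by (cases s; cases t) (auto simp: expT_nonneg)
  fix a b :: 'a
  show "0 \<le> expT (\<nu> a)" by (rule expT_nonneg)
  show "expT (\<nu> a) = 0 \<longleftrightarrow> a = 0" using nu(1,2)[of a] by (cases "\<nu> a") auto
  show "expT (\<nu> (a * b)) = expT (\<nu> a) * expT (\<nu> b)"
    unfolding nu(3) using nu(1)[of a] nu(1)[of b] by (cases "\<nu> a"; cases "\<nu> b") (auto simp: exp_add)
  show "expT (\<nu> (a + b)) \<le> max (expT (\<nu> a)) (expT (\<nu> b))"
    using mono[of "\<nu> (a + b)" "\<nu> a"] mono[of "\<nu> (a + b)" "\<nu> b"] nu(4)[of a b] nu(1) by (auto simp: max_def split: if_splits)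
  show "\<exists>a. a \<noteq> 0 \<and> expT (\<nu> a) \<noteq> 1"
  proof -
    obtain a where a: "a \<noteq> 0" "\<nu> a \<noteq> 0" using assms(3) by (auto simp: nontrivial_valuation_def)
    then have "expT (\<nu> a) \<noteq> 1" using nu(1,2)[of a] by (cases "\<nu> a") (auto simp: zero_ereal_def)
    then show ?thesis using a by blast
  qed
  show "alg_closed TYPE('a)" by (rule assms(1))
qed

lemma polyfun_affine: "(\<lambda>x. c + (\<Sum>j<n. a j * x j)) \<in> polyfun n" for a :: "nat \<Rightarrow> 'a::comm_ring_1"
proof -
  have "(\<lambda>x. \<Sum>j<m. a j * x j) \<in> polyfun n" if "m \<le> n" for m
    using that
  proof (induction m)
    case (Suc m)
    then have "(\<lambda>x. (\<Sum>j<m. a j * x j) + a m * x m) \<in> polyfun n"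
      by (intro polyfun.add[of "\<lambda>x. \<Sum>j<m. a j * x j"] polyfun.mult[of "\<lambda>x. a m"] polyfun.const polyfun.var) auto
    then show ?case by simp
  qed (simp add: polyfun.const)
  then show ?thesis by (intro polyfun.add polyfun.const) simp
qed

lemma lin_map_polyfun: "lin_map n N i \<Longrightarrow> k < N \<Longrightarrow> (\<lambda>y. i y k) \<in> polyfun n"
proof -
  assume "lin_map n N i" "k < N"
  then obtain c a where "\<forall>x. i x k = c + (\<Sum>j<n. a j * x j)" unfolding lin_map_def by blast
  then have "(\<lambda>y. i y k) = (\<lambda>x. c + (\<Sum>j<n. a j * x j))" by auto
  then show ?thesis by (simp add: polyfun_affine)
qed

section \<open>Seminorms on \<open>X\<close> as limits of points of \<open>X\<close>\<close>

locale tropical_setting =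
  fixes \<nu> :: "'a::field \<Rightarrow> ereal" and n :: nat and X :: "(nat \<Rightarrow> 'a) set"
  assumes alg: "alg_closed TYPE('a)"
    and nonarch: "nonarch_valuation \<nu>" and nontriv: "nontrivial_valuation \<nu>"
    and closed_X: "zariski_closed n X"
begin

abbreviation v :: "'a \<Rightarrow> real" where "v a \<equiv> expT (\<nu> a)"

sublocale alg_closed_valued v by (rule valued_field_expT[OF alg nonarch nontriv])

lemma \<nu>_not_PInf: "\<nu> a \<noteq> \<infinity>" and \<nu>_0 [simp]: "\<nu> 0 = -\<infinity>"
  using nonarch by (auto simp: nonarch_valuation_def)

lemma logT_v: "logT (v a) = \<nu> a" by (rule logT_expT[OF \<nu>_not_PInf])

lemma v_of_nat: "v (of_nat k) \<le> 1"
proof (induction k)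
  case (Suc k)
  have "v (1 + of_nat k) \<le> max (v 1) (v (of_nat k))" by (rule v_add)
  also have "\<dots> \<le> 1" using Suc by (simp only: v_1 max.bounded_iff order_refl simp_thms)
  finally show ?case by simp
qed simp

lemma XanD:
  assumes "s \<in> Xan n \<nu> X"
  shows "f \<in> polyfun n \<Longrightarrow> g \<in> polyfun n \<Longrightarrow> (\<And>x. x \<in> X \<Longrightarrow> f x = g x) \<Longrightarrow> s f = s g"
    and "f \<in> polyfun n \<Longrightarrow> 0 \<le> s f"
    and "f \<in> polyfun n \<Longrightarrow> g \<in> polyfun n \<Longrightarrow> s (f * g) = s f * s g"
    and "f \<in> polyfun n \<Longrightarrow> g \<in> polyfun n \<Longrightarrow> s (f + g) \<le> s f + s g"
    and "s (\<lambda>x. c) = v c"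
proof -
  note D = assms[unfolded Xan_def mem_Collect_eq, THEN conjunct2]
  show "f \<in> polyfun n \<Longrightarrow> g \<in> polyfun n \<Longrightarrow> (\<And>x. x \<in> X \<Longrightarrow> f x = g x) \<Longrightarrow> s f = s g"
    by (rule D[THEN conjunct1, rule_format])
  note D = D[THEN conjunct2]
  show "f \<in> polyfun n \<Longrightarrow> 0 \<le> s f" by (rule D[THEN conjunct1, rule_format])
  note D = D[THEN conjunct2]
  show "f \<in> polyfun n \<Longrightarrow> g \<in> polyfun n \<Longrightarrow> s (f * g) = s f * s g"
    unfolding times_fun_def by (rule D[THEN conjunct1, rule_format])
  note D = D[THEN conjunct2]
  show "f \<in> polyfun n \<Longrightarrow> g \<in> polyfun n \<Longrightarrow> s (f + g) \<le> s f + s g"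
    unfolding plus_fun_def by (rule D[THEN conjunct1, rule_format])
  show "s (\<lambda>x. c) = v c" by (rule D[THEN conjunct2, rule_format])
qed

text \<open>Integers have size at most \<open>1\<close>, so the binomial theorem gives
  \<open>s (f + g) ^ N \<le> (N + 1) * M ^ N\<close> with \<open>M\<close> the larger size; letting
  \<open>N\<close> grow removes the factor. The case \<open>M = 0\<close> is separate because of the
  division by \<open>M\<close>.\<close>

lemma Xan_mult_seminorm:
  assumes s: "s \<in> Xan n \<nu> X" shows "mult_seminorm n s"
proof -
  note C = polyfun_ring_closed[of n, where 'a='a]
  have mult: "s (f * g) = s f * s g" and tri: "s (f + g) \<le> s f + s g" and nonneg: "0 \<le> s f"
    if "f \<in> polyfun n" "g \<in> polyfun n" for f g
    using XanD(2-4)[OF s] that by blast+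
  note const = XanD(5)[OF s]
  have one: "s 1 = 1" using const[of 1] by (simp add: one_fun_def)
  have pw: "f ^ k \<in> polyfun n" "s (f ^ k) = s f ^ k" if "f \<in> polyfun n" for f k
  proof -
    show P: "f ^ k \<in> polyfun n" for k by (rule ring_closed_power[OF C that])
    show "s (f ^ k) = s f ^ k"
    proof (induction k)
      case (Suc k)
      then show ?case using mult[OF that P, of k] by (simp only: power_Suc)
    qed (simp only: power_0 one)
  qed
  have sum: "s (sum g A) \<le> (\<Sum>i\<in>A. s (g i))" if "finite A" "\<And>i. i \<in> A \<Longrightarrow> g i \<in> polyfun n" for g and A :: "nat set"
    using that
  proof (induction A rule: finite_induct)
    case empty
    then show ?case using const[of 0] by (simp add: zero_fun_def)
  next
    case (insert x F)
    have "s (g x + sum g F) \<le> s (g x) + s (sum g F)" using insert.prems by (intro tri ring_closed_sum[OF C]) auto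
    moreover have "s (sum g F) \<le> (\<Sum>i\<in>F. s (g i))" using insert by simp
    ultimately show ?case unfolding sum.insert[OF insert.hyps] by linarith
  qed
  have "s (f + g) \<le> max (s f) (s g)" if f: "f \<in> polyfun n" and g: "g \<in> polyfun n" for f g
  proof -
    define M where "M = max (s f) (s g)"
    have fg: "f + g \<in> polyfun n" using C f g by (simp only: ring_closed_def)
    have M0: "0 \<le> M" unfolding M_def using nonneg[OF f f] by (simp add: max_def)
    have le: "s (f + g) ^ N \<le> (real N + 1) * M ^ N" for N
    proof -
      define T where "T k = of_nat (N choose k) * f ^ k * g ^ (N - k)" for k
      have oP: "of_nat m \<in> polyfun n" and os: "s (of_nat m) \<le> 1" for m
        unfolding of_nat_fun using const v_of_nat by (auto intro: polyfun.const)
      have oF: "of_nat (N choose k) * f ^ k \<in> polyfun n" for k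
        using C oP pw(1)[OF f] unfolding ring_closed_def by blast
      have TP: "T k \<in> polyfun n" for k unfolding T_def using C oF pw(1)[OF g] unfolding ring_closed_def by blast
      have Ts: "s (T k) = s (of_nat (N choose k)) * s f ^ k * s g ^ (N - k)" for k
        unfolding T_def mult[OF oF pw(1)[OF g]] mult[OF oP pw(1)[OF f]] pw(2)[OF f] pw(2)[OF g] ..
      have Tb: "s (T k) \<le> M ^ N" if "k \<le> N" for k
      proof -
        have "s (T k) \<le> 1 * M ^ k * M ^ (N - k)"
          unfolding Ts using os nonneg[OF f f] nonneg[OF g g] M0 nonneg[OF oP oP]
          by (intro mult_mono power_mono) (auto simp: M_def)
        also have "\<dots> = M ^ N" using that by (simp flip: power_add)
        finally show ?thesis .
      qed
      have "s (f + g) ^ N = s (\<Sum>k\<le>N. T k)"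
        unfolding pw(2)[OF fg, symmetric] binomial_ring T_def ..
      moreover have "s (\<Sum>k\<le>N. T k) \<le> (\<Sum>k\<le>N. s (T k))" by (rule sum) (auto simp: TP)
      moreover have "(\<Sum>k\<le>N. s (T k)) \<le> (\<Sum>k\<le>N. M ^ N)" by (rule sum_mono) (simp add: Tb)
      ultimately have "s (f + g) ^ N \<le> (\<Sum>k\<le>N. M ^ N)" by linarith
      then show ?thesis by (simp add: add.commute)
    qed
    show "s (f + g) \<le> M"
    proof (cases "M = 0")
      case True
      then show ?thesis using le[of 1] by simp
    next
      case False
      then have Mp: "M > 0" using M0 by simp
      have "s (f + g) / M \<le> 1"
      proof (rule power_le_linear_imp_le_1)
        show "0 \<le> s (f + g) / M" using nonneg[OF fg fg] M0 by simp
        show "(s (f + g) / M) ^ N \<le> real N + 1" for N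
          using le[of N] Mp by (simp add: power_divide divide_le_eq)
      qed
      then show ?thesis using Mp by (simp add: divide_le_eq)
    qed
  qed
  then show ?thesis unfolding mult_seminorm_def using mult nonneg const by blast
qed

text \<open>Density with tolerances tending to zero. The equations of \<open>X\<close> agree with
  \<open>0\<close> on \<open>X\<close>, so they lie in the kernel of \<open>s\<close> and hold at
  the approximating points.\<close>

lemma ex_approximating_sequence:
  assumes s: "s \<in> Xan n \<nu> X" and E: "finite E" "E \<subseteq> polyfun n"
  shows "\<exists>x :: nat \<Rightarrow> nat \<Rightarrow> 'a. (\<forall>m. x m \<in> X) \<and> (\<forall>f\<in>E. (\<lambda>m. \<nu> (f (x m))) \<longlonglongrightarrow> logT (s f))"
proof -
  define P where "P m x \<longleftrightarrow> x \<in> aff n \<and> (\<forall>f\<in>polyfun n. s f = 0 \<longrightarrow> f x = 0) \<and>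
    (\<forall>f\<in>E. s f > 0 \<longrightarrow> f x \<noteq> 0 \<and> \<bar>ln (v (f x)) - ln (s f)\<bar> \<le> inverse (real (Suc m)))" for m x
  have "\<exists>x. P m x" for m
    using points_dense[OF Xan_mult_seminorm[OF s] E, of "inverse (real (Suc m))"] unfolding P_def Bex_def by simp
  then obtain x where "\<And>m. P m (x m)" using choice[of P] by blast
  then have x: "\<And>m. x m \<in> aff n" "\<And>m f. f \<in> polyfun n \<Longrightarrow> s f = 0 \<Longrightarrow> f (x m) = 0"
    "\<And>m f. f \<in> E \<Longrightarrow> s f > 0 \<Longrightarrow> f (x m) \<noteq> 0 \<and> \<bar>ln (v (f (x m))) - ln (s f)\<bar> \<le> inverse (real (Suc m))"
    unfolding P_def by blast+
  have "x m \<in> X" for m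
  proof -
    obtain S where S: "S \<subseteq> polyfun n" "X = {x \<in> aff n. \<forall>f\<in>S. f x = 0}" using closed_X by (auto simp: zariski_closed_def)
    have "f (x m) = 0" if "f \<in> S" for f
    proof -
      have "s f = s (\<lambda>x. 0)" by (rule XanD(1)[OF s]) (use that S in \<open>auto intro: polyfun.const\<close>)
      also have "\<dots> = 0" by (simp add: XanD(5)[OF s])
      finally show ?thesis using x(2) that S by blast
    qed
    then show ?thesis using S x(1) by auto
  qed
  moreover have "(\<lambda>m. \<nu> (f (x m))) \<longlonglongrightarrow> logT (s f)" if f: "f \<in> E" for f
  proof (cases "s f = 0")
    case True
    then show ?thesis using x(2)[of f] f E by (auto simp: logT_def)
  next
    case False
    moreover have "0 \<le> s f" by (rule XanD(2)[OF s]) (use f E in blast)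
    ultimately have sf: "s f > 0" by simp
    have "(\<lambda>m. ln (v (f (x m)))) \<longlonglongrightarrow> ln (s f)"
      by (rule tendsto_of_bound_inverse_Suc) (use x(3)[OF f sf] in blast)
    then have "(\<lambda>m. ereal (ln (v (f (x m))))) \<longlonglongrightarrow> ereal (ln (s f))" by (simp only: lim_ereal)
    moreover have "ereal (ln (v (f (x m)))) = \<nu> (f (x m))" for m
      using x(3)[OF f sf, of m] logT_v[of "f (x m)"] by (auto simp: logT_def)
    ultimately show ?thesis using False by (simp add: logT_def)
  qed
  ultimately show ?thesis by blast
qed

section \<open>The map into the inverse limit\<close>

lemma lin_emb_coords: "(N, i) \<in> lin_embs n X \<Longrightarrow> k < N \<Longrightarrow> (\<lambda>y. i y k) \<in> polyfun n"
  by (auto simp: lin_embs_def lin_emb_def lin_map_polyfun)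

lemma lin_emb_zero: "(N, i) \<in> lin_embs n X \<Longrightarrow> k \<ge> N \<Longrightarrow> i x k = 0"
  by (auto simp: lin_embs_def lin_emb_def lin_map_def)

lemma tendsto_pi_i:
  assumes e: "(N, i) \<in> lin_embs n X"
    and x: "\<And>k. k < N \<Longrightarrow> (\<lambda>m. \<nu> (i (x m) k)) \<longlonglongrightarrow> logT (s (\<lambda>y. i y k))"
  shows "(\<lambda>m. nuv \<nu> (i (x m))) \<longlonglongrightarrow> pi_i N i s"
  unfolding tendsto_fun_iff nuv_def pi_i_def using x lin_emb_zero[OF e] by auto

lemma pi_i_in_TT: "pi_i N i s \<in> TT N"
  by (auto simp: TT_def pi_i_def logT_not_PInf)

text \<open>For compatibility, one sequence of points approximates \<open>s\<close> on the
  coordinates of both embeddings. Along it \<open>\<psi>\<close> carries one tropicalization to the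
  other, and its continuity on \<open>TT N\<close> passes this on to the limits.\<close>

lemma pi_lim_in_trop_limit:
  assumes s: "s \<in> Xan n \<nu> X" shows "pi_lim n X s \<in> trop_limit n \<nu> X"
proof -
  have 1: "pi_i N i s \<in> Trop \<nu> X N i" if e: "(N, i) \<in> lin_embs n X" for N i
  proof -
    obtain x where x: "\<And>m. x m \<in> X" "\<And>k. k < N \<Longrightarrow> (\<lambda>m. \<nu> (i (x m) k)) \<longlonglongrightarrow> logT (s (\<lambda>y. i y k))"
    proof -
      have E: "(\<lambda>k y. i y k) ` {..<N} \<subseteq> polyfun n" using lin_emb_coords[OF e] by auto
      obtain x where "\<forall>m. x m \<in> X" "\<forall>f\<in>(\<lambda>k y. i y k) ` {..<N}. (\<lambda>m. \<nu> (f (x m))) \<longlonglongrightarrow> logT (s f)"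
        using ex_approximating_sequence[OF s finite_imageI[OF finite_lessThan] E] by (elim exE conjE)
      then show ?thesis using that[of x] by simp
    qed
    have lim: "(\<lambda>m. nuv \<nu> (i (x m))) \<longlonglongrightarrow> pi_i N i s" by (rule tendsto_pi_i[OF e, of x s]) (rule x(2))
    have "pi_i N i s \<in> closure ((\<lambda>x. nuv \<nu> (i x)) ` X)"
    proof (rule Lim_in_closed_set[OF closed_closure _ _ lim])
      show "\<forall>\<^sub>F m in sequentially. nuv \<nu> (i (x m)) \<in> closure ((\<lambda>x. nuv \<nu> (i x)) ` X)"
        by (intro always_eventually allI subsetD[OF closure_subset] imageI x(1))
    qed simp
    then show ?thesis by (simp add: Trop_def pi_i_in_TT)
  qed
  have 2: "pi_i M j s = \<psi> (pi_i N i s)"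
    if e: "(N, i) \<in> lin_embs n X" "(M, j) \<in> lin_embs n X" and \<phi>: "\<forall>x\<in>X. \<phi> (i x) = j x"
      and \<psi>: "induced_trop \<nu> N M \<phi> \<psi>" for N i M j \<phi> \<psi>
  proof -
    obtain x where x: "\<And>m. x m \<in> X" "\<And>k. k < N \<Longrightarrow> (\<lambda>m. \<nu> (i (x m) k)) \<longlonglongrightarrow> logT (s (\<lambda>y. i y k))"
        "\<And>k. k < M \<Longrightarrow> (\<lambda>m. \<nu> (j (x m) k)) \<longlonglongrightarrow> logT (s (\<lambda>y. j y k))"
    proof -
      let ?E = "(\<lambda>k y. i y k) ` {..<N} \<union> (\<lambda>k y. j y k) ` {..<M}"
      have E: "?E \<subseteq> polyfun n" and fE: "finite ?E" using lin_emb_coords[OF e(1)] lin_emb_coords[OF e(2)] by auto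
      obtain x where "\<forall>m. x m \<in> X" "\<forall>f\<in>?E. (\<lambda>m. \<nu> (f (x m))) \<longlonglongrightarrow> logT (s f)"
        using ex_approximating_sequence[OF s fE E] by (elim exE conjE)
      then show ?thesis by (intro that[of x]) (simp_all add: ball_Un)
    qed
    have ia: "i y \<in> aff N" for y using lin_emb_zero[OF e(1)] by (auto simp: aff_def)
    have T: "nuv \<nu> (i y) \<in> TT N" for y using lin_emb_zero[OF e(1)] \<nu>_not_PInf by (auto simp: TT_def nuv_def)
    have lim: "(\<lambda>m. nuv \<nu> (i (x m))) \<longlonglongrightarrow> pi_i N i s" by (rule tendsto_pi_i[OF e(1), of x s]) (rule x(2))
    have "continuous_on (TT N) \<psi>" using \<psi> by (simp add: induced_trop_def)
    then have "(\<lambda>m. \<psi> (nuv \<nu> (i (x m)))) \<longlonglongrightarrow> \<psi> (pi_i N i s)"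
      by (rule continuous_on_tendsto_compose[OF _ lim pi_i_in_TT]) (simp add: T)
    moreover have "\<psi> (nuv \<nu> (i (x m))) = nuv \<nu> (j (x m))" for m
      using \<psi> ia \<phi> x(1) by (simp add: induced_trop_def)
    ultimately have a: "(\<lambda>m. nuv \<nu> (j (x m))) \<longlonglongrightarrow> \<psi> (pi_i N i s)" by simp
    have b: "(\<lambda>m. nuv \<nu> (j (x m))) \<longlonglongrightarrow> pi_i M j s" by (rule tendsto_pi_i[OF e(2), of x s]) (rule x(3))
    show ?thesis
    proof
      fix k
      show "pi_i M j s k = \<psi> (pi_i N i s) k"
        using a b unfolding tendsto_fun_iff by (meson LIMSEQ_unique)
    qed
  qed
  show ?thesis unfolding trop_limit_def pi_lim_def using 1 2 by auto
qed

section \<open>Directedness of the linear embeddings\<close>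

definition dominates :: "nat \<times> ((nat \<Rightarrow> 'a) \<Rightarrow> nat \<Rightarrow> 'a) \<Rightarrow> nat \<times> ((nat \<Rightarrow> 'a) \<Rightarrow> nat \<Rightarrow> 'a) \<Rightarrow> bool" where
  "dominates e e' \<longleftrightarrow> (\<exists>\<tau>. inj_on \<tau> {..<fst e'} \<and> \<tau> ` {..<fst e'} \<subseteq> {..<fst e} \<and>
     (\<forall>x. \<forall>k<fst e'. snd e' x k = snd e x (\<tau> k)))"

lemma dominates_refl: "dominates e e"
  unfolding dominates_def by (intro exI[of _ id]) auto

lemma dominates_trans:
  assumes "dominates a b" "dominates b c" shows "dominates a c"
proof -
  obtain \<tau> \<rho> where t: "inj_on \<tau> {..<fst b}" "\<tau> ` {..<fst b} \<subseteq> {..<fst a}" "\<forall>x. \<forall>k<fst b. snd b x k = snd a x (\<tau> k)"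
    and r: "inj_on \<rho> {..<fst c}" "\<rho> ` {..<fst c} \<subseteq> {..<fst b}" "\<forall>x. \<forall>k<fst c. snd c x k = snd b x (\<rho> k)"
    using assms unfolding dominates_def by (elim exE conjE)
  have "inj_on (\<tau> \<circ> \<rho>) {..<fst c}" using t(1) r(1,2) by (intro comp_inj_on) (auto intro: inj_on_subset)
  moreover have "(\<tau> \<circ> \<rho>) ` {..<fst c} \<subseteq> {..<fst a}" unfolding image_comp[symmetric] using t(2) r(2) by blast
  moreover have "\<forall>x. \<forall>k<fst c. snd c x k = snd a x ((\<tau> \<circ> \<rho>) k)" using t(3) r(2,3) by (auto simp: image_subset_iff)
  ultimately show ?thesis unfolding dominates_def by blast
qed

text \<open>Links \<open>dominates\<close>, which knows only selections of coordinates, with the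
  transition maps of the limit. The selection \<open>p\<close> is admissible as a projection after
  \<open>q\<close>, the identity on \<open>aff N\<close>; the same selection on valuations, padded
  with \<open>-\<infinity>\<close>, is the induced map.\<close>

lemma trop_limit_dominates:
  assumes t: "t \<in> trop_limit n \<nu> X" and e: "(N, i) \<in> lin_embs n X" "(M, j) \<in> lin_embs n X"
    and \<tau>: "inj_on \<tau> {..<M}" "\<tau> ` {..<M} \<subseteq> {..<N}" "\<forall>x. \<forall>k<M. j x k = i x (\<tau> k)" and k: "k < M"
  shows "t (M, j) k = t (N, i) (\<tau> k)"
proof -
  define p :: "(nat \<Rightarrow> 'a) \<Rightarrow> nat \<Rightarrow> 'a" where "p = (\<lambda>y k. if k < M then y (\<tau> k) else 0)"
  define q :: "(nat \<Rightarrow> 'a) \<Rightarrow> nat \<Rightarrow> 'a" where "q = (\<lambda>y k. if k < N then y k else 0)"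
  define \<psi> :: "(nat \<Rightarrow> ereal) \<Rightarrow> nat \<Rightarrow> ereal" where "\<psi> = (\<lambda>y k. if k < M then y (\<tau> k) else -\<infinity>)"
  have \<tau>N: "\<tau> l < N" if "l < M" for l using \<tau>(2) that by auto
  have "lin_map N N q"
    unfolding lin_map_def
  proof (intro conjI allI impI)
    fix l assume "l < N"
    then have "\<forall>x. q x l = 0 + (\<Sum>j<N. (if j = l then 1 else 0) * x j)"
      by (simp add: q_def if_distrib[of "\<lambda>c. c * _"] cong: if_cong)
    then show "\<exists>c a. \<forall>x. q x l = c + (\<Sum>j<N. a j * x j)" by (intro exI)
  qed (auto simp: q_def)
  then have "lin_emb N (aff N) N q"
    unfolding lin_emb_def by (auto intro!: exI[of _ "\<lambda>j x. x j"] polyfun.var simp: q_def)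
  moreover have "coord_proj N M p" unfolding coord_proj_def p_def using \<tau>(1,2) by blast
  moreover have "p = p \<circ> q" by (auto simp: p_def q_def fun_eq_iff \<tau>N)
  ultimately have ex: "\<exists>L e pr. lin_emb N (aff N) L e \<and> coord_proj L M pr \<and> p = pr \<circ> e" by blast
  have "p ` torus N \<subseteq> torus M" by (auto simp: torus_def aff_def p_def \<tau>N)
  moreover have "\<forall>y\<in>torus N. \<forall>z\<in>torus N. p (\<lambda>k. y k * z k) = (\<lambda>k. p y k * p z k)" by (auto simp: p_def fun_eq_iff)
  ultimately have "admissible N M p" unfolding admissible_def using ex by blast
  moreover have "\<forall>x\<in>X. p (i x) = j x" using \<tau>(3) lin_emb_zero[OF e(2)] by (auto simp: p_def fun_eq_iff)
  moreover have "induced_trop \<nu> N M p \<psi>"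
    unfolding induced_trop_def
  proof (intro conjI ballI)
    show "continuous_on (TT N) \<psi>"
    proof (rule continuous_on_coordinatewise_then_product)
      fix l
      show "continuous_on (TT N) (\<lambda>y. \<psi> y l)"
        by (cases "l < M") (auto simp: \<psi>_def intro: continuous_on_product_then_coordinatewise continuous_on_id)
    qed
    show "\<psi> ` TT N \<subseteq> TT M" by (auto simp: \<psi>_def TT_def split: if_splits)
    show "\<psi> (nuv \<nu> y) = nuv \<nu> (p y)" for y by (auto simp: \<psi>_def nuv_def p_def fun_eq_iff)
  qed
  moreover have "\<forall>(N, i)\<in>lin_embs n X. \<forall>(M, j)\<in>lin_embs n X. \<forall>\<phi> \<psi>.
        admissible N M \<phi> \<and> (\<forall>x\<in>X. \<phi> (i x) = j x) \<and> induced_trop \<nu> N M \<phi> \<psi> \<longrightarrow> t (M, j) = \<psi> (t (N, i))"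
    using t unfolding trop_limit_def by simp
  ultimately have "t (M, j) = \<psi> (t (N, i))" using e by fast
  then show ?thesis using k by (simp add: \<psi>_def)
qed

text \<open>Concatenation of the two embeddings. A polynomial inverse of the first one still works,
  as it reads only the first \<open>N\<close> coordinates.\<close>

lemma ex_dominating_pair:
  assumes e: "e \<in> lin_embs n X" "e' \<in> lin_embs n X"
  shows "\<exists>d\<in>lin_embs n X. dominates d e \<and> dominates d e'"
proof -
  obtain N i M j where eq: "e = (N, i)" "e' = (M, j)" by (cases e, cases e')
  define c where "c = (\<lambda>x k. if k < N then i x k else if k < N + M then j x (k - N) else 0)"
  have l: "lin_map n N i" "lin_map n M j" using e by (auto simp: eq lin_embs_def lin_emb_def)
  obtain g where g: "\<forall>l<n. g l \<in> polyfun N" "\<forall>x\<in>X. \<forall>l<n. g l (i x) = x l"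
    using e(1) by (auto simp: eq lin_embs_def lin_emb_def)
  have "lin_map n (N + M) c"
    unfolding lin_map_def
  proof (intro conjI allI impI)
    fix k assume k: "k < N + M"
    show "\<exists>b a. \<forall>x. c x k = b + (\<Sum>j<n. a j * x j)"
    proof (cases "k < N")
      case True
      then show ?thesis using l(1) by (simp add: lin_map_def c_def)
    next
      case False
      then have "k - N < M" using k by simp
      then show ?thesis using l(2) False k by (simp add: lin_map_def c_def)
    qed
  qed (simp add: c_def)
  moreover have "\<forall>l<n. g l \<in> polyfun (N + M)" 
    by (intro allI impI polyfun_mono[OF g(1)[rule_format]]) auto
  moreover have "g l (c x) = x l" if "x \<in> X" "l < n" for x l
  proof -
    have "g l (c x) = g l (i x)" by (rule polyfun_cong[OF g(1)[rule_format, OF that(2)]]) (simp add: c_def)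
    then show ?thesis using g that by simp
  qed
  ultimately have "(N + M, c) \<in> lin_embs n X" unfolding lin_embs_def lin_emb_def by blast
  moreover have "dominates (N + M, c) e"
    unfolding dominates_def eq by (intro exI[of _ id]) (auto simp: c_def)
  moreover have "dominates (N + M, c) e'"
    unfolding dominates_def eq by (intro exI[of _ "\<lambda>k. k + N"]) (auto simp: c_def)
  ultimately show ?thesis by blast
qed

lemma ex_dominating_finite:
  assumes "finite F" "F \<subseteq> lin_embs n X" "e0 \<in> lin_embs n X"
  shows "\<exists>d\<in>lin_embs n X. dominates d e0 \<and> (\<forall>e\<in>F. dominates d e)"
  using assms(1,2)
proof (induction F rule: finite_induct)
  case empty
  then show ?case using assms(3) dominates_refl by blast
next
  case (insert a F)
  then obtain d where d: "d \<in> lin_embs n X" "dominates d e0" "\<forall>e\<in>F. dominates d e" by auto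
  obtain d' where d': "d' \<in> lin_embs n X" "dominates d' d" "dominates d' a"
    using ex_dominating_pair[OF d(1), of a] insert.prems by auto
  then show ?case using d dominates_trans[OF d'(2)] by (intro bexI[OF _ d'(1)]) auto
qed

text \<open>Serves twice: with \<open>b = 0\<close> it bounds the coordinates in the compactness
  argument, and with \<open>b\<close> a point of \<open>X\<close> it separates this point from the
  others.\<close>

lemma translation_lin_emb:
  "(n, \<lambda>x k. if k < n then x k - b k else 0) \<in> lin_embs n X"
proof -
  let ?i = "\<lambda>x k. if k < n then x k - b k else 0"
  have "lin_map n n ?i"
    unfolding lin_map_def
  proof (intro conjI allI impI)
    fix k assume "k < n"
    then have "\<forall>x. ?i x k = - b k + (\<Sum>j<n. (if j = k then 1 else 0) * x j)"
      by (simp add: if_distrib[of "\<lambda>c. c * _"] cong: if_cong)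
    then show "\<exists>c a. \<forall>x. ?i x k = c + (\<Sum>j<n. a j * x j)" by (intro exI)
  qed auto
  moreover have "(\<lambda>x. x j + b j) \<in> polyfun n" if "j < n" for j
    using polyfun.add[OF polyfun.var[OF that] polyfun.const[of "b j"]] by simp
  ultimately show ?thesis unfolding lin_embs_def lin_emb_def
    by (auto intro!: exI[of _ "\<lambda>j x. x j + b j"])
qed

section \<open>Limits of point seminorms and surjectivity\<close>

definition point_seminorm :: "(nat \<Rightarrow> 'a) \<Rightarrow> ((nat \<Rightarrow> 'a) \<Rightarrow> 'a) \<Rightarrow> real" where
  "point_seminorm x = (\<lambda>f. if f \<in> polyfun n then v (f x) else 0)"

text \<open>The axioms of \<open>Xan\<close> and the estimates of coordinates are non-strict
  inequalities between continuous functions of the seminorm, hence closed conditions that can be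
  checked on points.\<close>

lemma point_seminorm_closure:
  fixes A B :: "(((nat \<Rightarrow> 'a) \<Rightarrow> 'a) \<Rightarrow> real) \<Rightarrow> real"
  assumes s: "s \<in> closure (point_seminorm ` Y)" and c: "continuous_on UNIV A" "continuous_on UNIV B"
    and le: "\<And>x. x \<in> Y \<Longrightarrow> A (point_seminorm x) \<le> B (point_seminorm x)"
  shows "A s \<le> B s"
proof -
  have "closure (point_seminorm ` Y) \<subseteq> {s. A s \<le> B s}"
    using le by (intro closure_minimal closed_Collect_le c) auto
  then show ?thesis using s by auto
qed

lemma closure_point_seminorm_Xan:
  assumes s: "s \<in> closure (point_seminorm ` X)" shows "s \<in> Xan n \<nu> X"
proof -
  have le: "A s \<le> B s" if "continuous_on UNIV A" "continuous_on UNIV B" "\<And>x. x \<in> X \<Longrightarrow> A (point_seminorm x) \<le> B (point_seminorm x)" for A B :: "(((nat \<Rightarrow> 'a) \<Rightarrow> 'a) \<Rightarrow> real) \<Rightarrow> real"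
    by (rule point_seminorm_closure[OF s that])
  have eq: "A s = B s" if "continuous_on UNIV A" "continuous_on UNIV B" "\<And>x. x \<in> X \<Longrightarrow> A (point_seminorm x) = B (point_seminorm x)" for A B :: "(((nat \<Rightarrow> 'a) \<Rightarrow> 'a) \<Rightarrow> real) \<Rightarrow> real"
    using le[of A B] le[of B A] that by (simp add: antisym)
  show ?thesis unfolding Xan_def mem_Collect_eq
  proof (intro conjI allI impI ballI)
    fix f :: "(nat \<Rightarrow> 'a) \<Rightarrow> 'a" assume "f \<notin> polyfun n"
    then show "s f = 0" by (intro eq[of "\<lambda>s. s f" "\<lambda>s. 0"]) (auto simp: point_seminorm_def)
  next
    fix f g :: "(nat \<Rightarrow> 'a) \<Rightarrow> 'a" assume "f \<in> polyfun n" "g \<in> polyfun n" "\<forall>x\<in>X. f x = g x"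
    then show "s f = s g" by (intro eq[of "\<lambda>s. s f" "\<lambda>s. s g"]) (auto simp: point_seminorm_def)
  next
    fix f :: "(nat \<Rightarrow> 'a) \<Rightarrow> 'a" assume "f \<in> polyfun n"
    then show "0 \<le> s f" by (intro le[of "\<lambda>s. 0" "\<lambda>s. s f"]) (auto simp: point_seminorm_def v_nonneg)
  next
    fix f g :: "(nat \<Rightarrow> 'a) \<Rightarrow> 'a" assume fg: "f \<in> polyfun n" "g \<in> polyfun n"
    then have "(\<lambda>x. f x * g x) \<in> polyfun n" "(\<lambda>x. f x + g x) \<in> polyfun n" by (auto intro: polyfun.intros)
    note P = this fg
    show "s (\<lambda>x. f x * g x) = s f * s g"
      by (rule eq[of "\<lambda>s. s (\<lambda>x. f x * g x)" "\<lambda>s. s f * s g"])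
         (use P in \<open>auto simp: point_seminorm_def v_mult intro!: continuous_on_mult\<close>)
    have "max a b \<le> a + b" if "0 \<le> a" "0 \<le> b" for a b :: real using that by simp
    then have "v (f x + g x) \<le> v (f x) + v (g x)" for x using v_add v_nonneg by (meson order_trans)
    then show "s (\<lambda>x. f x + g x) \<le> s f + s g"
      by (intro le[of "\<lambda>s. s (\<lambda>x. f x + g x)" "\<lambda>s. s f + s g"])
         (use P in \<open>auto simp: point_seminorm_def intro!: continuous_on_add\<close>)
  next
    fix c :: 'a
    show "s (\<lambda>x. c) = v c" by (rule eq[of "\<lambda>s. s (\<lambda>x. c)" "\<lambda>s. v c"]) (auto simp: point_seminorm_def polyfun.const)
  qed
qed

text \<open>Boundedness on polydiscs: the bounds are the side lengths of a compact box that contains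
  the point seminorms of the polydisc.\<close>

lemma polyfun_bounded:
  assumes "f \<in> polyfun n"
  shows "\<exists>B\<ge>0. \<forall>x. (\<forall>k<n. v (x k) \<le> \<beta> k) \<longrightarrow> v (f x) \<le> B"
  using assms
proof (induction f rule: polyfun.induct)
  case (const c)
  show ?case by (intro exI[of _ "v c"]) (simp add: v_nonneg)
next
  case (var k)
  then show ?case by (intro exI[of _ "max 0 (\<beta> k)"]) (auto simp: le_max_iff_disj)
next
  case (add f g)
  then obtain B C where "B \<ge> 0" "C \<ge> 0" "\<forall>x. (\<forall>k<n. v (x k) \<le> \<beta> k) \<longrightarrow> v (f x) \<le> B" "\<forall>x. (\<forall>k<n. v (x k) \<le> \<beta> k) \<longrightarrow> v (g x) \<le> C" by blast
  then have "\<forall>x. (\<forall>k<n. v (x k) \<le> \<beta> k) \<longrightarrow> v (f x + g x) \<le> max B C"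
    by (meson max.mono order_trans v_add)
  then show ?case using \<open>B \<ge> 0\<close> by (intro exI[of _ "max B C"]) auto
next
  case (mult f g)
  then obtain B C where "B \<ge> 0" "C \<ge> 0" "\<forall>x. (\<forall>k<n. v (x k) \<le> \<beta> k) \<longrightarrow> v (f x) \<le> B" "\<forall>x. (\<forall>k<n. v (x k) \<le> \<beta> k) \<longrightarrow> v (g x) \<le> C" by blast
  then have "\<forall>x. (\<forall>k<n. v (x k) \<le> \<beta> k) \<longrightarrow> v (f x * g x) \<le> B * C"
    unfolding v_mult by (meson mult_mono v_nonneg)
  then show ?case using \<open>B \<ge> 0\<close> \<open>C \<ge> 0\<close> by (intro exI[of _ "B * C"]) auto
qed

lemma trop_limit_in_pi_lim:
  assumes t: "t \<in> trop_limit n \<nu> X" shows "t \<in> pi_lim n X ` Xan n \<nu> X"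
proof -
  have tT: "t (N, i) \<in> Trop \<nu> X N i" if "(N, i) \<in> lin_embs n X" for N i
    using t that unfolding trop_limit_def by fast
  then have TT: "t (N, i) \<in> TT N" if "(N, i) \<in> lin_embs n X" for N i using that by (auto simp: Trop_def)
  have tu: "t g = undefined" if "g \<notin> lin_embs n X" for g
    using t that unfolding trop_limit_def by blast
  \<comment> \<open>Distances are taken after exponentiation, so entries \<open>-\<infinity>\<close>
    of \<open>t\<close> are treated like all others.\<close>
  define Y where "Y e \<epsilon> = {x \<in> X. \<forall>k<fst e. \<bar>v (snd e x k) - expT (t e k)\<bar> \<le> \<epsilon>}" for e \<epsilon>
  have Yne: "Y e \<epsilon> \<noteq> {}" if e: "e \<in> lin_embs n X" and \<epsilon>: "\<epsilon> > 0" for e \<epsilon>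
  proof -
    obtain N i where ei: "e = (N, i)" by (cases e)
    have "\<forall>\<^sub>F y in nhds (t e). \<bar>expT (y k) - expT (t e k)\<bar> < \<epsilon>" for k
    proof -
      have "t e k \<noteq> \<infinity>" using TT e by (auto simp: ei TT_def)
      then have 1: "(expT \<longlongrightarrow> expT (t e k)) (nhds (t e k))" by (rule expT_tendsto)
      have "((\<lambda>y. y k) \<longlongrightarrow> t e k) (nhds (t e))"
        using tendsto_fun_iff[of "\<lambda>y. y" "t e" "nhds (t e)"] by (simp add: filterlim_ident)
      then have "((\<lambda>y. expT (y k)) \<longlongrightarrow> expT (t e k)) (nhds (t e))" using filterlim_compose[OF 1] by blast
      then show ?thesis using \<epsilon> by (auto simp: tendsto_iff dist_real_def)
    qed
    then have "\<forall>\<^sub>F y in nhds (t e). \<forall>k\<in>{..<N}. \<bar>expT (y k) - expT (t e k)\<bar> < \<epsilon>"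
      by (intro eventually_ball_finite) auto
    then obtain U where U: "open U" "t e \<in> U" "\<forall>y\<in>U. \<forall>k\<in>{..<N}. \<bar>expT (y k) - expT (t e k)\<bar> < \<epsilon>"
      unfolding eventually_nhds by blast
    have "t e \<in> closure ((\<lambda>x. nuv \<nu> (i x)) ` X)" using tT e by (auto simp: ei Trop_def)
    then have "U \<inter> (\<lambda>x. nuv \<nu> (i x)) ` X \<noteq> {}" using U(1,2) by (auto simp: closure_iff_nhds_not_empty)
    then obtain x where x: "x \<in> X" "nuv \<nu> (i x) \<in> U" by auto
    have "x \<in> Y e \<epsilon>" using x(1) U(3)[rule_format, OF x(2)] by (auto simp: Y_def ei nuv_def less_imp_le)
    then show ?thesis by blast
  qed
  \<comment> \<open>The coordinates of \<open>e\<close> occur among those of \<open>d\<close>, with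
    the same entries of \<open>t\<close>, so closeness along \<open>d\<close> is the stronger
    condition.\<close>
  have Ymono: "Y d \<epsilon> \<subseteq> Y e \<epsilon>'" if dom: "dominates d e" and "d \<in> lin_embs n X" "e \<in> lin_embs n X" "\<epsilon> \<le> \<epsilon>'" for d e \<epsilon> \<epsilon>'
  proof
    fix x assume x: "x \<in> Y d \<epsilon>"
    obtain \<tau> where \<tau>: "inj_on \<tau> {..<fst e}" "\<tau> ` {..<fst e} \<subseteq> {..<fst d}" "\<forall>x. \<forall>k<fst e. snd e x k = snd d x (\<tau> k)"
      using dom unfolding dominates_def by (elim exE conjE)
    have "\<bar>v (snd e x k) - expT (t e k)\<bar> \<le> \<epsilon>'" if k: "k < fst e" for k
    proof -
      have "t e k = t d (\<tau> k)"
        using trop_limit_dominates[OF t, of "fst d" "snd d" "fst e" "snd e" \<tau> k] \<tau> k \<open>d \<in> _\<close> \<open>e \<in> _\<close> by simp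
      moreover have "\<tau> k < fst d" using \<tau>(2) k by auto
      ultimately show ?thesis using x \<tau>(3) k \<open>\<epsilon> \<le> \<epsilon>'\<close> by (auto simp: Y_def intro: order_trans)
    qed
    then show "x \<in> Y e \<epsilon>'" using x by (auto simp: Y_def)
  qed
  define e0 :: "nat \<times> ((nat \<Rightarrow> 'a) \<Rightarrow> nat \<Rightarrow> 'a)" where "e0 = (n, \<lambda>x k. if k < n then x k - 0 else 0)"
  have e0: "e0 \<in> lin_embs n X" unfolding e0_def using translation_lin_emb[of "\<lambda>_. 0"] by simp
  \<comment> \<open>The margin \<open>1\<close> is the tolerance in \<open>Y e0 1\<close>, from
    which the points for the finite intersection property are taken.\<close>
  define \<beta> where "\<beta> k = expT (t e0 k) + 1" for k
  have "\<forall>f\<in>polyfun n. \<exists>B. 0 \<le> B \<and> (\<forall>x. (\<forall>k<n. v (x k) \<le> \<beta> k) \<longrightarrow> v (f x) \<le> B)"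
    using polyfun_bounded by blast
  from bchoice[OF this] obtain b where b: "\<forall>f\<in>polyfun n. 0 \<le> b f \<and> (\<forall>x. (\<forall>k<n. v (x k) \<le> \<beta> k) \<longrightarrow> v (f x) \<le> b f)" ..
  define K where "K = PiE UNIV (\<lambda>f. {0..if f \<in> polyfun n then b f else 0})"
  have K: "compact K" unfolding K_def by (rule compact_box)
  have YK: "point_seminorm x \<in> K" if "x \<in> Y e0 1" for x
  proof -
    have "v (x k) \<le> \<beta> k" if "k < n" for k
    proof -
      have "\<bar>v (x k) - expT (t e0 k)\<bar> \<le> 1" using \<open>x \<in> Y e0 1\<close> that by (auto simp: Y_def e0_def)
      then show ?thesis by (simp add: \<beta>_def)
    qed
    then show ?thesis using b by (auto simp: K_def point_seminorm_def v_nonneg)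
  qed
  \<comment> \<open>Letting the tolerance tend to zero with \<open>m\<close> forces a common element
    to take the prescribed values exactly.\<close>
  define D where "D = (\<lambda>(e, m). closure (point_seminorm ` Y e (inverse (real (Suc m)))))"
  have "K \<inter> \<Inter> (D ` (lin_embs n X \<times> UNIV)) \<noteq> {}"
  proof (rule compact_imp_fip_image[OF K])
    show "closed (D a)" for a by (cases a) (simp add: D_def)
    fix I assume I: "finite I" "I \<subseteq> lin_embs n X \<times> (UNIV :: nat set)"
    obtain d where d: "d \<in> lin_embs n X" "dominates d e0" "\<forall>e\<in>fst ` I. dominates d e"
    proof -
      have "fst ` I \<subseteq> lin_embs n X" using I(2) by auto
      then show ?thesis using ex_dominating_finite[OF finite_imageI[OF I(1)] _ e0] that by metis
    qed
    define m where "m = Max (insert 0 (snd ` I))"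
    have m: "k \<le> m" if "(e, k) \<in> I" for e k unfolding m_def using I(1) that by (intro Max_ge) (auto simp: image_iff intro!: bexI)
    obtain x where x: "x \<in> Y d (inverse (real (Suc m)))" using Yne[OF d(1), of "inverse (real (Suc m))"] by auto
    have "inverse (real (Suc m)) \<le> 1" by (simp add: inverse_le_1_iff)
    then have "x \<in> Y e0 1" using Ymono[OF d(2,1) e0] x by blast
    moreover have "point_seminorm x \<in> D a" if a: "a \<in> I" for a
    proof -
      obtain e k where ek: "a = (e, k)" by (cases a)
      have "inverse (real (Suc m)) \<le> inverse (real (Suc k))" using m[of e k] a ek by (simp add: le_imp_inverse_le)
      moreover have "e \<in> lin_embs n X" "dominates d e" using a I(2) d(3) unfolding ek by force+
      ultimately have "x \<in> Y e (inverse (real (Suc k)))" using Ymono[OF _ d(1)] x by blast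
      then have "point_seminorm x \<in> closure (point_seminorm ` Y e (inverse (real (Suc k))))"
        by (intro subsetD[OF closure_subset] imageI)
      then show ?thesis by (simp only: ek D_def prod.case)
    qed
    ultimately show "K \<inter> \<Inter> (D ` I) \<noteq> {}" using YK by blast
  qed
  then obtain s where s: "\<And>e m. e \<in> lin_embs n X \<Longrightarrow> s \<in> closure (point_seminorm ` Y e (inverse (real (Suc m))))"
    by (auto simp: D_def)
  have "Y e0 (inverse (real (Suc 0))) \<subseteq> X" by (auto simp: Y_def)
  then have sX: "s \<in> Xan n \<nu> X"
    using closure_point_seminorm_Xan s[OF e0, of 0] closure_mono[OF image_mono] by blast
  have val: "s (\<lambda>y. i y k) = expT (t (N, i) k)" if e: "(N, i) \<in> lin_embs n X" and k: "k < N" for N i k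
  proof -
    have "\<bar>s (\<lambda>y. i y k) - expT (t (N, i) k)\<bar> \<le> inverse (real (Suc m))" for m
      by (rule point_seminorm_closure[OF s[OF e, of m], of "\<lambda>s. \<bar>s (\<lambda>y. i y k) - expT (t (N, i) k)\<bar>" "\<lambda>_. inverse (real (Suc m))"])
         (use k lin_emb_coords[OF e k] in \<open>auto simp: Y_def point_seminorm_def intro!: continuous_intros\<close>)
    then have "(\<lambda>m::nat. s (\<lambda>y. i y k)) \<longlonglongrightarrow> expT (t (N, i) k)" by (rule tendsto_of_bound_inverse_Suc)
    then show ?thesis by (simp add: LIMSEQ_const_iff)
  qed
  have "pi_i N i s = t (N, i)" if e: "(N, i) \<in> lin_embs n X" for N i
  proof
    fix k
    show "pi_i N i s k = t (N, i) k"
      using TT[OF e] val[OF e, of k] by (auto simp: pi_i_def TT_def logT_expT)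
  qed
  then have "pi_lim n X s = t" by (auto simp: pi_lim_def fun_eq_iff tu)
  then show ?thesis using sX by blast
qed

text \<open>Translation by \<open>x\<close> moves \<open>x\<close> to the origin, the only point all
  of whose valuations are \<open>-\<infinity>\<close>. Coordinates from \<open>n\<close> on agree
  because \<open>X\<close> lies in \<open>aff n\<close>.\<close>

lemma inj_on_pi_lim_Xcl: "inj_on (pi_lim n X) (Xcl n \<nu> X)"
proof (rule inj_onI)
  fix s s' assume "s \<in> Xcl n \<nu> X" "s' \<in> Xcl n \<nu> X" and eq: "pi_lim n X s = pi_lim n X s'"
  then obtain x y where x: "x \<in> X" "s = point_seminorm x" and y: "y \<in> X" "s' = point_seminorm y"
    unfolding Xcl_def point_seminorm_def by blast
  define i where "i = (\<lambda>z k. if k < n then z k - x k else 0)"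
  have e: "(n, i) \<in> lin_embs n X" unfolding i_def by (rule translation_lin_emb)
  have "y k = x k" for k
  proof (cases "k < n")
    case True
    have "pi_i n i s k = pi_i n i s' k" using fun_cong[OF eq, of "(n, i)"] e by (simp add: pi_lim_def)
    then have "\<nu> (i x k) = \<nu> (i y k)"
      using True lin_emb_coords[OF e True] by (simp add: pi_i_def x y point_seminorm_def logT_v)
    then have "-\<infinity> = \<nu> (y k - x k)" using True by (simp add: i_def)
    then have "v (y k - x k) = 0" by (metis expT_MInf)
    then show ?thesis by (simp only: v_eq_0_iff right_minus_eq)
  next
    case False
    then show ?thesis using x y closed_X by (auto simp: zariski_closed_def aff_def)
  qed
  then have "x = y" by auto
  then show "s = s'" using x y by simp
qed

end

theorem theorem3p1:
  fixes \<nu> :: "'a::field \<Rightarrow> ereal" and n :: nat and X :: "(nat \<Rightarrow> 'a) set"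
  assumes "alg_closed TYPE('a)"
    and "nonarch_valuation \<nu>" and "nontrivial_valuation \<nu>" and "valuation_complete \<nu>"
    and "zariski_closed n X"
  shows "pi_lim n X ` Xan n \<nu> X = trop_limit n \<nu> X \<and> inj_on (pi_lim n X) (Xcl n \<nu> X)"
proof -
  interpret tropical_setting \<nu> n X by unfold_locales (use assms in auto)
  show ?thesis using pi_lim_in_trop_limit trop_limit_in_pi_lim inj_on_pi_lim_Xcl by blast
qed

end
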